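(* Let $n,k$ be integers with $1\le k\le n-2$, let $I=[a,b]$ with $a<b$, and let $a_j\in C^{n-j}(I)$ be real-valued for $j=1,\dots,n$. For $M\in\mathbb{R}$ let $$T_n[M]\,u(t)=u^{(n)}(t)+a_1(t)\,u^{(n-1)}(t)+\cdots+a_{n-1}(t)\,u'(t)+(a_n(t)+M)\,u(t),\quad t\in I.$$ Let $\bar M\in\mathbb{R}$ be such that the equation $T_n[\bar M]\,u(t)=0$ is disconjugate on $I$. Then the following two properties hold. (1) If $n-k$ is even, then the operator $T_n[M]$ is inverse positive on $X_k$ if and only if $M\in(\bar M-\lambda_1,\bar M-\lambda_2]$, where: - $\lambda_1>0$ is the least positive eigenvalue of $T_n[\bar M]$ in $X_k$; - $\lambda_2<0$ is the maximum of $\lambda_2'<0$, the biggest negative eigenvalue of $T_n[\bar M]$ in $X_{k-1}$, and $\lambda_2''<0$, the biggest negative eigenvalue of $T_n[\bar M]$ in $X_{k+1}$. (2) If $n-k$ is odd, then the operator $T_n[M]$ is inverse negative on $X_k$ if and only if $M\in[\bar M-\lambda_2,\bar M-\lambda_1)$, where: - $\lambda_1<0$ is the biggest negative eigenvalue of $T_n[\bar M]$ in $X_k$; - $\lambda_2>0$ is the minimum of $\lambda_2'>0$, the least positive eigenvalue of $T_n[\bar M]$ in $X_{k-1}$, and $\lambda_2''>0$, the least positive eigenvalue of $T_n[\bar M]$ in $X_{k+1}$. When $k=1$, the space $X_{k-1}=X_0$ carries no eigenvalues, and $\lambda_2$ is understood to be $\lambda_2''$.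
   Context: For $0\le m\le n$, $X_m=\{u\in C^n(I) : u(a)=u'(a)=\cdots=u^{(m-1)}(a)=0,\ u(b)=u'(b)=\cdots=u^{(n-m-1)}(b)=0\}$ ($m$ conditions at $a$ and $n-m$ conditions at $b$). The linear equation $T_n[M]u=0$ is disconjugate on $I$ if every nontrivial solution has fewer than $n$ zeros on $I$, counted with multiplicity. A real number $\lambda$ is an eigenvalue of $T_n[\bar M]$ in $X_m$ if there is a nontrivial $u\in X_m$ with $T_n[\bar M]\,u=\lambda u$ on $I$. "Biggest negative eigenvalue" means the negative eigenvalue closest to zero. $T_n[M]$ is inverse positive (respectively inverse negative) on $X_k$ if every $u\in X_k$ with $T_n[M]\,u\ge0$ on $I$ satisfies $u\ge0$ (respectively $u\le0$) on $I$. *)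

theory Defs
  imports "HOL-Analysis.Analysis"
begin

text \<open>
  Functions on \<open>I = [a,b]\<close> are represented by total functions on the reals, of which only
  the values on \<open>I\<close> matter: all derivatives are taken within \<open>I\<close>, hence are
  one-sided at \<open>a\<close> and \<open>b\<close>.
\<close>

definition nderiv :: "real \<Rightarrow> real \<Rightarrow> nat \<Rightarrow> (real \<Rightarrow> real) \<Rightarrow> real \<Rightarrow> real" where
  "nderiv a b i u = ((\<lambda>f t. vector_derivative f (at t within {a..b})) ^^ i) u"

text \<open>Continuity of the derivatives of order below \<open>m\<close> follows from their differentiability.\<close>

definition Cm_on :: "real \<Rightarrow> real \<Rightarrow> nat \<Rightarrow> (real \<Rightarrow> real) \<Rightarrow> bool" where
  "Cm_on a b m u \<longleftrightarrow>
     (\<forall>i<m. nderiv a b i u differentiable_on {a..b}) \<and> continuous_on {a..b} (nderiv a b m u)"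

text \<open>The coefficient \<open>a\<^sub>j\<close> is \<open>c j\<close> for \<open>j = 1, \<dots>, n\<close>; other values of \<open>c\<close> are irrelevant.\<close>

definition T_op ::
    "real \<Rightarrow> real \<Rightarrow> nat \<Rightarrow> (nat \<Rightarrow> real \<Rightarrow> real) \<Rightarrow> real \<Rightarrow> (real \<Rightarrow> real) \<Rightarrow> real \<Rightarrow> real" where
  "T_op a b n c M u t =
     nderiv a b n u t + (\<Sum>j=1..<n. c j t * nderiv a b (n - j) u t) + (c n t + M) * u t"

definition nontrivial_on :: "real \<Rightarrow> real \<Rightarrow> (real \<Rightarrow> real) \<Rightarrow> bool" where
  "nontrivial_on a b u \<longleftrightarrow> (\<exists>t\<in>{a..b}. u t \<noteq> 0)"

text \<open>
  The multiplicity is capped at \<open>n\<close>, since derivatives of a \<open>C\<^sup>n\<close> function beyond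
  order \<open>n\<close> need not exist. The cap does not affect disconjugacy: a zero reaching it
  already accounts for \<open>n\<close> zeros.
\<close>

definition zero_mult :: "real \<Rightarrow> real \<Rightarrow> nat \<Rightarrow> (real \<Rightarrow> real) \<Rightarrow> real \<Rightarrow> nat" where
  "zero_mult a b n u t = (LEAST i. i = n \<or> nderiv a b i u t \<noteq> 0)"

text \<open>Finiteness is explicit because a sum over an infinite set is \<open>0\<close>.\<close>

definition disconjugate ::
    "real \<Rightarrow> real \<Rightarrow> nat \<Rightarrow> (nat \<Rightarrow> real \<Rightarrow> real) \<Rightarrow> real \<Rightarrow> bool" where
  "disconjugate a b n c M \<longleftrightarrow>
     (\<forall>u. Cm_on a b n u \<and> (\<forall>t\<in>{a..b}. T_op a b n c M u t = 0) \<and> nontrivial_on a b u \<longrightarrow>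
        finite {t\<in>{a..b}. u t = 0} \<and> (\<Sum>t | t \<in> {a..b} \<and> u t = 0. zero_mult a b n u t) < n)"

definition X_space :: "real \<Rightarrow> real \<Rightarrow> nat \<Rightarrow> nat \<Rightarrow> (real \<Rightarrow> real) set" where
  "X_space a b n m =
     {u. Cm_on a b n u \<and> (\<forall>i<m. nderiv a b i u a = 0) \<and> (\<forall>i<n - m. nderiv a b i u b = 0)}"

definition eigenvalue_in ::
    "real \<Rightarrow> real \<Rightarrow> nat \<Rightarrow> (nat \<Rightarrow> real \<Rightarrow> real) \<Rightarrow> real \<Rightarrow> nat \<Rightarrow> real \<Rightarrow> bool" where
  "eigenvalue_in a b n c M m r \<longleftrightarrow>
     (\<exists>u\<in>X_space a b n m. nontrivial_on a b u \<and> (\<forall>t\<in>{a..b}. T_op a b n c M u t = r * u t))"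

definition least_pos_eigenvalue ::
    "real \<Rightarrow> real \<Rightarrow> nat \<Rightarrow> (nat \<Rightarrow> real \<Rightarrow> real) \<Rightarrow> real \<Rightarrow> nat \<Rightarrow> real \<Rightarrow> bool" where
  "least_pos_eigenvalue a b n c M m r \<longleftrightarrow>
     eigenvalue_in a b n c M m r \<and> 0 < r \<and>
     (\<forall>\<mu>. eigenvalue_in a b n c M m \<mu> \<and> 0 < \<mu> \<longrightarrow> r \<le> \<mu>)"

definition biggest_neg_eigenvalue ::
    "real \<Rightarrow> real \<Rightarrow> nat \<Rightarrow> (nat \<Rightarrow> real \<Rightarrow> real) \<Rightarrow> real \<Rightarrow> nat \<Rightarrow> real \<Rightarrow> bool" where
  "biggest_neg_eigenvalue a b n c M m r \<longleftrightarrow>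
     eigenvalue_in a b n c M m r \<and> r < 0 \<and>
     (\<forall>\<mu>. eigenvalue_in a b n c M m \<mu> \<and> \<mu> < 0 \<longrightarrow> \<mu> \<le> r)"

definition inverse_positive ::
    "real \<Rightarrow> real \<Rightarrow> nat \<Rightarrow> (nat \<Rightarrow> real \<Rightarrow> real) \<Rightarrow> real \<Rightarrow> nat \<Rightarrow> bool" where
  "inverse_positive a b n c M k \<longleftrightarrow>
     (\<forall>u\<in>X_space a b n k.
        (\<forall>t\<in>{a..b}. 0 \<le> T_op a b n c M u t) \<longrightarrow> (\<forall>t\<in>{a..b}. 0 \<le> u t))"

definition inverse_negative ::
    "real \<Rightarrow> real \<Rightarrow> nat \<Rightarrow> (nat \<Rightarrow> real \<Rightarrow> real) \<Rightarrow> real \<Rightarrow> nat \<Rightarrow> bool" where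
  "inverse_negative a b n c M k \<longleftrightarrow>
     (\<forall>u\<in>X_space a b n k.
        (\<forall>t\<in>{a..b}. 0 \<le> T_op a b n c M u t) \<longrightarrow> (\<forall>t\<in>{a..b}. u t \<le> 0))"

end

theory Submission
  imports Defs
begin

text \<open>
  With \<open>A = (-1)^(n-k) T\<^sub>n[Mbar]\<close> and \<open>\<mu> = (-1)^(n-k) (Mbar - M)\<close> both cases become one statement
  about \<open>A - \<mu>\<close> on \<open>X\<^sub>k\<close>; let \<open>l\<^sub>1\<close> be the least positive eigenvalue of \<open>A\<close> there and \<open>l\<^sub>2\<close> the
  least positive eigenvalue of \<open>-A\<close> on the two neighbouring spaces. Disconjugacy factors \<open>A\<close> on the
  half-open interval \<open>(a,b]\<close> through solutions with prescribed zeros at \<open>a\<close>. In this factorization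
  \<open>k\<close> of the intermediate functions vanish at \<open>a\<close> and the others at \<open>b\<close>, so signs and sign patterns of
  \<open>A u\<close> propagate to \<open>u\<close> by the mean value theorem. This gives the case \<open>\<mu> = 0\<close>. Positivity persists
  to the right up to \<open>l\<^sub>1\<close> and not beyond, since a positive resolvent beyond \<open>l\<^sub>1\<close> would dominate
  resolvents that blow up at \<open>l\<^sub>1\<close>.

  For \<open>\<mu> = -\<nu>\<close> with \<open>0 \<le> \<nu> < l\<^sub>2\<close> one uses that \<open>-A - \<nu>\<close> is inverse positive on the neighbouring
  spaces: a nonnegative solution of \<open>(A + \<nu>) u = f \<ge> 0\<close> cannot have a zero of higher order than
  required at \<open>a\<close> or \<open>b\<close>, and for tent-shaped \<open>f\<close> the sign pattern \<open>(-, +, -)\<close> of \<open>A u\<close> excludes interior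
  zeros; hence positivity survives as \<open>\<nu>\<close> grows to \<open>l\<^sub>2\<close>. Beyond \<open>l\<^sub>2\<close>, a positive supersolution in a
  neighbouring space contradicts inverse positivity.
\<close>

section \<open>Linear algebra and differentiable functions\<close>

text \<open>The solutions used as factors have zeros at \<open>a\<close>, so a boundary condition at
  \<open>a\<close> survives only as a limit of \<open>J i u / V i\<close>, to be proved separately,
  while the conditions at \<open>b\<close> are plain values. No Green's function appears: a
  parameter is moved by a continuity argument whose only quantitative input is a resolvent bound in
  the C^n norm. That norm is forced: elements of \<open>X k\<close> vanish at both ends, so
  positivity can be stable only if the leading derivatives there are controlled. These two
  coefficients are what the spaces \<open>X (k + 1)\<close> and \<open>X (k - 1)\<close> govern. For
  negative parameters the image A u = f - \<nu> u has no sign and, for general f, no usable pattern.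
  A tent steeper than the Lipschitz constant of \<nu> u forces the pattern, and nonnegative sums of
  tents approximate every nonnegative f. The eigenvalues are not postulated: without a positive one,
  inverse positivity would persist for all large parameters, which a single bump function
  refutes.\<close>

lemma underdetermined_nontrivial:
  fixes B :: "nat \<Rightarrow> 'j \<Rightarrow> real"
  assumes "finite J" "m < card J"
  shows "\<exists>x. (\<exists>j\<in>J. x j \<noteq> 0) \<and> (\<forall>i<m. (\<Sum>j\<in>J. B i j * x j) = 0)"
  using assms
proof (induction m arbitrary: J B)
  case 0
  then obtain j where "j \<in> J" by fastforce
  then show ?case by (intro exI[of _ "\<lambda>_. 1"]) auto
next
  case (Suc m)
  show ?case
  proof (cases "\<forall>j\<in>J. B m j = 0")
    case True
    have "\<exists>x. (\<exists>j\<in>J. x j \<noteq> 0) \<and> (\<forall>i<m. (\<Sum>j\<in>J. B i j * x j) = 0)"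
      using Suc.IH[OF Suc.prems(1)] Suc.prems(2) by simp
    with True show ?thesis by (auto simp: less_Suc_eq)
  next
    case False
    then obtain j0 where j0: "j0 \<in> J" "B m j0 \<noteq> 0" by blast
    \<comment> \<open>Gaussian elimination with pivot \<open>B m j0\<close>. The pivot column may be
      any element of \<open>J\<close>, which is why the unknowns are indexed by an arbitrary finite
      set and not by an initial segment.\<close>
    define B' where "B' = (\<lambda>i j. B i j - B i j0 * B m j / B m j0)"
    have "m < card (J - {j0})" using Suc.prems j0 by simp
    from Suc.IH[OF _ this, of B'] Suc.prems(1)
    obtain x where x: "\<exists>j\<in>J-{j0}. x j \<noteq> 0" "\<And>i. i < m \<Longrightarrow> (\<Sum>j\<in>J-{j0}. B' i j * x j) = 0"
      by auto
    define s where "s = (\<Sum>j\<in>J-{j0}. B m j * x j) / B m j0"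
    define y where "y = x(j0 := - s)"
    have split: "(\<Sum>j\<in>J. B i j * y j) = (\<Sum>j\<in>J-{j0}. B i j * x j) - B i j0 * s" for i
    proof -
      have "(\<Sum>j\<in>J. B i j * y j) = B i j0 * y j0 + (\<Sum>j\<in>J-{j0}. B i j * y j)"
        using Suc.prems(1) j0(1) by (simp add: sum.remove)
      also have "(\<Sum>j\<in>J-{j0}. B i j * y j) = (\<Sum>j\<in>J-{j0}. B i j * x j)"
        by (rule sum.cong) (auto simp: y_def)
      finally show ?thesis by (simp add: y_def)
    qed
    have "(\<Sum>j\<in>J. B i j * y j) = 0" if "i < Suc m" for i
    proof (cases "i = m")
      case True
      then show ?thesis using j0 by (simp add: split s_def)
    next
      case False
      then have "(\<Sum>j\<in>J-{j0}. B' i j * x j) = 0" using that x(2) by simp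
      moreover have "(\<Sum>j\<in>J-{j0}. B' i j * x j) = (\<Sum>j\<in>J-{j0}. B i j * x j) - B i j0 * s"
        by (simp add: B'_def s_def algebra_simps sum_subtractf sum_distrib_left sum_divide_distrib)
      ultimately show ?thesis by (simp add: split)
    qed
    moreover have "\<exists>j\<in>J. y j \<noteq> 0" using x(1) by (auto simp: y_def)
    ultimately show ?thesis by blast
  qed
qed

text \<open>Appending \<open>- \<beta>\<close> as a further column makes the system underdetermined.
  Injectivity forbids a kernel vector whose last entry vanishes, so one may divide by it.\<close>

lemma injective_imp_solvable:
  fixes B :: "nat \<Rightarrow> nat \<Rightarrow> real"
  assumes inj: "\<And>x. (\<forall>i<m. (\<Sum>j<m. B i j * x j) = 0) \<Longrightarrow> \<forall>j<m. x j = 0"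
  shows "\<exists>x. \<forall>i<m. (\<Sum>j<m. B i j * x j) = \<beta> i"
proof -
  define B' where "B' = (\<lambda>i j. if j = m then - \<beta> i else B i j)"
  obtain x where x: "\<exists>j\<in>{..<Suc m}. x j \<noteq> 0"
    "\<And>i. i < m \<Longrightarrow> (\<Sum>j<Suc m. B' i j * x j) = 0"
    using underdetermined_nontrivial[of "{..<Suc m}" m B'] by auto
  have eq: "(\<Sum>j<m. B i j * x j) = \<beta> i * x m" if "i < m" for i
  proof -
    have "(\<Sum>j<m. B' i j * x j) = (\<Sum>j<m. B i j * x j)"
      by (rule sum.cong) (auto simp: B'_def)
    then show ?thesis using x(2)[OF that] by (simp add: B'_def)
  qed
  have "x m \<noteq> 0"
  proof
    assume "x m = 0"
    then have "\<forall>j<m. x j = 0" using inj eq by simp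
    with x(1) \<open>x m = 0\<close> show False by (auto simp: less_Suc_eq)
  qed
  then have "(\<Sum>j<m. B i j * (x j / x m)) = \<beta> i" if "i < m" for i
    using eq[OF that] by (simp add: sum_divide_distrib[symmetric] field_simps)
  then show ?thesis by (intro exI[of _ "\<lambda>j. x j / x m"]) auto
qed

text \<open>Continuity method: the counterexamples would have an infimum, which the closedness
  hypothesis puts into \<open>P\<close> and the openness hypothesis pushes away from them. All
  homotopies in the spectral parameter run through this rule.\<close>

lemma real_interval_induct:
  fixes P :: "real \<Rightarrow> bool"
  assumes start: "P x0" and xy: "x0 \<le> x1"
    and closed: "\<And>s. x0 < s \<Longrightarrow> s \<le> x1 \<Longrightarrow> (\<And>x. x0 \<le> x \<Longrightarrow> x < s \<Longrightarrow> P x) \<Longrightarrow> P s"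
    and opened: "\<And>s. x0 \<le> s \<Longrightarrow> s < x1 \<Longrightarrow> (\<And>x. x0 \<le> x \<Longrightarrow> x \<le> s \<Longrightarrow> P x) \<Longrightarrow>
      \<exists>\<delta>>0. \<forall>x. s < x \<and> x < s + \<delta> \<and> x \<le> x1 \<longrightarrow> P x"
  shows "\<forall>x. x0 \<le> x \<and> x \<le> x1 \<longrightarrow> P x"
proof (rule ccontr)
  assume "\<not> ?thesis"
  then obtain z where z: "x0 \<le> z" "z \<le> x1" "\<not> P z" by blast
  define A where "A = {x. x0 \<le> x \<and> x \<le> x1 \<and> \<not> P x}"
  have A: "z \<in> A" "bdd_below A" using z by (auto simp: A_def intro!: bdd_belowI[of _ x0])
  define s where "s = Inf A"
  have s1: "x0 \<le> s" unfolding s_def by (rule cInf_greatest) (use A in \<open>auto simp: A_def\<close>)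
  have s2: "s \<le> x1" using cInf_lower[OF A] z by (simp add: s_def)
  have below: "P x" if "x0 \<le> x" "x < s" for x
  proof (rule ccontr)
    assume "\<not> P x"
    then have "x \<in> A" using that s2 by (auto simp: A_def)
    then show False using cInf_lower[OF _ A(2)] that by (auto simp: s_def not_less[symmetric])
  qed
  have Ps: "P s" using start closed[of s] below s1 s2 by (cases "s = x0") auto
  have "s < x1"
  proof (rule ccontr)
    assume "\<not> s < x1"
    then have "z = s \<or> z < s" using z s2 by auto
    then show False using Ps below z by auto
  qed
  moreover have "P x" if "x0 \<le> x" "x \<le> s" for x using that below Ps by (cases "x = s") auto
  ultimately obtain \<delta> where \<delta>: "\<delta> > 0" "\<And>x. s < x \<Longrightarrow> x < s + \<delta> \<Longrightarrow> x \<le> x1 \<Longrightarrow> P x"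
    using opened[of s] s1 by blast
  have "s + \<delta> \<le> x" if "x \<in> A" for x
  proof (rule ccontr)
    assume "\<not> s + \<delta> \<le> x"
    moreover have "s \<le> x" using cInf_lower[OF that A(2)] by (simp add: s_def)
    moreover have "x \<noteq> s" using that Ps by (auto simp: A_def)
    ultimately show False using \<delta>(2)[of x] that by (auto simp: A_def)
  qed
  then have "s + \<delta> \<le> Inf A" by (intro cInf_greatest) (use A in auto)
  with \<delta>(1) show False by (simp add: s_def)
qed

lemma nonpos_if_le_small_multiples:
  fixes z D r :: real
  assumes "0 < r" "0 \<le> D" and le: "\<And>\<delta>. 0 < \<delta> \<Longrightarrow> \<delta> \<le> r \<Longrightarrow> z \<le> \<delta> * D"
  shows "z \<le> 0"
proof (rule field_le_epsilon)
  fix e :: real assume e: "0 < e"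
  define \<delta> where "\<delta> = min r (e / (1 + D))"
  have \<delta>: "0 < \<delta>" "\<delta> \<le> r" "\<delta> \<le> e / (1 + D)" using assms e by (auto simp: \<delta>_def)
  have "z \<le> \<delta> * D" by (rule le[OF \<delta>(1,2)])
  also have "\<dots> \<le> e / (1 + D) * (1 + D)" using \<delta> assms e by (intro mult_mono) auto
  also have "\<dots> = e" using assms by simp
  finally show "z \<le> 0 + e" by simp
qed

section \<open>Smoothness classes and derivative towers\<close>

lemma mvt_within:
  fixes f f' :: "real \<Rightarrow> real"
  assumes "s < t" "{s..t} \<subseteq> S"
    and "\<And>x. x \<in> S \<Longrightarrow> (f has_real_derivative f' x) (at x within S)"
  shows "\<exists>x. s < x \<and> x < t \<and> f t - f s = f' x * (t - s)"
proof -
  have "\<exists>x\<in>{s<..<t}. f t - f s = (\<lambda>y. f' x * y) (t - s)"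
  proof (rule mvt_simple[OF assms(1)])
    fix x assume "s \<le> x" "x \<le> t"
    then have "(f has_real_derivative f' x) (at x within {s..t})"
      using assms DERIV_subset by (metis atLeastAtMost_iff subsetD)
    then show "(f has_derivative (\<lambda>y. f' x * y)) (at x within {s..t})"
      by (simp add: has_field_derivative_def)
  qed
  then show ?thesis by auto
qed

text \<open>The set is arbitrary because the coefficients of the factors are smooth only on (a,b].
  The derivative is existential, so that closure under products and quotients is an induction on the
  order.\<close>

primrec Cm_set :: "real set \<Rightarrow> nat \<Rightarrow> (real \<Rightarrow> real) \<Rightarrow> bool" where
  "Cm_set S 0 f \<longleftrightarrow> continuous_on S f"
| "Cm_set S (Suc m) f \<longleftrightarrow>
     (\<exists>f'. (\<forall>t\<in>S. (f has_real_derivative f' t) (at t within S)) \<and> Cm_set S m f')"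

lemma Cm_set_imp_continuous: "Cm_set S m f \<Longrightarrow> continuous_on S f"
  by (cases m) (auto simp: continuous_on_eq_continuous_within intro: DERIV_continuous)

lemma Cm_set_SucD: "Cm_set S (Suc m) f \<Longrightarrow> Cm_set S m f"
proof (induction m arbitrary: f)
  case 0
  then show ?case using Cm_set_imp_continuous[OF 0] by simp
next
  case (Suc m)
  then obtain f' where "\<forall>t\<in>S. (f has_real_derivative f' t) (at t within S)" "Cm_set S (Suc m) f'"
    by auto
  with Suc.IH show ?case by auto
qed

lemma Cm_set_mono: "Cm_set S m f \<Longrightarrow> l \<le> m \<Longrightarrow> Cm_set S l f"
proof (induction m)
  case (Suc m)
  then show ?case by (metis Cm_set_SucD le_Suc_eq)
qed simp

lemma Cm_set_const: "Cm_set S m (\<lambda>_. c)"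
  by (induction m arbitrary: c) (auto intro!: exI[of _ "\<lambda>_. 0"])

lemma Cm_set_add: "Cm_set S m f \<Longrightarrow> Cm_set S m g \<Longrightarrow> Cm_set S m (\<lambda>t. f t + g t)"
proof (induction m arbitrary: f g)
  case 0
  then show ?case by (auto intro: continuous_intros)
next
  case (Suc m)
  from Suc.prems obtain f' g' where
    "\<forall>t\<in>S. (f has_real_derivative f' t) (at t within S)" "Cm_set S m f'"
    "\<forall>t\<in>S. (g has_real_derivative g' t) (at t within S)" "Cm_set S m g'" by auto
  then show ?case using Suc.IH[of f' g']
    by (auto intro!: exI[of _ "\<lambda>t. f' t + g' t"] derivative_intros)
qed

lemma Cm_set_mult: "Cm_set S m f \<Longrightarrow> Cm_set S m g \<Longrightarrow> Cm_set S m (\<lambda>t. f t * g t)"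
proof (induction m arbitrary: f g)
  case 0
  then show ?case by (auto intro: continuous_intros)
next
  case (Suc m)
  from Suc.prems obtain f' g' where
    f': "\<And>t. t\<in>S \<Longrightarrow> (f has_real_derivative f' t) (at t within S)" "Cm_set S m f'" and
    g': "\<And>t. t\<in>S \<Longrightarrow> (g has_real_derivative g' t) (at t within S)" "Cm_set S m g'" by auto
  have "Cm_set S m (\<lambda>t. f' t * g t + g' t * f t)"
    using Suc.IH Suc.prems f' g' by (intro Cm_set_add) (blast dest: Cm_set_SucD)+
  then show ?case using DERIV_mult[OF f'(1) g'(1)]
    by (auto intro!: exI[of _ "\<lambda>t. f' t * g t + g' t * f t"])
qed

lemma Cm_set_minus: "Cm_set S m f \<Longrightarrow> Cm_set S m (\<lambda>t. - f t)"
  using Cm_set_mult[OF Cm_set_const[of S m "-1"]] by simp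

lemma Cm_set_diff: "Cm_set S m f \<Longrightarrow> Cm_set S m g \<Longrightarrow> Cm_set S m (\<lambda>t. f t - g t)"
  unfolding diff_conv_add_uminus by (intro Cm_set_add Cm_set_minus)

lemma Cm_set_sum:
  "finite J \<Longrightarrow> (\<And>j. j \<in> J \<Longrightarrow> Cm_set S m (f j)) \<Longrightarrow> Cm_set S m (\<lambda>t. \<Sum>j\<in>J. f j t)"
  by (induction J rule: finite_induct) (auto intro: Cm_set_const Cm_set_add)

lemma Cm_set_inverse:
  "Cm_set S m f \<Longrightarrow> (\<And>t. t \<in> S \<Longrightarrow> f t \<noteq> 0) \<Longrightarrow> Cm_set S m (\<lambda>t. inverse (f t))"
proof (induction m)
  case 0
  then show ?case by (auto intro: continuous_intros)
next
  case (Suc m)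
  from Suc.prems obtain f' where
    f': "\<And>t. t\<in>S \<Longrightarrow> (f has_real_derivative f' t) (at t within S)" "Cm_set S m f'" by auto
  have i: "Cm_set S m (\<lambda>t. inverse (f t))"
    using Suc.IH Suc.prems Cm_set_SucD by blast
  have "Cm_set S m (\<lambda>t. - (inverse (f t) * f' t * inverse (f t)))"
    using i f' by (intro Cm_set_minus Cm_set_mult)
  moreover have "((\<lambda>t. inverse (f t)) has_real_derivative
      - (inverse (f t) * f' t * inverse (f t))) (at t within S)" if "t \<in> S" for t
    using DERIV_inverse'[OF f'(1)] Suc.prems(2) that by blast
  ultimately show ?case
    by (auto intro!: exI[of _ "\<lambda>t. - (inverse (f t) * f' t * inverse (f t))"])
qed

lemma Cm_set_divide:
  "Cm_set S m f \<Longrightarrow> Cm_set S m g \<Longrightarrow> (\<And>t. t \<in> S \<Longrightarrow> g t \<noteq> 0) \<Longrightarrow> Cm_set S m (\<lambda>t. f t / g t)"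
  unfolding divide_inverse by (intro Cm_set_mult Cm_set_inverse)

text \<open>Functions are carried together with their derivatives, so that linear combinations
  raise no differentiability side conditions.\<close>

definition tower :: "real set \<Rightarrow> nat \<Rightarrow> (nat \<Rightarrow> real \<Rightarrow> real) \<Rightarrow> bool" where
  "tower S n g \<longleftrightarrow>
     (\<forall>i<n. \<forall>t\<in>S. (g i has_real_derivative g (Suc i) t) (at t within S)) \<and> continuous_on S (g n)"

lemma tower_deriv:
  "tower S n g \<Longrightarrow> i < n \<Longrightarrow> t \<in> S \<Longrightarrow> (g i has_real_derivative g (Suc i) t) (at t within S)"
  by (simp add: tower_def)

lemma tower_continuous:
  assumes "tower S n g" "i \<le> n"
  shows "continuous_on S (g i)"
proof (cases "i = n")
  case False
  then show ?thesis unfolding continuous_on_eq_continuous_within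
    using tower_deriv[OF assms(1)] assms(2) by (meson DERIV_continuous nat_less_le)
qed (use assms in \<open>simp add: tower_def\<close>)

lemma tower_add: "tower S n g \<Longrightarrow> tower S n h \<Longrightarrow> tower S n (\<lambda>i t. g i t + h i t)"
  by (auto simp: tower_def intro!: derivative_intros continuous_intros)

lemma tower_scale: "tower S n g \<Longrightarrow> tower S n (\<lambda>i t. c * g i t)"
  by (auto simp: tower_def intro!: derivative_eq_intros continuous_intros)

lemma tower_diff: "tower S n g \<Longrightarrow> tower S n h \<Longrightarrow> tower S n (\<lambda>i t. g i t - h i t)"
  by (auto simp: tower_def intro!: derivative_intros continuous_intros)

lemma tower_zero: "tower S n (\<lambda>i t. 0)"
  by (auto simp: tower_def intro!: derivative_eq_intros)

lemma tower_sum: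
  "finite J \<Longrightarrow> (\<And>j. j \<in> J \<Longrightarrow> tower S n (g j)) \<Longrightarrow> tower S n (\<lambda>i t. \<Sum>j\<in>J. g j i t)"
  by (induction J rule: finite_induct) (auto intro: tower_zero tower_add)

lemma tower_subset:
  "tower S n g \<Longrightarrow> S' \<subseteq> S \<Longrightarrow> tower S' n g"
  by (auto simp: tower_def intro: DERIV_subset continuous_on_subset)

lemma tower_imp_Cm_set: "tower S n g \<Longrightarrow> i \<le> n \<Longrightarrow> Cm_set S (n - i) (g i)"
proof (induction "n - i" arbitrary: i)
  case 0
  then show ?case using tower_continuous[of S n g i] by auto
next
  case (Suc m)
  then have "Cm_set S (n - Suc i) (g (Suc i))" by (metis Suc_diff_Suc Suc_inject Suc_leI zero_less_Suc zero_less_diff)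
  moreover have "n - i = Suc (n - Suc i)" using Suc by simp
  moreover have "i < n" using Suc.hyps by simp
  ultimately show ?case using tower_deriv[OF Suc.prems(1)]
    by (metis Cm_set.simps(2) Suc_diff_Suc)
qed

lemma Cm_set_imp_tower: "Cm_set S n f \<Longrightarrow> \<exists>g. tower S n g \<and> g 0 = f"
proof (induction n arbitrary: f)
  case 0
  then show ?case by (intro exI[of _ "\<lambda>_. f"]) (auto simp: tower_def)
next
  case (Suc n)
  then obtain f' where
    f': "\<And>t. t\<in>S \<Longrightarrow> (f has_real_derivative f' t) (at t within S)" "Cm_set S n f'" by auto
  obtain g where g: "tower S n g" "g 0 = f'" using Suc.IH[OF f'(2)] by auto
  show ?case
    using g f'(1) by (intro exI[of _ "case_nat f g"]) (auto simp: tower_def split: nat.split)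
qed


text \<open>One-sided derivatives are unique on a nondegenerate interval. The subinterval
  \<open>{c..d}\<close> matters for cutoffs, which coincide with a solution only near one end
  point.\<close>

lemma tower_eq_on:
  fixes c d :: real
  assumes "tower S n g" "tower S n h" "{c..d} \<subseteq> S" "c < d"
    and eq: "\<And>t. t \<in> {c..d} \<Longrightarrow> g 0 t = h 0 t"
    and "i \<le> n" "t \<in> {c..d}"
  shows "g i t = h i t"
  using assms(6,7)
proof (induction i arbitrary: t)
  case 0
  then show ?case using eq by blast
next
  case (Suc i)
  have i: "i < n" "t \<in> S" using Suc.prems assms(3) by auto
  have 1: "(g i has_real_derivative g (Suc i) t) (at t within {c..d})"
    "(h i has_real_derivative h (Suc i) t) (at t within {c..d})"
    using tower_deriv[OF assms(1) i] tower_deriv[OF assms(2) i] DERIV_subset[OF _ assms(3)] by blast+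
  have "(g i has_real_derivative h (Suc i) t) (at t within {c..d})"
    by (rule has_field_derivative_transform_within[OF 1(2), of 1])
      (use Suc in auto)
  note 2 = 1(1) this
  show ?case
    by (rule vector_derivative_unique_within_closed_interval[OF assms(4) _
          2[unfolded has_real_derivative_iff_has_vector_derivative, folded cbox_interval]])
      (use Suc.prems in \<open>simp add: cbox_interval\<close>)
qed

section \<open>Linear differential equations\<close>

definition lin_op :: "nat \<Rightarrow> (nat \<Rightarrow> real \<Rightarrow> real) \<Rightarrow> (nat \<Rightarrow> real \<Rightarrow> real) \<Rightarrow> real \<Rightarrow> real" where
  "lin_op n p g t = g n t + (\<Sum>i<n. p i t * g i t)"

lemma lin_op_add: "lin_op n p (\<lambda>i t. g i t + h i t) t = lin_op n p g t + lin_op n p h t"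
  by (simp add: lin_op_def algebra_simps sum.distrib)

lemma lin_op_scale: "lin_op n p (\<lambda>i t. c * g i t) t = c * lin_op n p g t"
  by (simp add: lin_op_def algebra_simps sum_distrib_left)

lemma lin_op_diff: "lin_op n p (\<lambda>i t. g i t - h i t) t = lin_op n p g t - lin_op n p h t"
  by (simp add: lin_op_def algebra_simps sum_subtractf)

lemma lin_op_sum:
  "lin_op n p (\<lambda>i t. \<Sum>j\<in>J. c j * g j i t) t = (\<Sum>j\<in>J. c j * lin_op n p (g j) t)"
  by (induction J rule: infinite_finite_induct)
    (auto simp: lin_op_add lin_op_scale, simp_all add: lin_op_def)

lemma lin_op_continuous:
  assumes "\<And>i. i < n \<Longrightarrow> continuous_on S (p i)" "tower S n g"
  shows "continuous_on S (lin_op n p g)"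
  unfolding lin_op_def[abs_def]
  using assms by (intro continuous_intros tower_continuous[OF assms(2)]) auto

section \<open>Growth estimates\<close>

lemma nonneg_deriv_imp_le:
  fixes f f' :: "real \<Rightarrow> real"
  assumes "s \<le> t" "{s..t} \<subseteq> S"
    and "\<And>x. x \<in> S \<Longrightarrow> (f has_real_derivative f' x) (at x within S)"
    and "\<And>x. s < x \<Longrightarrow> x < t \<Longrightarrow> 0 \<le> f' x"
  shows "f s \<le> f t"
proof (cases "s = t")
  case False
  then obtain x where "s < x" "x < t" "f t - f s = f' x * (t - s)"
    using mvt_within[of s t S f f'] assms by auto
  with assms(4)[of x] show ?thesis
    by (metis diff_ge_0_iff_ge less_eq_real_def mult_nonneg_nonneg order_less_trans)
qed simp

text \<open>Gronwall's estimate in both directions of time: \<open>e t\<close> times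
  \<open>exp (- \<kappa> * t)\<close> decreases and \<open>e t\<close> times
  \<open>exp (\<kappa> * t)\<close> increases, so the base point may lie on either side.\<close>

lemma exp_growth:
  fixes e e' :: "real \<Rightarrow> real"
  assumes d: "\<And>t. t \<in> {a..b} \<Longrightarrow> (e has_real_derivative e' t) (at t within {a..b})"
    and le: "\<And>t. t \<in> {a..b} \<Longrightarrow> \<bar>e' t\<bar> \<le> \<kappa> * e t"
    and t0: "t0 \<in> {a..b}" and t: "t \<in> {a..b}"
  shows "e t \<le> e t0 * exp (\<kappa> * \<bar>t - t0\<bar>)"
proof (cases "t0 \<le> t")
  case True
  have "- (e t0 * exp (- \<kappa> * t0)) \<le> - (e t * exp (- \<kappa> * t))"
  proof (rule nonneg_deriv_imp_le[OF True])
    show "{t0..t} \<subseteq> {a..b}" using t0 t by auto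
    show "((\<lambda>x. - (e x * exp (- \<kappa> * x))) has_real_derivative
        (\<kappa> * e x - e' x) * exp (- \<kappa> * x)) (at x within {a..b})" if "x \<in> {a..b}" for x
      using d[OF that] by (auto intro!: derivative_eq_intros simp: algebra_simps)
    show "0 \<le> (\<kappa> * e x - e' x) * exp (- \<kappa> * x)" if "t0 < x" "x < t" for x
      using le[of x] that t0 t by auto
  qed
  then have "e t * exp (- \<kappa> * t) * exp (\<kappa> * t) \<le> e t0 * exp (- \<kappa> * t0) * exp (\<kappa> * t)"
    by (intro mult_right_mono) auto
  then show ?thesis using True by (simp add: mult.assoc flip: exp_add) (simp add: algebra_simps)
next
  case False
  have "e t * exp (\<kappa> * t) \<le> e t0 * exp (\<kappa> * t0)"
  proof (rule nonneg_deriv_imp_le[of t t0 "{a..b}"])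
    show "t \<le> t0" "{t..t0} \<subseteq> {a..b}" using t0 t False by auto
    show "((\<lambda>x. (e x * exp (\<kappa> * x))) has_real_derivative
        (\<kappa> * e x + e' x) * exp (\<kappa> * x)) (at x within {a..b})" if "x \<in> {a..b}" for x
      using d[OF that] by (auto intro!: derivative_eq_intros simp: algebra_simps)
    show "0 \<le> (\<kappa> * e x + e' x) * exp (\<kappa> * x)" if "t < x" "x < t0" for x
      using le[of x] that t0 t by auto
  qed
  then have "e t * exp (\<kappa> * t) * exp (- \<kappa> * t) \<le> e t0 * exp (\<kappa> * t0) * exp (- \<kappa> * t)"
    by (intro mult_right_mono) auto
  then show ?thesis using False by (simp add: mult.assoc flip: exp_add) (simp add: algebra_simps)
qed

lemma coefficients_bounded:
  fixes p :: "nat \<Rightarrow> real \<Rightarrow> real"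
  assumes "\<And>i. i < n \<Longrightarrow> continuous_on {a..b} (p i)"
  obtains K where "0 \<le> K" "\<And>t. t \<in> {a..b} \<Longrightarrow> (\<Sum>i<n. \<bar>p i t\<bar>) \<le> K"
proof -
  have "continuous_on {a..b} (\<lambda>t. \<Sum>i<n. \<bar>p i t\<bar>)" using assms by (intro continuous_intros) auto
  then have "bounded ((\<lambda>t. \<Sum>i<n. \<bar>p i t\<bar>) ` {a..b})"
    by (intro compact_imp_bounded compact_continuous_image) auto
  then obtain K where "\<And>t. t \<in> {a..b} \<Longrightarrow> \<bar>\<Sum>i<n. \<bar>p i t\<bar>\<bar> \<le> K"
    unfolding bounded_iff by fastforce
  then have "\<And>t. t \<in> {a..b} \<Longrightarrow> (\<Sum>i<n. \<bar>p i t\<bar>) \<le> \<bar>K\<bar>" by fastforce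
  then show ?thesis by (intro that[of "\<bar>K\<bar>"]) auto
qed

text \<open>The constant serves every function and every base point \<open>t0\<close> at once; this
  uniformity later allows base points to approach \<open>a\<close>.\<close>

lemma lin_op_apriori:
  fixes p :: "nat \<Rightarrow> real \<Rightarrow> real"
  assumes cont: "\<And>i. i < n \<Longrightarrow> continuous_on {a..b} (p i)"
  obtains C where "0 \<le> C"
    "\<And>g F t0 t i. tower {a..b} n g \<Longrightarrow> (\<And>s. s \<in> {a..b} \<Longrightarrow> \<bar>lin_op n p g s\<bar> \<le> F) \<Longrightarrow>
       t0 \<in> {a..b} \<Longrightarrow> t \<in> {a..b} \<Longrightarrow> i \<le> n \<Longrightarrow> \<bar>g i t\<bar> \<le> C * ((\<Sum>j<n. \<bar>g j t0\<bar>) + F)"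
proof -
  obtain K where K: "0 \<le> K" "\<And>t. t \<in> {a..b} \<Longrightarrow> (\<Sum>i<n. \<bar>p i t\<bar>) \<le> K"
    using coefficients_bounded[of n a b p] cont by blast
  define \<kappa> where "\<kappa> = 2 * n * (1 + K) * (1 + K)"
  define E where "E = exp (\<kappa> * \<bar>b - a\<bar>)"
  have "0 \<le> \<kappa>" using K by (simp add: \<kappa>_def)
  then have E: "1 \<le> E" by (simp add: E_def)
  have "\<bar>g i t\<bar> \<le> (1 + K) * E * ((\<Sum>j<n. \<bar>g j t0\<bar>) + F)"
    if g: "tower {a..b} n g" and F: "\<And>s. s \<in> {a..b} \<Longrightarrow> \<bar>lin_op n p g s\<bar> \<le> F"
      and t0: "t0 \<in> {a..b}" and t: "t \<in> {a..b}" and i: "i \<le> n" for g F t0 t i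
  proof -
    \<comment> \<open>Including \<open>F\<close> in the energy absorbs the inhomogeneity:
      \<open>F\<close> and every \<open>g i t\<close> with \<open>i < n\<close> are bounded by
      \<open>s t\<close>, so the energy satisfies a homogeneous differential inequality.\<close>
    define e where "e = (\<lambda>t. (\<Sum>i<n. (g i t)\<^sup>2) + F\<^sup>2)"
    define s where "s = (\<lambda>t. sqrt (e t))"
    have F0: "0 \<le> F" using F[OF t0] by linarith
    have e0: "0 \<le> e t" for t by (auto simp: e_def intro!: add_nonneg_nonneg sum_nonneg)
    have s: "0 \<le> s t" "(s t)\<^sup>2 = e t" for t using e0[of t] by (auto simp: s_def)
    have gs: "\<bar>g i t\<bar> \<le> s t" if "i < n" for i t
    proof -
      have "(g i t)\<^sup>2 \<le> (\<Sum>i<n. (g i t)\<^sup>2)" using that by (intro member_le_sum) auto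
      also have "\<dots> \<le> e t" by (simp add: e_def)
      finally show ?thesis unfolding s_def by (simp add: real_le_rsqrt)
    qed
    have Fs: "F \<le> s t" for t
      unfolding s_def e_def by (intro real_le_rsqrt) (simp add: sum_nonneg)
    have gn: "\<bar>g n t\<bar> \<le> (1 + K) * s t" if "t \<in> {a..b}" for t
    proof -
      have "g n t = lin_op n p g t - (\<Sum>i<n. p i t * g i t)" by (simp add: lin_op_def)
      then have "\<bar>g n t\<bar> \<le> F + \<bar>\<Sum>i<n. p i t * g i t\<bar>" using F[OF that] by linarith
      also have "\<bar>\<Sum>i<n. p i t * g i t\<bar> \<le> (\<Sum>i<n. \<bar>p i t\<bar> * s t)"
        by (rule order_trans[OF sum_abs]) (intro sum_mono, auto simp: abs_mult intro!: mult_left_mono gs)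
      also have "\<dots> \<le> K * s t" unfolding sum_distrib_right[symmetric]
        using K(2)[OF that] s by (intro mult_right_mono) auto
      finally show ?thesis using Fs[of t] by (simp add: algebra_simps)
    qed
    have gi: "\<bar>g i t\<bar> \<le> (1 + K) * s t" if "t \<in> {a..b}" "i \<le> n" for i t
    proof (cases "i = n")
      case False
      then have "\<bar>g i t\<bar> \<le> s t" using gs that by auto
      also have "\<dots> \<le> (1 + K) * s t" using K s[of t] by (simp add: algebra_simps)
      finally show ?thesis .
    qed (use gn that in auto)
    have "(e has_real_derivative (\<Sum>i<n. 2 * g i t * g (Suc i) t)) (at t within {a..b})"
      if "t \<in> {a..b}" for t
      unfolding e_def
      by (auto intro!: derivative_eq_intros tower_deriv[OF g _ that] sum.cong)
    moreover have "\<bar>\<Sum>i<n. 2 * g i t * g (Suc i) t\<bar> \<le> \<kappa> * e t" if "t \<in> {a..b}" for t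
    proof -
      have "\<bar>\<Sum>i<n. 2 * g i t * g (Suc i) t\<bar> \<le> (\<Sum>i<n. 2 * (((1 + K) * s t) * ((1 + K) * s t)))"
      proof (rule order_trans[OF sum_abs], rule sum_mono)
        fix i assume "i \<in> {..<n}"
        then have "\<bar>g i t\<bar> * \<bar>g (Suc i) t\<bar> \<le> ((1 + K) * s t) * ((1 + K) * s t)"
          using gi[OF that, of i] gi[OF that, of "Suc i"] K s[of t] by (intro mult_mono) auto
        then show "\<bar>2 * g i t * g (Suc i) t\<bar> \<le> 2 * (((1 + K) * s t) * ((1 + K) * s t))"
          by (simp add: abs_mult)
      qed
      also have "\<dots> = \<kappa> * (s t)\<^sup>2" by (simp add: \<kappa>_def power2_eq_square)
      finally show ?thesis by (simp add: s)
    qed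
    ultimately have "e t \<le> e t0 * exp (\<kappa> * \<bar>t - t0\<bar>)"
      by (rule exp_growth[OF _ _ t0 t])
    also have "\<dots> \<le> e t0 * E"
      unfolding E_def using t t0 e0 \<open>0 \<le> \<kappa>\<close> by (intro mult_left_mono) (auto intro!: mult_left_mono)
    also have "\<dots> \<le> e t0 * E\<^sup>2" using E e0[of t0] by (simp add: power2_eq_square mult_left_mono)
    finally have "s t \<le> s t0 * E" unfolding s(2)[symmetric] power_mult_distrib[symmetric]
      using E s by (meson power2_le_imp_le mult_nonneg_nonneg order_trans zero_le_one)
    also have "s t0 \<le> (\<Sum>j<n. \<bar>g j t0\<bar>) + F"
      unfolding s_def
    proof (rule real_le_lsqrt)
      have "L2_set (\<lambda>j. g j t0) {..<n} \<le> (\<Sum>j<n. \<bar>g j t0\<bar>)" by (rule L2_set_le_sum_abs)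
      then have "(L2_set (\<lambda>j. g j t0) {..<n})\<^sup>2 \<le> (\<Sum>j<n. \<bar>g j t0\<bar>)\<^sup>2"
        by (intro power_mono) auto
      then have "e t0 \<le> (\<Sum>j<n. \<bar>g j t0\<bar>)\<^sup>2 + F\<^sup>2"
        by (simp add: e_def L2_set_def sum_nonneg)
      also have "\<dots> \<le> ((\<Sum>j<n. \<bar>g j t0\<bar>) + F)\<^sup>2"
        using F0 by (simp add: power2_sum sum_nonneg)
      finally show "e t0 \<le> ((\<Sum>j<n. \<bar>g j t0\<bar>) + F)\<^sup>2" .
    qed (use F0 in \<open>simp add: sum_nonneg\<close>)
    finally have "(1 + K) * s t \<le> (1 + K) * (((\<Sum>j<n. \<bar>g j t0\<bar>) + F) * E)"
      using E K by (intro mult_left_mono) auto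
    with gi[OF t i] show ?thesis by (simp add: algebra_simps)
  qed
  moreover have "0 \<le> (1 + K) * E" using K E by simp
  ultimately show ?thesis by (rule that[rotated])
qed

section \<open>Initial value and two-point problems\<close>

primrec iint :: "real \<Rightarrow> (real \<Rightarrow> real) \<Rightarrow> nat \<Rightarrow> real \<Rightarrow> real" where
  "iint a v 0 = v"
| "iint a v (Suc j) = (\<lambda>t. integral {a..t} (iint a v j))"

lemma iint_continuous: "continuous_on {a..b} v \<Longrightarrow> continuous_on {a..b} (iint a v j)"
  by (induction j) (auto intro!: indefinite_integral_continuous_1 integrable_continuous_interval)

lemma iint_deriv:
  assumes "continuous_on {a..b} v" "t \<in> {a..b}"
  shows "(iint a v (Suc j) has_real_derivative iint a v j t) (at t within {a..b})"
  using integral_has_real_derivative[OF iint_continuous[OF assms(1)] assms(2)] by simp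

lemma iint_diff:
  assumes "continuous_on {a..b} v" "continuous_on {a..b} w"
  shows "t \<in> {a..b} \<Longrightarrow> iint a (\<lambda>s. v s - w s) j t = iint a v j t - iint a w j t"
proof (induction j arbitrary: t)
  case (Suc j)
  have "integral {a..t} (iint a (\<lambda>s. v s - w s) j)
      = integral {a..t} (\<lambda>s. iint a v j s - iint a w j s)"
    using Suc by (intro integral_cong) auto
  also have "\<dots> = integral {a..t} (iint a v j) - integral {a..t} (iint a w j)"
    using Suc.prems assms
    by (intro integral_diff integrable_continuous_interval
        continuous_on_subset[OF iint_continuous[of a b]]) auto
  finally show ?case by simp
qed simp

text \<open>Each integration gains a factor \<open>1 / \<kappa>\<close> against the weight
  \<open>exp (\<kappa> * (t - a))\<close>; this makes the fixed point map below a contraction on the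
  whole interval.\<close>

lemma iint_bound:
  assumes v: "continuous_on {a..b} v" and "0 < \<kappa>"
    and le: "\<And>t. t \<in> {a..b} \<Longrightarrow> \<bar>v t\<bar> \<le> W * exp (\<kappa> * (t - a))" and "0 \<le> W"
  shows "t \<in> {a..b} \<Longrightarrow> \<bar>iint a v j t\<bar> \<le> W * exp (\<kappa> * (t - a)) / \<kappa> ^ j"
proof (induction j arbitrary: t)
  case (Suc j)
  have *: "0 \<le> W * exp (\<kappa> * (t - a)) / \<kappa> ^ Suc j + c * iint a v (Suc j) t"
    if c: "c = 1 \<or> c = -1" for c
  proof -
    have "W * exp (\<kappa> * (a - a)) / \<kappa> ^ Suc j + c * iint a v (Suc j) a
      \<le> W * exp (\<kappa> * (t - a)) / \<kappa> ^ Suc j + c * iint a v (Suc j) t"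
    proof (rule nonneg_deriv_imp_le[of a t "{a..b}"])
      show "((\<lambda>t. W * exp (\<kappa> * (t - a)) / \<kappa> ^ Suc j + c * iint a v (Suc j) t)
        has_real_derivative W * exp (\<kappa> * (x - a)) / \<kappa> ^ j + c * iint a v j x)
          (at x within {a..b})" if "x \<in> {a..b}" for x
        using \<open>0 < \<kappa>\<close> by (auto intro!: derivative_eq_intros iint_deriv[OF v that] simp del: iint.simps)
      show "0 \<le> W * exp (\<kappa> * (x - a)) / \<kappa> ^ j + c * iint a v j x" if "a < x" "x < t" for x
        using Suc.IH[of x] that Suc.prems c by auto
    qed (use Suc.prems in auto)
    moreover have "0 \<le> W / \<kappa> ^ Suc j" using assms by simp
    ultimately show ?thesis by simp
  qed
  show ?case using *[of 1] *[of "-1"] by (simp add: abs_le_iff del: iint.simps)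
qed (use le in auto)

text \<open>The unknown is the highest derivative \<open>v\<close>; the lower ones are its iterated
  integrals, which vanish at \<open>a\<close> by construction. Banach's theorem is applied in an
  exponentially weighted sup norm, in place of a subdivision of the interval.\<close>

lemma zero_data_solution:
  fixes p :: "nat \<Rightarrow> real \<Rightarrow> real"
  assumes ab: "a \<le> b" and cont: "\<And>i. i < n \<Longrightarrow> continuous_on {a..b} (p i)"
    and f: "continuous_on {a..b} f"
  shows "\<exists>g. tower {a..b} n g \<and> (\<forall>i<n. g i a = 0) \<and> (\<forall>t\<in>{a..b}. lin_op n p g t = f t)"
proof -
  obtain K where K: "0 \<le> K" "\<And>t. t \<in> {a..b} \<Longrightarrow> (\<Sum>i<n. \<bar>p i t\<bar>) \<le> K"
    using coefficients_bounded[of n a b p] cont by blast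
  \<comment> \<open>Twice the coefficient bound makes the contraction factor
    \<open>K / \<kappa>\<close> at most 1/2. The summand 1 keeps \<kappa> at least 1, so that its
    powers \<open>\<kappa> ^ (n - i)\<close> are at least \<kappa>.\<close>
  define \<kappa> where "\<kappa> = 1 + 2 * K"
  have \<kappa>: "1 \<le> \<kappa>" "K / \<kappa> \<le> 1 / 2" using K by (auto simp: \<kappa>_def field_simps)
  \<comment> \<open>Bounded continuous functions live on the whole line; clamping to [a,b] extends
    functions from the interval to it.\<close>
  define cl where "cl = (\<lambda>t::real. max a (min b t))"
  have cl: "cl t \<in> {a..b}" for t using ab by (auto simp: cl_def)
  have cl': "cl t = t" if "t \<in> {a..b}" for t using that by (auto simp: cl_def)
  \<comment> \<open>The weight is moved into the substitution, so that the plain metric for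
    \<open>w\<close> is the weighted one for \<open>V w\<close>.\<close>
  define V where "V = (\<lambda>(w :: real \<Rightarrow>\<^sub>C real) s. exp (\<kappa> * (s - a)) * apply_bcontfun w s)"
  have V: "continuous_on S (V w)" for S w
    unfolding V_def by (intro continuous_intros) auto
  define \<Psi> where "\<Psi> = (\<lambda>w s. exp (- (\<kappa> * (s - a))) * (f s - (\<Sum>i<n. p i s * iint a (V w) (n - i) s)))"
  have \<Psi>: "continuous_on {a..b} (\<Psi> w)" for w
    unfolding \<Psi>_def using cont f by (intro continuous_intros iint_continuous V) auto
  have mem: "(\<lambda>t. \<Psi> w (cl t)) \<in> bcontfun" for w
  proof -
    have "bounded (\<Psi> w ` {a..b})" using \<Psi> by (intro compact_imp_bounded compact_continuous_image) auto
    then have "bounded (range (\<lambda>t. \<Psi> w (cl t)))" by (rule bounded_subset) (use cl in auto)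
    moreover have "continuous_on UNIV (\<lambda>t. \<Psi> w (cl t))"
      by (rule continuous_on_compose2[OF \<Psi>]) (use cl in \<open>auto simp: cl_def intro!: continuous_intros\<close>)
    ultimately show ?thesis by (simp add: bcontfun_def)
  qed
  define \<Phi> where "\<Phi> = (\<lambda>w. Bcontfun (\<lambda>t. \<Psi> w (cl t)))"
  have ap: "apply_bcontfun (\<Phi> w) t = \<Psi> w (cl t)" for w t
    unfolding \<Phi>_def using mem by (simp add: Bcontfun_inverse)
  have "dist (\<Phi> w) (\<Phi> w') \<le> (1/2) * dist w w'" for w w'
  proof (rule dist_bound)
    fix t
    define s where "s = cl t"
    have s: "s \<in> {a..b}" using cl by (simp add: s_def)
    define D where "D = dist w w'"
    have D: "0 \<le> D" by (simp add: D_def)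
    have I: "\<bar>iint a (V w) (n - i) s - iint a (V w') (n - i) s\<bar> \<le> D * exp (\<kappa> * (s - a)) / \<kappa>"
      if "i < n" for i
    proof -
      have "\<bar>iint a (\<lambda>s. V w s - V w' s) (n - i) s\<bar> \<le> D * exp (\<kappa> * (s - a)) / \<kappa> ^ (n - i)"
      proof (rule iint_bound[OF _ _ _ D s])
        fix t assume "t \<in> {a..b}"
        have "\<bar>V w t - V w' t\<bar> = exp (\<kappa> * (t - a)) * dist (apply_bcontfun w t) (apply_bcontfun w' t)"
          by (simp add: V_def dist_real_def abs_mult right_diff_distrib[symmetric])
        also have "\<dots> \<le> exp (\<kappa> * (t - a)) * D"
          unfolding D_def by (intro mult_left_mono dist_bounded) auto
        finally show "\<bar>V w t - V w' t\<bar> \<le> D * exp (\<kappa> * (t - a))" by (simp add: mult.commute)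
      qed (use \<kappa> in \<open>auto intro!: continuous_intros V\<close>)
      also have "\<dots> \<le> D * exp (\<kappa> * (s - a)) / \<kappa>"
        using D \<kappa> that self_le_power[of \<kappa> "n - i"] by (intro divide_left_mono) auto
      finally show ?thesis using iint_diff[OF V V s] by simp
    qed
    define Q where "Q = (\<Sum>i<n. p i s * (iint a (V w) (n - i) s - iint a (V w') (n - i) s))"
    have "\<Psi> w s - \<Psi> w' s = exp (- (\<kappa> * (s - a))) *
        ((\<Sum>i<n. p i s * iint a (V w') (n - i) s) - (\<Sum>i<n. p i s * iint a (V w) (n - i) s))"
      unfolding \<Psi>_def right_diff_distrib[symmetric] by simp
    also have "\<dots> = - (exp (- (\<kappa> * (s - a))) * Q)"
      unfolding Q_def by (simp only: right_diff_distrib sum_subtractf)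
    finally have "\<bar>\<Psi> w s - \<Psi> w' s\<bar> = exp (- (\<kappa> * (s - a))) * \<bar>Q\<bar>"
      by (simp add: abs_mult)
    also have "\<dots> \<le> exp (- (\<kappa> * (s - a))) * (\<Sum>i<n. \<bar>p i s\<bar> * (D * exp (\<kappa> * (s - a)) / \<kappa>))"
      unfolding Q_def
    proof (intro mult_left_mono order_trans[OF sum_abs] sum_mono)
      fix i assume "i \<in> {..<n}"
      then show "\<bar>p i s * (iint a (V w) (n - i) s - iint a (V w') (n - i) s)\<bar>
          \<le> \<bar>p i s\<bar> * (D * exp (\<kappa> * (s - a)) / \<kappa>)"
        unfolding abs_mult by (intro mult_left_mono I) auto
    qed auto
    also have "\<dots> = (\<Sum>i<n. \<bar>p i s\<bar>) * (D / \<kappa>)"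
      unfolding sum_distrib_right[symmetric] by (simp add: exp_minus)
    also have "\<dots> \<le> K * (D / \<kappa>)" using K(2)[OF s] D \<kappa> by (intro mult_right_mono) auto
    also have "\<dots> \<le> (1/2) * D" using mult_right_mono[OF \<kappa>(2) D] by simp
    finally show "dist (apply_bcontfun (\<Phi> w) t) (apply_bcontfun (\<Phi> w') t) \<le> (1/2) * dist w w'"
      by (simp add: ap s_def dist_real_def D_def)
  qed
  then obtain w where w: "\<Phi> w = w" using banach_fix_type[of "1/2" \<Phi>] by auto
  define v where "v = V w"
  have v: "continuous_on {a..b} v" using V by (simp add: v_def)
  define g where "g = (\<lambda>i. iint a v (n - i))"
  have veq: "v t = f t - (\<Sum>i<n. p i t * iint a v (n - i) t)" if "t \<in> {a..b}" for t
  proof -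
    have "apply_bcontfun w t = \<Psi> w t" using ap[of w t] unfolding w cl'[OF that] .
    then have "v t = exp (\<kappa> * (t - a)) * \<Psi> w t" by (simp only: v_def V_def)
    also have "\<dots> = (exp (\<kappa> * (t - a)) * exp (- (\<kappa> * (t - a)))) *
        (f t - (\<Sum>i<n. p i t * iint a v (n - i) t))"
      unfolding \<Psi>_def v_def by (simp only: mult.assoc)
    also have "exp (\<kappa> * (t - a)) * exp (- (\<kappa> * (t - a))) = 1" by (simp flip: exp_add)
    finally show ?thesis by (simp only: mult_1)
  qed
  have lin: "\<forall>t\<in>{a..b}. lin_op n p g t = f t"
  proof
    fix t assume t: "t \<in> {a..b}"
    have "lin_op n p g t = v t + (\<Sum>i<n. p i t * iint a v (n - i) t)"
      unfolding lin_op_def g_def diff_self_eq_0 iint.simps(1) ..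
    then show "lin_op n p g t = f t" unfolding veq[OF t] by (simp only: diff_add_cancel)
  qed
  have tow: "tower {a..b} n g"
    unfolding tower_def g_def
  proof (intro conjI allI impI ballI)
    fix i t assume "i < n" "t \<in> {a..b}"
    then show "(iint a v (n - i) has_real_derivative iint a v (n - Suc i) t) (at t within {a..b})"
      using iint_deriv[OF v, of t "n - Suc i"] by (simp add: Suc_diff_Suc del: iint.simps)
  qed (use v in \<open>simp only: diff_self_eq_0 iint.simps(1)\<close>)
  have "\<forall>i<n. g i a = 0"
  proof (intro allI impI)
    fix i assume "i < n"
    then obtain j where "n - i = Suc j" by (metis Suc_diff_Suc)
    then show "g i a = 0" by (simp add: g_def)
  qed
  with lin tow show ?thesis by (intro exI[of _ g] conjI)
qed

lemma lin_op_unique_zero: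
  fixes p :: "nat \<Rightarrow> real \<Rightarrow> real"
  assumes cont: "\<And>i. i < n \<Longrightarrow> continuous_on {a..b} (p i)"
    and g: "tower {a..b} n g" "\<And>t. t \<in> {a..b} \<Longrightarrow> lin_op n p g t = 0"
    and t0: "t0 \<in> {a..b}" "\<And>i. i < n \<Longrightarrow> g i t0 = 0"
    and "t \<in> {a..b}" "i \<le> n"
  shows "g i t = 0"
proof (rule lin_op_apriori[of n a b p, OF cont])
  fix C assume "0 \<le> C"
    "\<And>g F t0 t i. tower {a..b} n g \<Longrightarrow> (\<And>s. s \<in> {a..b} \<Longrightarrow> \<bar>lin_op n p g s\<bar> \<le> F) \<Longrightarrow>
       t0 \<in> {a..b} \<Longrightarrow> t \<in> {a..b} \<Longrightarrow> i \<le> n \<Longrightarrow> \<bar>g i t\<bar> \<le> C * ((\<Sum>j<n. \<bar>g j t0\<bar>) + F)"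
  from this(2)[of g 0 t0 t i] assms show "g i t = 0" by simp
qed

lemma ivp_left:
  fixes p :: "nat \<Rightarrow> real \<Rightarrow> real"
  assumes ab: "a \<le> b" and cont: "\<And>i. i < n \<Longrightarrow> continuous_on {a..b} (p i)"
    and f: "continuous_on {a..b} f"
  shows "\<exists>g. tower {a..b} n g \<and> (\<forall>i<n. g i a = x i) \<and> (\<forall>t\<in>{a..b}. lin_op n p g t = f t)"
proof -
  \<comment> \<open>\<open>m j i\<close> is the \<open>i\<close>-th derivative of
    \<open>(t - a) ^ j / fact j\<close>; subtracting a combination of these reduces to zero initial
    data.\<close>
  define m where "m = (\<lambda>j i t. if i \<le> j then (t - a) ^ (j - i) / fact (j - i) else 0 :: real)"
  have m: "tower S n (m j)" for j S
    unfolding tower_def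
  proof (intro conjI allI impI ballI)
    fix i t
    show "(m j i has_real_derivative m j (Suc i) t) (at t within S)"
    proof (cases "i < j")
      case True
      then obtain l where l: "j - i = Suc l" "j - Suc i = l" by (metis Suc_diff_Suc diff_Suc_Suc)
      have "((\<lambda>t. (t - a) ^ Suc l / fact (Suc l)) has_real_derivative
          (1 + real l) * (t - a) ^ l / fact (Suc l)) (at t within S)"
        by (auto intro!: derivative_eq_intros simp del: power_Suc fact_Suc)
      also have "(1 + real l) * (t - a) ^ l / fact (Suc l) = (t - a) ^ l / fact l"
        unfolding fact_Suc of_nat_Suc of_nat_mult
        by (subst mult_divide_mult_cancel_left) auto
      finally have "((\<lambda>t. (t - a) ^ Suc l / fact (Suc l)) has_real_derivative
          (t - a) ^ l / fact l) (at t within S)" .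
      then show ?thesis using True by (simp add: m_def l del: power_Suc fact_Suc)
    next
      case False
      then have "m j i = (\<lambda>t. if i = j then 1 else 0)" by (auto simp: m_def)
      then show ?thesis using False by (auto simp: m_def intro!: derivative_eq_intros)
    qed
  next
    show "continuous_on S (m j n)" unfolding m_def by (cases "n \<le> j") (auto intro!: continuous_intros)
  qed
  define q where "q = (\<lambda>i t. \<Sum>j<n. x j * m j i t)"
  have q: "tower {a..b} n q" unfolding q_def by (intro tower_sum tower_scale m) auto
  have ma: "m j i a = (if i = j then 1 else 0)" for i j by (auto simp: m_def)
  have qa: "q i a = x i" if "i < n" for i
    using that by (simp add: q_def ma if_distrib cong: if_cong)
  have "continuous_on {a..b} (\<lambda>t. f t - lin_op n p q t)"
    by (intro continuous_on_diff f lin_op_continuous q cont)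
  then obtain r where r: "tower {a..b} n r" "\<forall>i<n. r i a = 0"
      "\<forall>t\<in>{a..b}. lin_op n p r t = f t - lin_op n p q t"
    using zero_data_solution[where p = p and n = n, OF ab cont] by blast
  show ?thesis
  proof (intro exI[of _ "\<lambda>i t. q i t + r i t"] conjI)
    show "tower {a..b} n (\<lambda>i t. q i t + r i t)" by (rule tower_add[OF q r(1)])
    show "\<forall>i<n. q i a + r i a = x i" using r(2) qa by simp
    show "\<forall>t\<in>{a..b}. lin_op n p (\<lambda>i t. q i t + r i t) t = f t"
      unfolding lin_op_add using r(3) by simp
  qed
qed

text \<open>The linear map from jets at \<open>a\<close> to jets at \<open>t0\<close> of homogeneous
  solutions is injective by uniqueness, hence onto. So data at any point are reached from data at
  \<open>a\<close>.\<close>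

lemma ivp:
  fixes p :: "nat \<Rightarrow> real \<Rightarrow> real"
  assumes ab: "a \<le> b" and cont: "\<And>i. i < n \<Longrightarrow> continuous_on {a..b} (p i)"
    and f: "continuous_on {a..b} f" and t0: "t0 \<in> {a..b}"
  shows "\<exists>g. tower {a..b} n g \<and> (\<forall>i<n. g i t0 = x i) \<and> (\<forall>t\<in>{a..b}. lin_op n p g t = f t)"
proof -
  obtain r where r: "tower {a..b} n r" "\<forall>t\<in>{a..b}. lin_op n p r t = f t"
    using ivp_left[where p = p and n = n, OF ab cont f] by blast
  have "\<forall>j. \<exists>y. tower {a..b} n y \<and> (\<forall>i<n. y i a = (if i = j then 1 else 0)) \<and>
      (\<forall>t\<in>{a..b}. lin_op n p y t = 0)"
    by (intro allI, rule ivp_left[where p = p and n = n and f = "\<lambda>_. 0", OF ab cont]) auto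
  from choice[OF this] obtain y where y: "\<And>j. tower {a..b} n (y j)"
    "\<And>i j. i < n \<Longrightarrow> y j i a = (if i = j then 1 else 0)"
    "\<And>j t. t \<in> {a..b} \<Longrightarrow> lin_op n p (y j) t = 0" by blast
  have ty: "tower {a..b} n (\<lambda>i t. \<Sum>j<n. c j * y j i t)" for c
    by (intro tower_sum tower_scale y) auto
  have "\<exists>c. \<forall>i<n. (\<Sum>j<n. y j i t0 * c j) = x i - r i t0"
  proof (rule injective_imp_solvable)
    fix c assume c: "\<forall>i<n. (\<Sum>j<n. y j i t0 * c j) = 0"
    have "(\<Sum>j<n. c j * y j i a) = 0" if "i < n" for i
      by (rule lin_op_unique_zero[of n a b p "\<lambda>i t. \<Sum>j<n. c j * y j i t" t0])
        (use cont ty t0 c that ab in \<open>auto simp: lin_op_sum y mult.commute\<close>)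
    then show "\<forall>j<n. c j = 0" by (simp add: y if_distrib cong: if_cong)
  qed
  then obtain c where c: "\<And>i. i < n \<Longrightarrow> (\<Sum>j<n. c j * y j i t0) = x i - r i t0"
    by (auto simp: mult.commute)
  show ?thesis
  proof (intro exI[of _ "\<lambda>i t. r i t + (\<Sum>j<n. c j * y j i t)"] conjI)
    show "tower {a..b} n (\<lambda>i t. r i t + (\<Sum>j<n. c j * y j i t))" by (rule tower_add[OF r(1) ty])
    show "\<forall>i<n. r i t0 + (\<Sum>j<n. c j * y j i t0) = x i" using c by simp
    show "\<forall>t\<in>{a..b}. lin_op n p (\<lambda>i t. r i t + (\<Sum>j<n. c j * y j i t)) t = f t"
      unfolding lin_op_add lin_op_sum using r(2) y(3) by simp
  qed
qed

text \<open>Fredholm alternative in finite dimension: the solutions with \<open>q\<close> zeros at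
  \<open>s\<close> form a space of dimension \<open>n - q\<close>, and uniqueness makes the map to
  their first \<open>n - q\<close> derivatives at \<open>t\<close> injective, hence onto.\<close>

lemma two_point_solvable:
  fixes p :: "nat \<Rightarrow> real \<Rightarrow> real"
  assumes ab: "a < b" and cont: "\<And>i. i < n \<Longrightarrow> continuous_on {a..b} (p i)"
    and st: "s \<in> {a..b}" "t \<in> {a..b}" and q: "q \<le> n"
    and uniq: "\<And>g. tower {a..b} n g \<Longrightarrow> (\<forall>r\<in>{a..b}. lin_op n p g r = 0) \<Longrightarrow>
      (\<forall>i<q. g i s = 0) \<Longrightarrow> (\<forall>i<n-q. g i t = 0) \<Longrightarrow> \<forall>r\<in>{a..b}. g 0 r = 0"
  shows "\<exists>g. tower {a..b} n g \<and> (\<forall>r\<in>{a..b}. lin_op n p g r = 0) \<and>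
      (\<forall>i<q. g i s = 0) \<and> (\<forall>i<n-q. g i t = \<beta> i)"
proof -
  have "\<forall>j. \<exists>y. tower {a..b} n y \<and> (\<forall>i<n. y i s = (if i = j then 1 else 0)) \<and>
      (\<forall>t\<in>{a..b}. lin_op n p y t = 0)"
    by (intro allI, rule ivp[where p = p and n = n and f = "\<lambda>_. 0", OF less_imp_le[OF ab] cont _ st(1)]) auto
  from choice[OF this] obtain y where y: "\<And>j. tower {a..b} n (y j)"
    "\<And>i j. i < n \<Longrightarrow> y j i s = (if i = j then 1 else 0)"
    "\<And>j t. t \<in> {a..b} \<Longrightarrow> lin_op n p (y j) t = 0" by blast
  define Y where "Y = (\<lambda>c i t. \<Sum>j<n-q. c j * y (q + j) i t)"
  have Y: "tower {a..b} n (Y c)" "\<forall>r\<in>{a..b}. lin_op n p (Y c) r = 0" "\<forall>i<q. Y c i s = 0" for c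
    unfolding Y_def using q by (auto simp: lin_op_sum y intro!: tower_sum tower_scale)
  have "\<exists>c. \<forall>i<n-q. (\<Sum>j<n-q. y (q + j) i t * c j) = \<beta> i"
  proof (rule injective_imp_solvable)
    fix c assume "\<forall>i<n-q. (\<Sum>j<n-q. y (q + j) i t * c j) = 0"
    then have "\<forall>i<n-q. Y c i t = 0" by (simp add: Y_def mult.commute)
    then have "\<forall>r\<in>{a..b}. Y c 0 r = 0" using uniq[OF Y] by blast
    then have "Y c (q + i) s = 0" if "i < n - q" for i
      using tower_eq_on[OF Y(1) tower_zero order_refl ab] that st q by simp
    then show "\<forall>j<n-q. c j = 0" by (simp add: Y_def y if_distrib cong: if_cong)
  qed
  then obtain c where "\<And>i. i < n - q \<Longrightarrow> Y c i t = \<beta> i" by (auto simp: Y_def mult.commute)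
  with Y show ?thesis by blast
qed

section \<open>Factorization of a disconjugate operator\<close>

definition jet_op :: "nat \<Rightarrow> (nat \<Rightarrow> real \<Rightarrow> real) \<Rightarrow> (nat \<Rightarrow> real \<Rightarrow> real) \<Rightarrow> real \<Rightarrow> real" where
  "jet_op i e g t = (\<Sum>j\<le>i. e j t * g j t)"

lemma jet_op_diff: "jet_op i e (\<lambda>j t. g j t - h j t) t = jet_op i e g t - jet_op i e h t"
  by (simp add: jet_op_def algebra_simps sum_subtractf)

lemma jet_op_add: "jet_op i e (\<lambda>j t. g j t + h j t) t = jet_op i e g t + jet_op i e h t"
  by (simp add: jet_op_def algebra_simps sum.distrib)

lemma jet_op_scale: "jet_op i e (\<lambda>j t. c * g j t) t = c * jet_op i e g t"
  by (simp add: jet_op_def algebra_simps sum_distrib_left)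

lemma jet_op_cong: "(\<And>j. j \<le> i \<Longrightarrow> g j t = h j t) \<Longrightarrow> jet_op i e g t = jet_op i e h t"
  by (simp add: jet_op_def)

lemma jet_op_0: "(\<And>j. j \<le> i \<Longrightarrow> g j t = 0) \<Longrightarrow> jet_op i e g t = 0"
  by (simp add: jet_op_def)

lemma half_open_deriv_unique:
  fixes f :: "real \<Rightarrow> real"
  assumes "(f has_real_derivative D) (at t within {a<..b})"
    "(f has_real_derivative D') (at t within {a<..b})" "t \<in> {a<..b}"
  shows "D = D'"
proof -
  define c where "c = (a + t) / 2"
  have c: "c < b" "t \<in> cbox c b" "{c..b} \<subseteq> {a<..b}" using assms(3) by (auto simp: c_def)
  show ?thesis
    by (rule vector_derivative_unique_within_closed_interval[OF c(1,2), of f])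
      (use assms c in \<open>auto simp: cbox_interval has_real_derivative_iff_has_vector_derivative[symmetric]
        intro: DERIV_subset\<close>)
qed

lemma nonzero_constant_sign:
  fixes w :: "real \<Rightarrow> real"
  assumes "continuous_on {a<..b} w" "\<And>t. t \<in> {a<..b} \<Longrightarrow> w t \<noteq> 0"
  obtains s :: real where "s = 1 \<or> s = -1" "\<forall>t\<in>{a<..b}. 0 < s * w t"
proof (cases "\<exists>x\<in>{a<..b}. \<exists>y\<in>{a<..b}. w x < 0 \<and> 0 < w y")
  case True
  then obtain x y where xy: "x \<in> {a<..b}" "y \<in> {a<..b}" "w x < 0" "0 < w y" by blast
  have "connected (w ` {a<..b})" by (intro connected_continuous_image assms) auto
  then have "0 \<in> w ` {a<..b}" using xy connectedD_interval[of "w ` {a<..b}" "w x" "w y" 0] by auto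
  with assms(2) show ?thesis by force
next
  case False
  then have "(\<forall>t\<in>{a<..b}. 0 < w t) \<or> (\<forall>t\<in>{a<..b}. w t < 0)"
    using assms(2) by (metis linorder_neqE_linordered_idom)
  then show ?thesis using that[of 1] that[of "-1"] by auto
qed

text \<open>Of disconjugacy only the two-point form is kept: zeros at two points with prescribed
  orders that sum to \<open>n\<close>. It suffices for the factorization and is symmetric under
  reflection of the interval.\<close>

locale disconj_op =
  fixes a b :: real and n :: nat and p :: "nat \<Rightarrow> real \<Rightarrow> real"
  assumes ab: "a < b" and n_pos: "0 < n"
    and cont: "\<And>i. i < n \<Longrightarrow> continuous_on {a..b} (p i)"
    and disc: "\<And>g s t q. tower {a..b} n g \<Longrightarrow> \<forall>r\<in>{a..b}. lin_op n p g r = 0 \<Longrightarrow>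
      a \<le> s \<Longrightarrow> s < t \<Longrightarrow> t \<le> b \<Longrightarrow> q \<le> n \<Longrightarrow> \<forall>i<q. g i s = 0 \<Longrightarrow> \<forall>i<n-q. g i t = 0 \<Longrightarrow>
      \<forall>r\<in>{a..b}. g 0 r = 0"
begin

abbreviation "ts \<equiv> tower {a..b} n"
abbreviation "L \<equiv> lin_op n p"

definition hom :: "(nat \<Rightarrow> real \<Rightarrow> real) \<Rightarrow> bool" where
  "hom g \<longleftrightarrow> ts g \<and> (\<forall>r\<in>{a..b}. L g r = 0)"

lemma hom_diff: "hom g \<Longrightarrow> hom h \<Longrightarrow> hom (\<lambda>i t. g i t - h i t)"
  by (simp add: hom_def tower_diff lin_op_diff)

lemma hom_scale: "hom g \<Longrightarrow> hom (\<lambda>i t. c * g i t)"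
  by (simp add: hom_def tower_scale lin_op_scale)

lemma hom_exists:
  assumes "t \<in> {a..b}"
  obtains g where "hom g" "\<And>i. i < n \<Longrightarrow> g i t = x i"
proof -
  have "\<exists>g. ts g \<and> (\<forall>i<n. g i t = x i) \<and> (\<forall>t\<in>{a..b}. L g t = 0)"
    by (rule ivp[OF less_imp_le[OF ab] cont continuous_on_const assms])
  then show ?thesis using that by (auto simp: hom_def)
qed

text \<open>\<open>jet_op i e\<close> is the monic operator of order \<open>i\<close> that
  annihilates the \<open>i\<close>-dimensional space of solutions with \<open>n - i\<close> zeros at
  \<open>a\<close>. Its coefficients lose one derivative per factor, whence the smoothness
  \<open>n - i\<close>.\<close>

definition kills :: "nat \<Rightarrow> (nat \<Rightarrow> real \<Rightarrow> real) \<Rightarrow> bool" where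
  "kills i e \<longleftrightarrow> (\<forall>j\<le>i. Cm_set {a<..b} (n - i) (e j)) \<and> (\<forall>t\<in>{a<..b}. e i t = 1) \<and>
     (\<forall>g. hom g \<longrightarrow> (\<forall>l<n-i. g l a = 0) \<longrightarrow> (\<forall>t\<in>{a<..b}. jet_op i e g t = 0))"

lemma kills_zero: "kills 0 (\<lambda>_ _. 1)"
  unfolding kills_def
proof (intro conjI allI impI ballI)
  fix g t assume "hom g" "\<forall>l<n-0. g l a = 0" "t \<in> {a<..b}"
  then show "jet_op 0 (\<lambda>_ _. 1) g t = 0"
    using lin_op_unique_zero[of n a b p g a t 0] cont ab by (auto simp: hom_def jet_op_def)
qed (auto intro: Cm_set_const)

text \<open>This is where disconjugacy enters: if \<open>jet_op i e y\<close> vanished at \<open>t\<close>, no solution with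
  \<open>n - i - 1\<close> zeros at \<open>a\<close> could have the jet \<open>(0, \<dots>, 0, 1)\<close> of order \<open>i\<close> at \<open>t\<close>.\<close>

lemma kills_next_nonzero:
  assumes e: "kills i e" and i: "i < n" and y: "hom y" "\<And>l. l < n - Suc i \<Longrightarrow> y l a = 0" "y (n - Suc i) a = 1"
    and t: "t \<in> {a<..b}"
  shows "jet_op i e y t \<noteq> 0"
proof
  assume 0: "jet_op i e y t = 0"
  have "\<exists>g. ts g \<and> (\<forall>r\<in>{a..b}. L g r = 0) \<and>
      (\<forall>l<n - Suc i. g l a = 0) \<and> (\<forall>l<n-(n - Suc i). g l t = (if l = i then 1 else 0))"
  proof (rule two_point_solvable[OF ab cont])
    show "\<forall>r\<in>{a..b}. g 0 r = 0" if "ts g" "\<forall>r\<in>{a..b}. L g r = 0" "\<forall>l<n - Suc i. g l a = 0"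
      "\<forall>l<n-(n - Suc i). g l t = 0" for g
      by (rule disc[OF that(1,2) order_refl _ _ _ that(3,4)]) (use t in auto)
  qed (use t in auto)
  then obtain g where g: "hom g" "\<And>l. l < n - Suc i \<Longrightarrow> g l a = 0"
      "\<And>l. l \<le> i \<Longrightarrow> g l t = (if l = i then 1 else 0)"
    using i by (auto simp: hom_def)
  define \<alpha> where "\<alpha> = g (n - Suc i) a"
  have "jet_op i e g t = e i t"
  proof -
    have "jet_op i e g t = (\<Sum>j\<le>i. if j = i then e i t else 0)"
      unfolding jet_op_def by (rule sum.cong) (simp_all add: g(3))
    then show ?thesis by simp
  qed
  then have "jet_op i e g t = 1" using e t by (simp add: kills_def)
  moreover have "jet_op i e (\<lambda>l t. g l t - \<alpha> * y l t) t = 0"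
  proof -
    have "hom (\<lambda>l t. g l t - \<alpha> * y l t)" by (intro hom_diff hom_scale g y)
    moreover have "g l a - \<alpha> * y l a = 0" if "l < n - i" for l
      using that g(2)[of l] y(2)[of l] y(3) i by (cases "l = n - Suc i") (auto simp: \<alpha>_def)
    ultimately show ?thesis using e t unfolding kills_def by blast
  qed
  ultimately show False using 0 by (simp add: jet_op_diff jet_op_scale)
qed

text \<open>One factor of the Polya factorization: \<open>jet_op (Suc i) e' g\<close> is
  \<open>v\<close> times the derivative of \<open>jet_op i e g / v\<close>. Positivity of
  \<open>v\<close> lets signs be transported through the factor.\<close>

definition linked :: "nat \<Rightarrow> (nat \<Rightarrow> real \<Rightarrow> real) \<Rightarrow> (nat \<Rightarrow> real \<Rightarrow> real) \<Rightarrow> (real \<Rightarrow> real) \<Rightarrow> bool" where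
  "linked i e e' v \<longleftrightarrow> (\<forall>t\<in>{a<..b}. 0 < v t) \<and>
    (\<forall>g. ts g \<longrightarrow> (\<forall>t\<in>{a<..b}. ((\<lambda>t. jet_op i e g t / v t) has_real_derivative
       jet_op (Suc i) e' g t / v t) (at t within {a<..b})))"

text \<open>For the solution \<open>y\<close> with exactly \<open>n - Suc i\<close> zeros at
  \<open>a\<close>, disconjugacy makes \<open>jet_op i e y\<close> nowhere zero on (a,b]. Dividing
  by this function, up to sign, and differentiating annihilates \<open>y\<close> along with
  everything annihilated before.\<close>

lemma kills_step:
  assumes e: "kills i e" and i: "i < n"
  shows "\<exists>v e'. kills (Suc i) e' \<and> linked i e e' v"
proof -
  let ?S = "{a<..b}"
  have ts_S: "tower ?S n g" if "ts g" for g by (rule tower_subset[OF that]) auto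
  obtain y where y: "hom y" "\<And>l. l < n \<Longrightarrow> y l a = (if l = n - Suc i then 1 else 0)"
    using hom_exists[of a "\<lambda>l. if l = n - Suc i then 1 else 0"] ab by auto
  define w where "w = jet_op i e y"
  have w: "Cm_set ?S (n - i) w"
    unfolding w_def jet_op_def[abs_def]
  proof (intro Cm_set_sum Cm_set_mult)
    fix j assume "j \<in> {..i}"
    then show "Cm_set ?S (n - i) (e j)" using e by (simp add: kills_def)
    show "Cm_set ?S (n - i) (y j)"
      by (rule Cm_set_mono[OF tower_imp_Cm_set[OF ts_S]])
        (use y(1) i \<open>j \<in> {..i}\<close> in \<open>auto simp: hom_def\<close>)
  qed auto
  have w0: "w t \<noteq> 0" if "t \<in> ?S" for t
    unfolding w_def by (rule kills_next_nonzero[OF e i y(1) _ _ that]) (use y(2) i in auto)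
  obtain s :: real where s: "s = 1 \<or> s = -1" "\<forall>t\<in>?S. 0 < s * w t"
    by (rule nonzero_constant_sign[OF Cm_set_imp_continuous[OF w] w0])
  define v where "v = (\<lambda>t. s * w t)"
  have v_pos: "0 < v t" if "t \<in> ?S" for t using s(2) that by (simp add: v_def)
  have ni: "n - i = Suc (n - Suc i)" using i by simp
  have "Cm_set ?S (Suc (n - Suc i)) v"
    unfolding v_def ni[symmetric] by (intro Cm_set_mult Cm_set_const w)
  then obtain v' where v': "\<And>t. t \<in> ?S \<Longrightarrow> (v has_real_derivative v' t) (at t within ?S)"
      "Cm_set ?S (n - Suc i) v'" unfolding Cm_set.simps(2) by blast
  have v_Cm: "Cm_set ?S (n - Suc i) v" by (rule Cm_set_SucD) fact
  have "\<forall>j. \<exists>d. j \<le> i \<longrightarrow> (\<forall>t\<in>?S. (e j has_real_derivative d t) (at t within ?S)) \<and> Cm_set ?S (n - Suc i) d"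
    using e unfolding kills_def ni by auto
  from choice[OF this] obtain d where
    d: "\<And>j t. j \<le> i \<Longrightarrow> t \<in> ?S \<Longrightarrow> (e j has_real_derivative d j t) (at t within ?S)"
      "\<And>j. j \<le> i \<Longrightarrow> Cm_set ?S (n - Suc i) (d j)" by blast
  have e_Cm: "Cm_set ?S (n - Suc i) (e j)" if "j \<le> i" for j
    using e that unfolding kills_def ni by (blast intro: Cm_set_SucD)
  \<comment> \<open>Read off from \<open>v\<close> times the derivative of
    \<open>jet_op i e g / v\<close>: the product rule gives \<open>d j\<close>, the quotient rule
    \<open>- v' / v * e j\<close>, and differentiating \<open>g (j - 1)\<close> shifts the
    index.\<close>
  define e' where "e' = (\<lambda>j t. (if j \<le> i then d j t - v' t / v t * e j t else 0) +
    (if j = 0 then 0 else e (j - 1) t))"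
  have deriv: "((\<lambda>t. jet_op i e g t / v t) has_real_derivative jet_op (Suc i) e' g t / v t) (at t within ?S)"
    if g: "ts g" and t: "t \<in> ?S" for g t
  proof -
    have "jet_op (Suc i) e' g t = (\<Sum>j\<le>i. (d j t - v' t / v t * e j t) * g j t) + (\<Sum>j\<le>i. e j t * g (Suc j) t)"
    proof -
      have "jet_op (Suc i) e' g t =
          (\<Sum>j\<le>Suc i. (if j \<le> i then d j t - v' t / v t * e j t else 0) * g j t) +
          (\<Sum>j\<le>Suc i. (if j = 0 then 0 else e (j - 1) t) * g j t)"
        unfolding jet_op_def e'_def by (simp only: distrib_right sum.distrib)
      also have "(\<Sum>j\<le>Suc i. (if j \<le> i then d j t - v' t / v t * e j t else 0) * g j t) =
          (\<Sum>j\<le>i. (d j t - v' t / v t * e j t) * g j t)" by simp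
      also have "(\<Sum>j\<le>Suc i. (if j = 0 then 0 else e (j - 1) t) * g j t) = (\<Sum>j\<le>i. e j t * g (Suc j) t)"
        by (simp only: sum.atMost_Suc_shift) simp
      finally show ?thesis .
    qed
    also have "\<dots> = (\<Sum>j\<le>i. d j t * g j t + e j t * g (Suc j) t) - v' t / v t * jet_op i e g t"
      by (simp add: jet_op_def algebra_simps sum.distrib sum_subtractf sum_distrib_left)
    finally have eq: "jet_op (Suc i) e' g t = \<dots>" .
    have "(jet_op i e g has_real_derivative (\<Sum>j\<le>i. d j t * g j t + e j t * g (Suc j) t)) (at t within ?S)"
      unfolding jet_op_def[abs_def]
    proof (rule DERIV_sum)
      fix j assume "j \<in> {..i}"
      then show "((\<lambda>t. e j t * g j t) has_real_derivative d j t * g j t + e j t * g (Suc j) t) (at t within ?S)"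
        using DERIV_mult[OF d(1)[of j t] tower_deriv[OF ts_S[OF g], of j t]] t i
        by (simp add: algebra_simps)
    qed
    from DERIV_divide[OF this v'(1)[OF t]] v_pos[OF t]
    show ?thesis unfolding eq by (simp add: field_simps)
  qed
  have "kills (Suc i) e'"
    unfolding kills_def
  proof (intro conjI allI impI ballI)
    fix j assume "j \<le> Suc i"
    have "Cm_set ?S (n - Suc i) (\<lambda>t. d j t - v' t / v t * e j t)" if "j \<le> i"
      using v_pos that by (intro Cm_set_diff Cm_set_mult Cm_set_divide d v' v_Cm e_Cm) force+
    moreover have "Cm_set ?S (n - Suc i) (e (j - 1))" using \<open>j \<le> Suc i\<close> by (intro e_Cm) auto
    ultimately show "Cm_set ?S (n - Suc i) (e' j)"
      unfolding e'_def by (intro Cm_set_add; cases "j \<le> i"; cases "j = 0") (auto intro: Cm_set_const)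
  next
    show "e' (Suc i) t = 1" if "t \<in> ?S" for t using e that by (simp add: e'_def kills_def)
  next
    fix g t assume g: "hom g" "\<forall>l<n - Suc i. g l a = 0" and t: "t \<in> ?S"
    define \<alpha> where "\<alpha> = g (n - Suc i) a"
    have "hom (\<lambda>l t. g l t - \<alpha> * y l t)" by (intro hom_diff hom_scale g y)
    moreover have "\<forall>l<n-i. g l a - \<alpha> * y l a = 0"
      using g(2) y(2) i by (auto simp: \<alpha>_def ni less_Suc_eq)
    ultimately have 0: "\<forall>r\<in>?S. jet_op i e (\<lambda>l t. g l t - \<alpha> * y l t) r = 0"
      using e unfolding kills_def by blast
    have const: "jet_op i e g r / v r = \<alpha> * s" if r: "r \<in> ?S" for r
    proof -
      have "jet_op i e g r = \<alpha> * w r"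
        using bspec[OF 0 r] unfolding jet_op_diff jet_op_scale w_def by simp
      also have "w r = s * v r" using s(1) by (auto simp: v_def)
      finally show ?thesis using v_pos[OF r] by simp
    qed
    have "((\<lambda>t. jet_op i e g t / v t) has_real_derivative 0) (at t within ?S)"
      by (rule has_field_derivative_transform_within[of "\<lambda>_. \<alpha> * s" 0 t ?S 1])
        (use t const in simp_all)
    moreover have "ts g" using g(1) by (simp add: hom_def)
    ultimately have "jet_op (Suc i) e' g t / v t = 0"
      using half_open_deriv_unique[OF deriv _ t] t by blast
    then show "jet_op (Suc i) e' g t = 0" using v_pos[OF t] by simp
  qed
  with deriv v_pos show ?thesis unfolding linked_def by blast
qed

lemma chain_exists:
  "\<exists>e v. (\<forall>i\<le>n. kills i (e i)) \<and> e 0 = (\<lambda>_ _. 1) \<and> (\<forall>i<n. linked i (e i) (e (Suc i)) (v i))"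
proof -
  define Q where "Q = (\<lambda>i e e'. i < n \<longrightarrow> (\<exists>v. linked i e e' v))"
  define P where "P = (\<lambda>i e. (i \<le> n \<longrightarrow> kills i e) \<and> (i = 0 \<longrightarrow> e = (\<lambda>_ _. 1)))"
  have "\<exists>e. \<forall>i. P i (e i) \<and> Q i (e i) (e (Suc i))"
  proof (rule dependent_nat_choice)
    show "\<exists>x. P 0 x" using kills_zero by (auto simp: P_def)
    show "\<exists>y. P (Suc i) y \<and> Q i x y" if "P i x" for x i
      using kills_step[of i x] that unfolding P_def Q_def by (cases "i < n") auto
  qed
  then obtain e where e: "\<And>i. P i (e i)" "\<And>i. Q i (e i) (e (Suc i))" by blast
  have "\<forall>i. \<exists>v. i < n \<longrightarrow> linked i (e i) (e (Suc i)) v"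
    using e(2) unfolding Q_def by blast
  from choice[OF this] obtain v where "\<forall>i. i < n \<longrightarrow> linked i (e i) (e (Suc i)) (v i)" ..
  with e(1) show ?thesis unfolding P_def by (intro exI[of _ e] exI[of _ v]) blast
qed

definition chain :: "(nat \<Rightarrow> nat \<Rightarrow> real \<Rightarrow> real) \<times> (nat \<Rightarrow> real \<Rightarrow> real)" where
  "chain = (SOME ev. (\<forall>i\<le>n. kills i (fst ev i)) \<and> fst ev 0 = (\<lambda>_ _. 1) \<and>
    (\<forall>i<n. linked i (fst ev i) (fst ev (Suc i)) (snd ev i)))"

definition J :: "nat \<Rightarrow> (nat \<Rightarrow> real \<Rightarrow> real) \<Rightarrow> real \<Rightarrow> real" where
  "J i = jet_op i (fst chain i)"

definition V :: "nat \<Rightarrow> real \<Rightarrow> real" where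
  "V = snd chain"

lemma chain:
  shows kills_chain: "i \<le> n \<Longrightarrow> kills i (fst chain i)" and chain_0: "fst chain 0 = (\<lambda>_ _. 1)"
    and linked_chain: "i < n \<Longrightarrow> linked i (fst chain i) (fst chain (Suc i)) (snd chain i)"
proof -
  obtain e v where ev: "(\<forall>i\<le>n. kills i (e i)) \<and> e 0 = (\<lambda>_ _. 1) \<and>
    (\<forall>i<n. linked i (e i) (e (Suc i)) (v i))"
    using chain_exists by blast
  have *: "(\<forall>i\<le>n. kills i (fst chain i)) \<and> fst chain 0 = (\<lambda>_ _. 1) \<and>
    (\<forall>i<n. linked i (fst chain i) (fst chain (Suc i)) (snd chain i))"
    unfolding chain_def by (rule someI[of _ "(e, v)"]) (unfold fst_conv snd_conv, rule ev)
  show "i \<le> n \<Longrightarrow> kills i (fst chain i)" "fst chain 0 = (\<lambda>_ _. 1)"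
    "i < n \<Longrightarrow> linked i (fst chain i) (fst chain (Suc i)) (snd chain i)"
    using * by blast+
qed

lemma V_pos: "i < n \<Longrightarrow> t \<in> {a<..b} \<Longrightarrow> 0 < V i t"
  using linked_chain[of i] unfolding linked_def V_def by blast

lemma J_deriv:
  "i < n \<Longrightarrow> ts g \<Longrightarrow> t \<in> {a<..b} \<Longrightarrow>
    ((\<lambda>t. J i g t / V i t) has_real_derivative J (Suc i) g t / V i t) (at t within {a<..b})"
  using linked_chain[of i] unfolding linked_def J_def V_def by blast

lemma J_0: "J 0 g t = g 0 t"
  by (simp add: J_def chain_0 jet_op_def)

lemma J_hom: "i \<le> n \<Longrightarrow> hom g \<Longrightarrow> (\<And>l. l < n - i \<Longrightarrow> g l a = 0) \<Longrightarrow> t \<in> {a<..b} \<Longrightarrow> J i g t = 0"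
  using kills_chain[of i] unfolding kills_def J_def by blast

text \<open>Both operators are monic of order \<open>n\<close> and annihilate every solution.
  Comparing \<open>g\<close> with the solution that shares its jet below order \<open>n\<close> at
  \<open>t\<close> leaves the same difference of top derivatives in both.\<close>

lemma J_n:
  assumes g: "ts g" and t: "t \<in> {a<..b}"
  shows "J n g t = L g t"
proof -
  obtain h where h: "hom h" "\<And>i. i < n \<Longrightarrow> h i t = g i t"
    using hom_exists[of t "\<lambda>i. g i t"] t by auto
  have 1: "fst chain n n t = 1" using kills_chain[of n] t by (simp add: kills_def)
  have split: "J n f t = (\<Sum>j<n. fst chain n j t * f j t) + f n t" for f
    unfolding J_def jet_op_def by (simp add: 1 lessThan_Suc_atMost[symmetric])
  have "J n h t = 0" using J_hom[OF order_refl h(1)] t by simp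
  moreover have "L h t = 0" using h(1) t by (simp add: hom_def)
  ultimately show ?thesis using h(2) by (simp add: split lin_op_def)
qed

end

section \<open>Propagation of signs\<close>

lemma continuous_near_left:
  fixes \<psi> :: "real \<Rightarrow> real"
  assumes "continuous_on {a..b} \<psi>" "a < b"
  shows "(\<psi> \<longlongrightarrow> \<psi> a) (at_right a)"
proof -
  have "(\<psi> \<longlongrightarrow> \<psi> a) (at a within {a..b})"
    using assms by (simp add: continuous_on_def)
  then show ?thesis using assms(2) by (simp add: at_within_Icc_at_right)
qed

context disconj_op
begin

lemma interior_eventually: "\<forall>\<^sub>F \<tau> in at_right a. \<tau> \<in> {a<..b}"
  unfolding eventually_at_right_field using ab by (intro exI[of _ b]) auto

lemma J_nonneg_step:
  assumes g: "ts g" and i: "i < n" and \<tau>: "\<tau> \<in> {a<..b}" "0 \<le> J i g \<tau>"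
    and next_nonneg: "\<And>s. \<tau> \<le> s \<Longrightarrow> s \<le> b \<Longrightarrow> 0 \<le> J (Suc i) g s"
    and s: "\<tau> \<le> s" "s \<le> s'" "s' \<le> b"
  shows "0 \<le> J i g s" "J i g s / V i s \<le> J i g s' / V i s'"
proof -
  have mono: "J i g s / V i s \<le> J i g s' / V i s'" if "\<tau> \<le> s" "s \<le> s'" "s' \<le> b" for s s'
  proof (rule nonneg_deriv_imp_le[OF that(2)])
    show "{s..s'} \<subseteq> {a<..b}" using that \<tau> by auto
    show "((\<lambda>t. J i g t / V i t) has_real_derivative J (Suc i) g t / V i t) (at t within {a<..b})"
      if "t \<in> {a<..b}" for t by (rule J_deriv[OF i g that])
    show "0 \<le> J (Suc i) g x / V i x" if "s < x" "x < s'" for x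
      using next_nonneg[of x] V_pos[OF i, of x] that \<open>\<tau> \<le> s\<close> \<open>s' \<le> b\<close> \<tau> by (intro divide_nonneg_pos) auto
  qed
  show "J i g s / V i s \<le> J i g s' / V i s'" by (rule mono[OF s])
  have "0 \<le> J i g \<tau> / V i \<tau>" using \<tau> V_pos[OF i \<tau>(1)] by simp
  also have "\<dots> \<le> J i g s / V i s" using s by (intro mono) auto
  finally have "0 \<le> J i g s / V i s" .
  moreover have "0 < V i s" using \<tau> s by (intro V_pos[OF i]) auto
  ultimately show "0 \<le> J i g s" by (simp add: zero_le_divide_iff)
qed

lemma J_nonneg_above:
  assumes g: "ts g" and \<tau>: "\<tau> \<in> {a<..b}" "\<And>i. i < n \<Longrightarrow> 0 \<le> J i g \<tau>"
    and L: "\<And>s. \<tau> \<le> s \<Longrightarrow> s \<le> b \<Longrightarrow> 0 \<le> L g s" and i: "i \<le> n"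
  shows "\<forall>s. \<tau> \<le> s \<and> s \<le> b \<longrightarrow> 0 \<le> J i g s"
  using i
proof (induction i rule: inc_induct)
  case base
  show ?case using L J_n[OF g] \<tau> by auto
next
  case (step i)
  show ?case
  proof (intro allI impI)
    fix s assume s: "\<tau> \<le> s \<and> s \<le> b"
    have nx: "\<And>s. \<tau> \<le> s \<Longrightarrow> s \<le> b \<Longrightarrow> 0 \<le> J (Suc i) g s" using step.IH by simp
    show "0 \<le> J i g s"
      by (rule J_nonneg_step(1)[OF g step.hyps(2) \<tau>(1) \<tau>(2)[OF step.hyps(2)] nx, of s s]) (use s in auto)
  qed
qed

text \<open>As \<tau> tends to \<open>a\<close>, the jet of \<open>g\<close> at \<tau> tends to 0,
  so a solution \<open>h\<close> sharing that jet becomes negligible at any fixed \<open>t\<close>.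
  The point is that \<open>B\<close> depends neither on \<tau> nor on \<open>h\<close>.\<close>

lemma J_small_solution:
  assumes g: "ts g" "\<And>l. l < n \<Longrightarrow> g l a = 0" and t: "t \<in> {a<..b}" and i: "i \<le> n"
  shows "\<exists>B. \<forall>\<tau>\<in>{a<..b}. \<forall>h. hom h \<longrightarrow> (\<forall>l<n. h l \<tau> = g l \<tau>) \<longrightarrow>
    \<bar>J i h t\<bar> \<le> B * (\<Sum>l<n. \<bar>g l \<tau>\<bar>)"
proof (rule lin_op_apriori[of n a b p, OF cont])
  fix C assume C: "0 \<le> C"
    "\<And>g F t0 t i. ts g \<Longrightarrow> (\<And>s. s \<in> {a..b} \<Longrightarrow> \<bar>L g s\<bar> \<le> F) \<Longrightarrow>
       t0 \<in> {a..b} \<Longrightarrow> t \<in> {a..b} \<Longrightarrow> i \<le> n \<Longrightarrow> \<bar>g i t\<bar> \<le> C * ((\<Sum>j<n. \<bar>g j t0\<bar>) + F)"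
  define B where "B = (\<Sum>j\<le>i. \<bar>fst chain i j t\<bar> * C)"
  have "\<bar>J i h t\<bar> \<le> B * (\<Sum>l<n. \<bar>g l \<tau>\<bar>)"
    if \<tau>: "\<tau> \<in> {a<..b}" and h: "hom h" "\<forall>l<n. h l \<tau> = g l \<tau>" for \<tau> h
  proof -
    have hj: "\<bar>h j t\<bar> \<le> C * (\<Sum>l<n. \<bar>g l \<tau>\<bar>)" if "j \<le> i" for j
      using C(2)[of h 0 \<tau> t j] h \<tau> t i that by (simp add: hom_def)
    have "\<bar>J i h t\<bar> \<le> (\<Sum>j\<le>i. \<bar>fst chain i j t * h j t\<bar>)"
      unfolding J_def jet_op_def by (rule sum_abs)
    also have "\<dots> \<le> (\<Sum>j\<le>i. \<bar>fst chain i j t\<bar> * (C * (\<Sum>l<n. \<bar>g l \<tau>\<bar>)))"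
      unfolding abs_mult by (intro sum_mono mult_left_mono hj) auto
    also have "\<dots> = B * (\<Sum>l<n. \<bar>g l \<tau>\<bar>)" by (simp add: B_def sum_distrib_right mult.assoc)
    finally show ?thesis .
  qed
  then show ?thesis by (intro exI[of _ B]) simp
qed

lemma jets_tendsto_0:
  assumes g: "ts g" "\<And>l. l < n \<Longrightarrow> g l a = 0"
  shows "((\<lambda>\<tau>. B * (\<Sum>l<n. \<bar>g l \<tau>\<bar>)) \<longlongrightarrow> 0) (at_right a)"
proof -
  have "continuous_on {a..b} (\<lambda>\<tau>. B * (\<Sum>l<n. \<bar>g l \<tau>\<bar>))"
    using tower_continuous[OF g(1)] by (intro continuous_intros) auto
  from continuous_near_left[OF this ab] show ?thesis using g(2) by simp
qed

text \<open>The limit at the singular end point \<open>a\<close> is reached through solutions \<open>h\<close> of the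
  homogeneous equation that share their jet with \<open>g\<close> at a point \<open>\<tau>\<close> tending to \<open>a\<close>.\<close>

lemma J_nonneg_zero_jet:
  assumes g: "ts g" "\<And>l. l < n \<Longrightarrow> g l a = 0" and L: "\<And>s. s \<in> {a..b} \<Longrightarrow> 0 \<le> L g s"
    and i: "i \<le> n" and t: "t \<in> {a<..b}"
  shows "0 \<le> J i g t"
proof -
  obtain B where B: "\<forall>\<tau>\<in>{a<..b}. \<forall>h. hom h \<longrightarrow> (\<forall>l<n. h l \<tau> = g l \<tau>) \<longrightarrow>
    \<bar>J i h t\<bar> \<le> B * (\<Sum>l<n. \<bar>g l \<tau>\<bar>)"
    using J_small_solution[OF g t i] by blast
  have "- J i g t \<le> B * (\<Sum>l<n. \<bar>g l \<tau>\<bar>)" if \<tau>: "\<tau> \<in> {a<..b}" "\<tau> \<le> t" for \<tau>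
  proof -
    obtain h where h: "hom h" "\<And>l. l < n \<Longrightarrow> h l \<tau> = g l \<tau>"
      using hom_exists[of \<tau> "\<lambda>l. g l \<tau>"] \<tau> by auto
    have hs: "ts h" "\<And>s. s \<in> {a..b} \<Longrightarrow> L h s = 0" using h(1) by (auto simp: hom_def)
    have "\<forall>s. \<tau> \<le> s \<and> s \<le> b \<longrightarrow> 0 \<le> J i (\<lambda>l t. g l t - h l t) s"
    proof (rule J_nonneg_above[OF tower_diff[OF g(1) hs(1)] \<tau>(1) _ _ i])
      show "0 \<le> J i (\<lambda>l t. g l t - h l t) \<tau>" if "i < n" for i
        unfolding J_def by (subst jet_op_0) (use h(2) that in auto)
      show "0 \<le> L (\<lambda>l t. g l t - h l t) s" if "\<tau> \<le> s" "s \<le> b" for s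
        using L[of s] hs(2)[of s] that \<tau> by (simp add: lin_op_diff)
    qed
    then have "0 \<le> J i (\<lambda>l t. g l t - h l t) t" using \<tau> t by auto
    then have "J i h t \<le> J i g t" by (simp add: J_def jet_op_diff)
    moreover have "\<bar>J i h t\<bar> \<le> B * (\<Sum>l<n. \<bar>g l \<tau>\<bar>)" using B \<tau>(1) h by blast
    ultimately show ?thesis by linarith
  qed
  moreover have "\<forall>\<^sub>F \<tau> in at_right a. \<tau> \<in> {a<..b} \<and> \<tau> \<le> t"
    unfolding eventually_at_right_field using t by (intro exI[of _ t]) auto
  ultimately have "\<forall>\<^sub>F \<tau> in at_right a. - J i g t \<le> B * (\<Sum>l<n. \<bar>g l \<tau>\<bar>)"
    by (auto elim: eventually_mono)
  from tendsto_lowerbound[OF jets_tendsto_0[OF g] this] show ?thesis by simp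
qed

text \<open>The solution \<open>h\<close> with the jet of \<open>g\<close> at \<tau> has
  \<open>J i h / V i\<close> increasing from \<tau> to \<open>b\<close>, so the value at \<tau> is
  squeezed between 0 and the value at \<open>b\<close>, where \<open>h\<close> is small.
  Monotonicity thus replaces any information on \<open>V i\<close> near \<open>a\<close>.\<close>

lemma J_limit_nonneg_zero_jet:
  assumes g: "ts g" "\<And>l. l < n \<Longrightarrow> g l a = 0" and L: "\<And>s. s \<in> {a..b} \<Longrightarrow> 0 \<le> L g s"
    and i: "i < n"
  shows "((\<lambda>\<tau>. J i g \<tau> / V i \<tau>) \<longlongrightarrow> 0) (at_right a)"
proof -
  have b: "b \<in> {a<..b}" using ab by simp
  obtain B where B: "\<forall>\<tau>\<in>{a<..b}. \<forall>h. hom h \<longrightarrow> (\<forall>l<n. h l \<tau> = g l \<tau>) \<longrightarrow>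
    \<bar>J i h b\<bar> \<le> B * (\<Sum>l<n. \<bar>g l \<tau>\<bar>)"
    using J_small_solution[OF g b less_imp_le[OF i]] by blast
  have le: "J i g \<tau> / V i \<tau> \<le> (B / V i b) * (\<Sum>l<n. \<bar>g l \<tau>\<bar>)" if \<tau>: "\<tau> \<in> {a<..b}" for \<tau>
  proof -
    obtain h where h: "hom h" "\<And>l. l < n \<Longrightarrow> h l \<tau> = g l \<tau>"
      using hom_exists[of \<tau> "\<lambda>l. g l \<tau>"] \<tau> by auto
    have hs: "ts h" "\<And>s. s \<in> {a..b} \<Longrightarrow> L h s = 0" using h(1) by (auto simp: hom_def)
    have eq: "J j h \<tau> = J j g \<tau>" if "j < n" for j
      unfolding J_def by (rule jet_op_cong) (use h(2) that in auto)
    have nn: "0 \<le> J j h \<tau>" if "j < n" for j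
      unfolding eq[OF that] using J_nonneg_zero_jet[OF g L _ \<tau>] that by simp
    have "\<forall>s. \<tau> \<le> s \<and> s \<le> b \<longrightarrow> 0 \<le> J (Suc i) h s"
      by (rule J_nonneg_above[OF hs(1) \<tau> nn]) (use hs(2) \<tau> i in auto)
    then have "J i h \<tau> / V i \<tau> \<le> J i h b / V i b"
      using \<tau> by (intro J_nonneg_step(2)[OF hs(1) i \<tau> nn[OF i]]) auto
    also have "\<dots> \<le> (B * (\<Sum>l<n. \<bar>g l \<tau>\<bar>)) / V i b"
    proof (rule divide_right_mono)
      have "\<bar>J i h b\<bar> \<le> B * (\<Sum>l<n. \<bar>g l \<tau>\<bar>)" using B \<tau> h by blast
      then show "J i h b \<le> B * (\<Sum>l<n. \<bar>g l \<tau>\<bar>)" by linarith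
    qed (use V_pos[OF i b] in simp)
    finally show ?thesis by (simp add: eq[OF i])
  qed
  have ge: "0 \<le> J i g \<tau> / V i \<tau>" if "\<tau> \<in> {a<..b}" for \<tau>
    using J_nonneg_zero_jet[OF g L less_imp_le[OF i] that] V_pos[OF i that] by simp
  show ?thesis
    by (rule tendsto_sandwich[OF _ _ tendsto_const jets_tendsto_0[OF g, of "B / V i b"]])
      (use le ge in \<open>auto intro: eventually_mono[OF interior_eventually]\<close>)
qed

text \<open>A solution \<open>h\<close> with the jet of \<open>u\<close> at \<open>a\<close> has at
  least \<open>n - i\<close> zeros there and does not contribute to \<open>J i\<close>. The rest has
  a zero jet but an image without sign; adding \<open>H\<close> times the solution \<open>r\<close>
  of \<open>L r = 1\<close> makes the image nonnegative, and both pieces fall under the signed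
  case.\<close>

lemma J_limit:
  assumes u: "ts u" "\<And>l. l < m \<Longrightarrow> u l a = 0" and i: "n - m \<le> i" "i < n"
  shows "((\<lambda>\<tau>. J i u \<tau> / V i \<tau>) \<longlongrightarrow> 0) (at_right a)"
proof -
  have a: "a \<in> {a..b}" using ab by simp
  obtain h where h: "hom h" "\<And>l. l < n \<Longrightarrow> h l a = u l a"
    using hom_exists[OF a, of "\<lambda>l. u l a"] by auto
  have hs: "ts h" "\<And>s. s \<in> {a..b} \<Longrightarrow> L h s = 0" using h(1) by (auto simp: hom_def)
  define g where "g = (\<lambda>l t. u l t - h l t)"
  have g: "ts g" "\<And>l. l < n \<Longrightarrow> g l a = 0" unfolding g_def using u(1) hs(1) h(2) by (auto intro: tower_diff)
  have "\<exists>r. ts r \<and> (\<forall>i<n. r i a = 0) \<and> (\<forall>t\<in>{a..b}. L r t = 1)"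
    by (rule ivp[OF less_imp_le[OF ab] cont continuous_on_const a])
  then obtain r where r: "ts r" "\<And>i. i < n \<Longrightarrow> r i a = 0" "\<And>t. t \<in> {a..b} \<Longrightarrow> L r t = 1" by blast
  have "bounded (L g ` {a..b})"
    by (intro compact_imp_bounded compact_continuous_image lin_op_continuous cont g) auto
  then obtain H where H: "\<And>t. t \<in> {a..b} \<Longrightarrow> \<bar>L g t\<bar> \<le> H"
    unfolding bounded_iff by fastforce
  have 1: "((\<lambda>\<tau>. J i (\<lambda>l t. H * r l t + g l t) \<tau> / V i \<tau>) \<longlongrightarrow> 0) (at_right a)"
  proof (rule J_limit_nonneg_zero_jet[OF _ _ _ i(2)])
    show "0 \<le> L (\<lambda>l t. H * r l t + g l t) s" if "s \<in> {a..b}" for s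
      using H[OF that] r(3)[OF that] unfolding lin_op_add lin_op_scale by simp
  qed (use r g in \<open>auto intro!: tower_add tower_scale\<close>)
  have 2: "((\<lambda>\<tau>. H * (J i r \<tau> / V i \<tau>)) \<longlongrightarrow> H * 0) (at_right a)"
    by (intro tendsto_mult tendsto_const J_limit_nonneg_zero_jet i r) (use r(3) in auto)
  have "((\<lambda>\<tau>. J i g \<tau> / V i \<tau>) \<longlongrightarrow> 0) (at_right a)"
    using tendsto_diff[OF 1 2] by (simp add: J_def jet_op_add jet_op_scale add_divide_distrib)
  moreover have "J i g \<tau> = J i u \<tau>" if "\<tau> \<in> {a<..b}" for \<tau>
  proof -
    have "J i h \<tau> = 0" by (rule J_hom[OF _ h(1) _ that]) (use i h(2) u(2) in auto)
    then show ?thesis by (simp add: J_def g_def jet_op_diff)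
  qed
  then have "\<forall>\<^sub>F \<tau> in at_right a. J i g \<tau> / V i \<tau> = J i u \<tau> / V i \<tau>"
    by (auto intro: eventually_mono[OF interior_eventually])
  ultimately show ?thesis by (rule Lim_transform_eventually)
qed

section \<open>Sign patterns and signed factors\<close>

definition avoids :: "(real \<Rightarrow> real) \<Rightarrow> bool" where
  "avoids f \<longleftrightarrow> \<not> (\<exists>t1 t2 t3. a < t1 \<and> t1 < t2 \<and> t2 < t3 \<and> t3 \<le> b \<and> 0 < f t1 \<and> f t2 < 0 \<and> 0 < f t3)"

definition strictly_avoids :: "(real \<Rightarrow> real) \<Rightarrow> bool" where
  "strictly_avoids f \<longleftrightarrow> \<not> (\<exists>t1 t2 t3. a < t1 \<and> t1 < t2 \<and> t2 < t3 \<and> t3 \<le> b \<and> 0 < f t1 \<and> f t2 \<le> 0 \<and> 0 < f t3)"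

lemma rise_imp_pos:
  assumes d: "\<And>t. t \<in> {a<..b} \<Longrightarrow> (f has_real_derivative f' t) (at t within {a<..b})"
    and "a < s" "s < t" "t \<le> b" "f s < f t"
  shows "\<exists>x. s < x \<and> x < t \<and> 0 < f' x"
proof -
  obtain x where x: "s < x" "x < t" "f t - f s = f' x * (t - s)"
    using mvt_within[OF assms(3) _ d] assms(2,4) by force
  then have "0 < f' x * (t - s)" using assms by linarith
  with x show ?thesis by (auto simp: zero_less_mult_iff)
qed

lemma fall_imp_neg:
  assumes d: "\<And>t. t \<in> {a<..b} \<Longrightarrow> (f has_real_derivative f' t) (at t within {a<..b})"
    and "a < s" "s < t" "t \<le> b" "f t < f s"
  shows "\<exists>x. s < x \<and> x < t \<and> f' x < 0"
  using rise_imp_pos[of "\<lambda>t. - f t" "\<lambda>t. - f' t" s t] assms by (auto intro: derivative_intros)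

text \<open>The limit 0 at \<open>a\<close> forces a rise before \<open>t1\<close>, so a pattern of
  \<open>f\<close> produces the full pattern (+, -, +) of \<open>f'\<close>. Strictness is gained
  because reaching 0 at \<open>t2\<close> already forces a fall.\<close>

lemma avoids_forward:
  assumes d: "\<And>t. t \<in> {a<..b} \<Longrightarrow> (f has_real_derivative f' t) (at t within {a<..b})"
    and lim: "(f \<longlongrightarrow> 0) (at_right a)" and f': "avoids f'"
  shows "strictly_avoids f"
  unfolding strictly_avoids_def
proof
  assume "\<exists>t1 t2 t3. a < t1 \<and> t1 < t2 \<and> t2 < t3 \<and> t3 \<le> b \<and> 0 < f t1 \<and> f t2 \<le> 0 \<and> 0 < f t3"
  then obtain t1 t2 t3 where t: "a < t1" "t1 < t2" "t2 < t3" "t3 \<le> b" "0 < f t1" "f t2 \<le> 0" "0 < f t3"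
    by blast
  have "\<forall>\<^sub>F \<tau> in at_right a. f \<tau> < f t1" by (rule order_tendstoD(2)[OF lim t(5)])
  moreover have "\<forall>\<^sub>F \<tau> in at_right a. a < \<tau> \<and> \<tau> < t1"
    unfolding eventually_at_right_field using t(1) by (intro exI[of _ t1]) auto
  ultimately have "\<forall>\<^sub>F \<tau> in at_right a. a < \<tau> \<and> \<tau> < t1 \<and> f \<tau> < f t1"
    by eventually_elim simp
  then obtain \<tau> where \<tau>: "a < \<tau>" "\<tau> < t1" "f \<tau> < f t1"
    using eventually_happens[of _ "at_right a"] by (auto simp: trivial_limit_at_right_real)
  obtain x1 where "\<tau> < x1" "x1 < t1" "0 < f' x1" using rise_imp_pos[OF d, of \<tau> t1] \<tau> t by auto
  moreover obtain x2 where "t1 < x2" "x2 < t2" "f' x2 < 0" using fall_imp_neg[OF d, of t1 t2] t by auto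
  moreover obtain x3 where "t2 < x3" "x3 < t3" "0 < f' x3" using rise_imp_pos[OF d, of t2 t3] t by auto
  ultimately have "a < x1" "x1 < x2" "x2 < x3" "x3 \<le> b" "0 < f' x1" "f' x2 < 0" "0 < f' x3"
    using \<tau> t by auto
  with f' show False unfolding avoids_def by blast
qed

text \<open>The zero at \<open>b\<close> forces a fall after \<open>t3\<close>, so the derivative
  shows (-, +, -); this accounts for the sign in the hypothesis on \<open>f'\<close>.\<close>

lemma avoids_backward:
  assumes d: "\<And>t. t \<in> {a<..b} \<Longrightarrow> (f has_real_derivative f' t) (at t within {a<..b})"
    and fb: "f b = 0" and f': "avoids (\<lambda>t. - f' t)"
  shows "strictly_avoids f"
  unfolding strictly_avoids_def
proof
  assume "\<exists>t1 t2 t3. a < t1 \<and> t1 < t2 \<and> t2 < t3 \<and> t3 \<le> b \<and> 0 < f t1 \<and> f t2 \<le> 0 \<and> 0 < f t3"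
  then obtain t1 t2 t3 where t: "a < t1" "t1 < t2" "t2 < t3" "t3 \<le> b" "0 < f t1" "f t2 \<le> 0" "0 < f t3"
    by blast
  have "t3 < b" using t(4,7) fb by (cases "t3 = b") auto
  obtain x1 where "t1 < x1" "x1 < t2" "f' x1 < 0" using fall_imp_neg[OF d, of t1 t2] t by auto
  moreover obtain x2 where "t2 < x2" "x2 < t3" "0 < f' x2" using rise_imp_pos[OF d, of t2 t3] t by auto
  moreover obtain x3 where "t3 < x3" "x3 < b" "f' x3 < 0"
    using fall_imp_neg[OF d, of t3 b] t fb \<open>t3 < b\<close> by auto
  ultimately have "a < x1" "x1 < x2" "x2 < x3" "x3 \<le> b" "0 < - f' x1" "- f' x2 < 0" "0 < - f' x3"
    using t by auto
  with f' show False unfolding avoids_def by blast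
qed

lemma avoids_pos_mult:
  assumes "\<And>t. t \<in> {a<..b} \<Longrightarrow> 0 < v t"
  shows "avoids (\<lambda>t. f t / v t) \<longleftrightarrow> avoids f"
proof -
  have *: "0 < f t / v t \<longleftrightarrow> 0 < f t" "f t / v t < 0 \<longleftrightarrow> f t < 0" if "a < t" "t \<le> b" for t
    using assms[of t] that by (auto simp: zero_less_divide_iff divide_less_0_iff)
  show ?thesis unfolding avoids_def using * by (smt (verit, best))
qed

lemma strictly_avoids_imp_avoids: "strictly_avoids f \<Longrightarrow> avoids f"
  unfolding strictly_avoids_def avoids_def by (meson less_imp_le)

definition X :: "nat \<Rightarrow> (nat \<Rightarrow> real \<Rightarrow> real) \<Rightarrow> bool" where
  "X m g \<longleftrightarrow> ts g \<and> (\<forall>i<m. g i a = 0) \<and> (\<forall>i<n - m. g i b = 0)"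

definition op :: "nat \<Rightarrow> (nat \<Rightarrow> real \<Rightarrow> real) \<Rightarrow> real \<Rightarrow> real" where
  "op m g t = (-1) ^ (n - m) * L g t"

text \<open>For \<open>u\<close> in \<open>X m\<close> the quotients \<open>J i u / V i\<close> with
  \<open>i < n - m\<close> vanish at \<open>b\<close>, the others tend to 0 at \<open>a\<close>.
  Integration backwards from \<open>b\<close> reverses signs, so the alternating factor for the
  former makes every step preserve them; at \<open>i = n\<close> it is the sign in
  \<open>op\<close>.\<close>

definition W :: "nat \<Rightarrow> nat \<Rightarrow> (nat \<Rightarrow> real \<Rightarrow> real) \<Rightarrow> real \<Rightarrow> real" where
  "W m i u t = (-1) ^ min i (n - m) * J i u t"

lemma W_deriv:
  assumes "ts u" "i < n" "t \<in> {a<..b}"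
  shows "((\<lambda>t. W m i u t / V i t) has_real_derivative
    (if n - m \<le> i then 1 else -1) * (W m (Suc i) u t / V i t)) (at t within {a<..b})"
proof -
  have "(-1) ^ min i (n - m) = (if n - m \<le> i then 1 else -1 :: real) * (-1) ^ min (Suc i) (n - m)"
    by (auto simp: min_def not_less_eq_eq le_Suc_eq)
  then have "(-1) ^ min i (n - m) * (J (Suc i) u t / V i t)
      = (if n - m \<le> i then 1 else -1) * (W m (Suc i) u t / V i t)"
    unfolding W_def by simp
  with DERIV_cmult[OF J_deriv[OF assms(2,1,3)], of "(-1) ^ min i (n - m)"]
  show ?thesis unfolding W_def times_divide_eq_right by (simp only:)
qed

lemma W_b: "X m u \<Longrightarrow> i < n - m \<Longrightarrow> W m i u b = 0"
  by (simp add: W_def J_def X_def jet_op_0)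

lemma W_lim:
  assumes "X m u" "n - m \<le> i" "i < n"
  shows "((\<lambda>t. W m i u t / V i t) \<longlongrightarrow> 0) (at_right a)"
proof -
  have "((\<lambda>t. J i u t / V i t) \<longlongrightarrow> 0) (at_right a)"
    by (rule J_limit[of u m]) (use assms in \<open>auto simp: X_def\<close>)
  from tendsto_mult[OF tendsto_const[of "(-1) ^ min i (n - m)"] this]
  show ?thesis by (simp add: W_def)
qed

lemma W_n: "ts u \<Longrightarrow> t \<in> {a<..b} \<Longrightarrow> W m n u t = op m u t"
  by (simp add: W_def op_def J_n)

lemma W_0: "W m 0 u t = u 0 t"
  by (simp add: W_def J_0)

lemma avoids_cong: "(\<And>t. t \<in> {a<..b} \<Longrightarrow> f t = g t) \<Longrightarrow> avoids f \<longleftrightarrow> avoids g"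
  unfolding avoids_def by (smt (verit, best) greaterThanAtMost_iff)

lemma W_strictly_avoids:
  assumes u: "X m u" and i: "i < n" and "avoids (W m (Suc i) u)"
  shows "strictly_avoids (\<lambda>t. W m i u t / V i t)"
proof -
  have ts: "ts u" using u by (simp add: X_def)
  have av: "avoids (\<lambda>t. W m (Suc i) u t / V i t)"
    using avoids_pos_mult[of "V i"] V_pos[OF i] assms(3) by blast
  show ?thesis
  proof (cases "n - m \<le> i")
    case True
    show ?thesis
      by (rule avoids_forward[OF W_deriv[OF ts i] W_lim[OF u True i]]) (use True av in simp_all)
  next
    case False
    show ?thesis
      by (rule avoids_backward[OF W_deriv[OF ts i]]) (use False av W_b[OF u] in simp_all)
  qed
qed

lemma W_avoids:
  assumes u: "X m u" and av: "avoids (op m u)" and i: "i \<le> n"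
  shows "avoids (W m i u)"
  using i
proof (induction i rule: inc_induct)
  case base
  show ?case using av avoids_cong[of "W m n u" "op m u"] W_n u by (simp add: X_def)
next
  case (step i)
  then have "avoids (\<lambda>t. W m i u t / V i t)"
    using W_strictly_avoids[OF u step.hyps(2)] strictly_avoids_imp_avoids by blast
  then show ?case using avoids_pos_mult[of "V i"] V_pos[OF step.hyps(2)] by blast
qed

lemma solution_strictly_avoids:
  assumes u: "X m u" and av: "avoids (op m u)"
  shows "strictly_avoids (u 0)"
proof -
  have "strictly_avoids (\<lambda>t. W m 0 u t / V 0 t)"
    by (rule W_strictly_avoids[OF u n_pos W_avoids[OF u av]]) (use n_pos in simp)
  moreover have "0 < f t / V 0 t \<longleftrightarrow> 0 < f t" "f t / V 0 t \<le> 0 \<longleftrightarrow> f t \<le> 0" if "a < t" "t \<le> b" for f t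
    using V_pos[OF n_pos, of t] that by (auto simp: zero_less_divide_iff divide_le_0_iff)
  ultimately show ?thesis unfolding strictly_avoids_def W_0 by (smt (verit, best))
qed

lemma W_nonneg_step:
  assumes u: "X m u" and i: "i < n" and nn: "\<And>t. t \<in> {a<..b} \<Longrightarrow> 0 \<le> W m (Suc i) u t"
    and t: "t \<in> {a<..b}"
  shows "0 \<le> W m i u t / V i t"
proof (rule ccontr)
  assume neg: "\<not> 0 \<le> W m i u t / V i t"
  have ts: "ts u" using u by (simp add: X_def)
  have q: "0 \<le> W m (Suc i) u x / V i x" if "x \<in> {a<..b}" for x
    using nn[OF that] V_pos[OF i that] by simp
  show False
  proof (cases "n - m \<le> i")
    case True
    have "\<forall>\<^sub>F \<tau> in at_right a. W m i u t / V i t < W m i u \<tau> / V i \<tau>"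
      by (rule order_tendstoD(1)[OF W_lim[OF u True i]]) (use neg in simp)
    moreover have "\<forall>\<^sub>F \<tau> in at_right a. a < \<tau> \<and> \<tau> < t"
      unfolding eventually_at_right_field using t by (intro exI[of _ t]) auto
    ultimately have "\<forall>\<^sub>F \<tau> in at_right a. a < \<tau> \<and> \<tau> < t \<and> W m i u t / V i t < W m i u \<tau> / V i \<tau>"
      by eventually_elim simp
    then obtain \<tau> where \<tau>: "a < \<tau>" "\<tau> < t" "W m i u t / V i t < W m i u \<tau> / V i \<tau>"
      using eventually_happens[of _ "at_right a"] by (auto simp: trivial_limit_at_right_real)
    obtain x where "\<tau> < x" "x < t" "(if n - m \<le> i then 1 else -1) * (W m (Suc i) u x / V i x) < 0"
      using fall_imp_neg[OF W_deriv[OF ts i], of \<tau> t m] \<tau> t by auto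
    then show False using q[of x] True \<tau> t by simp
  next
    case False
    then have "W m i u b = 0" by (intro W_b[OF u]) auto
    then have "t \<noteq> b" "W m i u t / V i t < W m i u b / V i b" using neg by auto
    then obtain x where "t < x" "x < b" "0 < (if n - m \<le> i then 1 else -1) * (W m (Suc i) u x / V i x)"
      using rise_imp_pos[OF W_deriv[OF ts i], of t b m] t by auto
    then show False using q[of x] False t by simp
  qed
qed

lemma W_nonneg:
  assumes u: "X m u" and L: "\<And>t. t \<in> {a<..b} \<Longrightarrow> 0 \<le> op m u t" and i: "i \<le> n"
  shows "\<forall>t\<in>{a<..b}. 0 \<le> W m i u t"
  using i
proof (induction i rule: inc_induct)
  case base
  show ?case using L W_n u by (simp add: X_def)
next
  case (step i)
  show ?case
  proof
    fix t assume t: "t \<in> {a<..b}"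
    have "0 \<le> W m i u t / V i t"
      by (rule W_nonneg_step[OF u step.hyps(2) _ t]) (use step.IH in blast)
    then show "0 \<le> W m i u t" using V_pos[OF step.hyps(2) t] by (simp add: zero_le_divide_iff)
  qed
qed

lemma solution_nonneg:
  assumes u: "X m u" and L: "\<And>t. t \<in> {a..b} \<Longrightarrow> 0 \<le> op m u t" and t: "t \<in> {a..b}"
  shows "0 \<le> u 0 t"
proof (cases "t = a")
  case False
  then show ?thesis using W_nonneg[OF u L, of 0] t by (simp add: W_0)
next
  case True
  have ge: "0 \<le> u 0 \<tau>" if "\<tau> \<in> {a<..b}" for \<tau>
    using W_nonneg[OF u L, of 0] that by (simp add: W_0)
  \<comment> \<open>The factorization says nothing at \<open>a\<close> itself, so the value there is
    obtained as a limit.\<close>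
  have "(u 0 \<longlongrightarrow> u 0 a) (at_right a)"
    by (rule continuous_near_left[OF tower_continuous ab]) (use u in \<open>auto simp: X_def\<close>)
  then have "0 \<le> u 0 a"
    by (rule tendsto_lowerbound) (use ge in \<open>auto intro: eventually_mono[OF interior_eventually]\<close>)
  with True show ?thesis by simp
qed

lemma W_pos_forward:
  assumes u: "X m u" and L: "\<And>t. t \<in> {a<..b} \<Longrightarrow> 0 \<le> op m u t" and i: "i < n" "n - m \<le> i"
    and cd: "a < c" "c < d" "d \<le> b" "\<And>t. c < t \<Longrightarrow> t < d \<Longrightarrow> 0 < W m (Suc i) u t"
    and t: "d \<le> t" "t \<le> b"
  shows "0 < W m i u t"
proof -
  have ts: "ts u" using u by (simp add: X_def)
  have nn: "0 \<le> W m i u x / V i x" "0 \<le> W m (Suc i) u x / V i x" if "x \<in> {a<..b}" for x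
    using W_nonneg[OF u L] i(1) V_pos[OF i(1) that] that by auto
  have "W m i u d / V i d \<le> W m i u t / V i t"
    by (rule nonneg_deriv_imp_le[OF t(1) _ W_deriv[OF ts i(1)]]) (use cd t nn(2) i(2) in auto)
  moreover obtain x where x: "c < x" "x < d" "W m i u d / V i d - W m i u c / V i c
      = ((if n - m \<le> i then 1 else -1) * (W m (Suc i) u x / V i x)) * (d - c)"
    using mvt_within[OF cd(2) _ W_deriv[OF ts i(1)], of m] cd by force
  moreover have "0 < W m (Suc i) u x / V i x" using cd x V_pos[OF i(1), of x] by auto
  then have "0 < ((if n - m \<le> i then 1 else -1) * (W m (Suc i) u x / V i x)) * (d - c)"
    using cd i(2) by (intro mult_pos_pos) auto
  moreover have "0 \<le> W m i u c / V i c" using cd by (intro nn) auto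
  ultimately have "0 < W m i u t / V i t" by linarith
  then show ?thesis using V_pos[OF i(1), of t] t cd by (auto simp: zero_less_divide_iff)
qed

lemma W_pos_backward:
  assumes u: "X m u" and L: "\<And>t. t \<in> {a<..b} \<Longrightarrow> 0 \<le> op m u t" and i: "i < n - m"
    and c: "a < c" "c < b" "\<And>t. c < t \<Longrightarrow> t < b \<Longrightarrow> 0 < W m (Suc i) u t"
    and t: "a < t" "t < b"
  shows "0 < W m i u t"
proof -
  have ts: "ts u" and i': "i < n" using u i by (auto simp: X_def)
  have nn: "0 \<le> W m i u x / V i x" "0 \<le> W m (Suc i) u x / V i x" if "x \<in> {a<..b}" for x
    using W_nonneg[OF u L] i' V_pos[OF i' that] that by auto
  define s where "s = max c t"
  have s: "t \<le> s" "c \<le> s" "s < b" using c t by (auto simp: s_def)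
  have "- (W m i u t / V i t) \<le> - (W m i u s / V i s)"
    by (rule nonneg_deriv_imp_le[OF s(1) _ DERIV_minus[OF W_deriv[OF ts i']]]) (use c t s nn(2) i in auto)
  moreover obtain x where x: "s < x" "x < b" "W m i u b / V i b - W m i u s / V i s
      = ((if n - m \<le> i then 1 else -1) * (W m (Suc i) u x / V i x)) * (b - s)"
    using mvt_within[OF s(3) _ W_deriv[OF ts i'], of m] s t c by force
  moreover have "0 < W m (Suc i) u x / V i x" using c x s V_pos[OF i', of x] by auto
  then have "0 < (W m (Suc i) u x / V i x) * (b - s)" using s by (intro mult_pos_pos) auto
  moreover have "W m i u b = 0" by (rule W_b[OF u i])
  ultimately have "0 < W m i u t / V i t" using i by simp
  then show ?thesis using V_pos[OF i', of t] t by (auto simp: zero_less_divide_iff)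
qed

text \<open>A forward factor spreads positivity from an interval to everything on its right, a
  backward factor from a neighbourhood of \<open>b\<close> to all of (a,b). Since
  \<open>1 \<le> m\<close> and \<open>m < n\<close> there is at least one of each kind, so local
  positivity of the image reaches the whole open interval.\<close>

lemma solution_pos:
  assumes u: "X m u" and m: "1 \<le> m" "m < n" and L: "\<And>t. t \<in> {a..b} \<Longrightarrow> 0 \<le> op m u t"
    and t0: "a < t0" "t0 < b" "0 < op m u t0" and t: "a < t" "t < b"
  shows "0 < u 0 t"
proof -
  have ts: "ts u" using u by (simp add: X_def)
  have L': "\<And>t. t \<in> {a<..b} \<Longrightarrow> 0 \<le> op m u t" using L by simp
  have "continuous_on {a<..<b} (op m u)"
    unfolding op_def[abs_def]
    by (intro continuous_intros continuous_on_subset[OF lin_op_continuous[OF cont ts]]) auto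
  then have "isCont (op m u) t0" using t0 by (simp add: continuous_on_eq_continuous_at)
  then have "\<forall>\<^sub>F x in at_right t0. 0 < op m u x"
    by (intro order_tendstoD(1)[OF _ t0(3)]) (simp add: isCont_def filterlim_at_split)
  then obtain d0 where d0: "t0 < d0" "\<And>x. t0 < x \<Longrightarrow> x < d0 \<Longrightarrow> 0 < op m u x"
    unfolding eventually_at_right_field by blast
  have fw: "\<exists>c d. a < c \<and> c < d \<and> d < b \<and> (\<forall>t. c < t \<and> t < d \<longrightarrow> 0 < W m i u t)"
    if "n - m \<le> i" "i \<le> n" for i
    using that(2,1)
  proof (induction i rule: inc_induct)
    case base
    have "0 < W m n u x" if "t0 < x" "x < min d0 ((t0 + b) / 2)" for x
      using W_n[OF ts, of x m] d0(2)[of x] that t0 by auto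
    then show ?case using d0(1) t0 by (intro exI[of _ t0] exI[of _ "min d0 ((t0 + b) / 2)"]) (auto simp: min_less_iff_disj)
  next
    case (step i)
    then obtain c d where cd: "a < c" "c < d" "d < b" "\<And>t. c < t \<Longrightarrow> t < d \<Longrightarrow> 0 < W m (Suc i) u t"
      by (meson le_Suc_eq)
    have "0 < W m i u x" if "d < x" "x < (d + b) / 2" for x
      by (rule W_pos_forward[OF u L' step.hyps(2) _ cd(1,2) _ cd(4)]) (use that cd step in auto)
    then show ?case using cd by (intro exI[of _ d] exI[of _ "(d + b) / 2"]) auto
  qed
  have bw: "\<exists>c. a < c \<and> c < b \<and> (\<forall>t. c < t \<and> t < b \<longrightarrow> 0 < W m i u t)" if "i \<le> n - m" for i
    using that
  proof (induction i rule: inc_induct)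
    case base
    \<comment> \<open>Because \<open>1 \<le> m\<close>, index \<open>n - m\<close> still belongs to
      a forward factor; it extends positivity all the way to \<open>b\<close>, which the backward
      factors need as their start.\<close>
    have "n - m \<le> Suc (n - m)" "Suc (n - m) \<le> n" using m by auto
    from fw[OF this] obtain c d where
      cd: "a < c" "c < d" "d < b" "\<And>t. c < t \<Longrightarrow> t < d \<Longrightarrow> 0 < W m (Suc (n - m)) u t" by blast
    have "0 < W m (n - m) u x" if "d < x" "x < b" for x
      by (rule W_pos_forward[OF u L' _ _ cd(1,2) _ cd(4)]) (use that cd m in auto)
    then show ?case using cd by (intro exI[of _ d]) auto
  next
    case (step i)
    then obtain c where c: "a < c" "c < b" "\<And>t. c < t \<Longrightarrow> t < b \<Longrightarrow> 0 < W m (Suc i) u t" by blast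
    have "0 < W m i u x" if "a < x" "x < b" for x
      by (rule W_pos_backward[OF u L' step.hyps(2) c that])
    then show ?case using c by (intro exI[of _ c]) auto
  qed
  have "Suc 0 \<le> n - m" using m by simp
  from bw[OF this] obtain c where
    c: "a < c" "c < b" "\<And>t. c < t \<Longrightarrow> t < b \<Longrightarrow> 0 < W m (Suc 0) u t" by blast
  have "0 < W m 0 u t" by (rule W_pos_backward[OF u L' _ c t]) (use m in auto)
  then show ?thesis by (simp add: W_0)
qed

end

section \<open>Resolvents and inverse positivity\<close>

lemma lin_op_shift:
  assumes "0 < n"
  shows "lin_op n (p(0 := \<lambda>t. p 0 t - c)) g t = lin_op n p g t - c * g 0 t"
proof -
  obtain k where k: "n = Suc k" using assms by (cases n) auto
  show ?thesis unfolding lin_op_def k sum.lessThan_Suc_shift by (simp add: algebra_simps)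
qed

lemma sup_attained:
  fixes u :: "real \<Rightarrow> real"
  assumes "continuous_on {a..b} u" "a \<le> b"
  shows "\<exists>s\<in>{a..b}. \<forall>t\<in>{a..b}. \<bar>u t\<bar> \<le> \<bar>u s\<bar>"
  by (rule continuous_attains_sup) (use assms in \<open>auto intro!: continuous_intros\<close>)

context disconj_op
begin

lemma X_ts: "X m g \<Longrightarrow> ts g"
  by (simp add: X_def)

lemma X_cont: "X m g \<Longrightarrow> i \<le> n \<Longrightarrow> continuous_on {a..b} (g i)"
  by (auto simp: X_def intro: tower_continuous)

lemma le0: "0 \<le> n"
  by simp

lemma X_add: "X m g \<Longrightarrow> X m h \<Longrightarrow> X m (\<lambda>i t. g i t + h i t)"
  by (simp add: X_def tower_add)

lemma X_diff: "X m g \<Longrightarrow> X m h \<Longrightarrow> X m (\<lambda>i t. g i t - h i t)"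
  by (simp add: X_def tower_diff)

lemma X_scale: "X m g \<Longrightarrow> X m (\<lambda>i t. c * g i t)"
  by (simp add: X_def tower_scale)

lemma op_add: "op m (\<lambda>i t. g i t + h i t) t = op m g t + op m h t"
  by (simp add: op_def lin_op_add algebra_simps)

lemma op_diff: "op m (\<lambda>i t. g i t - h i t) t = op m g t - op m h t"
  by (simp add: op_def lin_op_diff algebra_simps)

lemma op_scale: "op m (\<lambda>i t. c * g i t) t = c * op m g t"
  by (simp add: op_def lin_op_scale)

lemma X_minus: "X m g \<Longrightarrow> X m (\<lambda>i t. - g i t)"
  using X_scale[of m g "-1"] by simp

lemma op_minus: "op m (\<lambda>i t. - g i t) t = - op m g t"
  using op_scale[of m "-1" g t] by simp

lemma op_Suc: "m < n \<Longrightarrow> op (Suc m) g t = - op m g t"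
  by (simp add: op_def Suc_diff_Suc[symmetric])

lemma op_cont: "ts g \<Longrightarrow> continuous_on {a..b} (op m g)"
  unfolding op_def[abs_def] by (intro continuous_intros lin_op_continuous cont)

lemma tower_eq: "ts g \<Longrightarrow> ts h \<Longrightarrow> (\<And>t. t \<in> {a..b} \<Longrightarrow> g 0 t = h 0 t) \<Longrightarrow> i \<le> n \<Longrightarrow> t \<in> {a..b} \<Longrightarrow> g i t = h i t"
  by (rule tower_eq_on[OF _ _ order_refl ab])

definition eig :: "nat \<Rightarrow> real \<Rightarrow> bool" where
  "eig m \<mu> \<longleftrightarrow> (\<exists>g. X m g \<and> (\<exists>t\<in>{a..b}. g 0 t \<noteq> 0) \<and> (\<forall>t\<in>{a..b}. op m g t = \<mu> * g 0 t))"

definition IP :: "nat \<Rightarrow> real \<Rightarrow> bool" where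
  "IP m \<mu> \<longleftrightarrow> (\<forall>g. X m g \<longrightarrow> (\<forall>t\<in>{a..b}. \<mu> * g 0 t \<le> op m g t) \<longrightarrow> (\<forall>t\<in>{a..b}. 0 \<le> g 0 t))"

lemma IP_D: "IP m \<mu> \<Longrightarrow> X m g \<Longrightarrow> (\<And>t. t \<in> {a..b} \<Longrightarrow> \<mu> * g 0 t \<le> op m g t) \<Longrightarrow> t \<in> {a..b} \<Longrightarrow> 0 \<le> g 0 t"
  unfolding IP_def by blast

lemma not_eig_D: "\<not> eig m \<mu> \<Longrightarrow> X m g \<Longrightarrow> (\<And>t. t \<in> {a..b} \<Longrightarrow> op m g t = \<mu> * g 0 t) \<Longrightarrow> t \<in> {a..b} \<Longrightarrow> g 0 t = 0"
  unfolding eig_def by blast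

lemma IP_not_eig:
  assumes "IP m \<mu>"
  shows "\<not> eig m \<mu>"
proof
  assume "eig m \<mu>"
  then obtain g s where g: "X m g" "s \<in> {a..b}" "g 0 s \<noteq> 0" "\<And>t. t \<in> {a..b} \<Longrightarrow> op m g t = \<mu> * g 0 t"
    unfolding eig_def by blast
  have "0 \<le> g 0 s" by (rule IP_D[OF assms g(1) _ g(2)]) (simp add: g)
  moreover have "0 \<le> - g 0 s"
    by (rule IP_D[OF assms X_minus[OF g(1)] _ g(2)]) (simp add: g op_minus)
  ultimately show False using g(3) by simp
qed

section \<open>Resolvents and their bounds\<close>

lemma shifted_op: "((-1) ^ (n - m) * lin_op n (p(0 := \<lambda>t. p 0 t - (-1) ^ (n - m) * \<mu>)) g t) = op m g t - \<mu> * g 0 t"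
  by (simp add: lin_op_shift[OF n_pos] op_def right_diff_distrib)

lemma shifted_cont: "i < n \<Longrightarrow> continuous_on {a..b} ((p(0 := \<lambda>t. p 0 t - c)) i)"
  using cont[of i] cont[OF n_pos] by (auto intro: continuous_intros)

lemma boundary_solvable:
  assumes m: "m \<le> n" and ne: "\<not> eig m \<mu>"
  shows "\<exists>z. ts z \<and> (\<forall>t\<in>{a..b}. op m z t = \<mu> * z 0 t) \<and> (\<forall>i<m. z i a = 0) \<and> (\<forall>i<n-m. z i b = \<beta> i)"
proof -
  let ?p = "p(0 := \<lambda>t. p 0 t - (-1) ^ (n - m) * \<mu>)"
  have 0: "lin_op n ?p g t = 0 \<longleftrightarrow> op m g t = \<mu> * g 0 t" for g t
    using shifted_op[of m \<mu> g t] by auto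
  have "\<exists>z. ts z \<and> (\<forall>t\<in>{a..b}. lin_op n ?p z t = 0) \<and> (\<forall>i<m. z i a = 0) \<and> (\<forall>i<n-m. z i b = \<beta> i)"
  proof (rule two_point_solvable[OF ab shifted_cont _ _ m])
    fix g assume "ts g" "\<forall>r\<in>{a..b}. lin_op n ?p g r = 0" "\<forall>i<m. g i a = 0" "\<forall>i<n - m. g i b = 0"
    then have "X m g" "\<And>r. r \<in> {a..b} \<Longrightarrow> op m g r = \<mu> * g 0 r" using 0 by (auto simp: X_def)
    then show "\<forall>r\<in>{a..b}. g 0 r = 0" using not_eig_D[OF ne] by blast
  qed (use ab in auto)
  then show ?thesis unfolding 0 .
qed

text \<open>A bound of the resolvent from the sup norm to the C^n norm; higher derivatives are
  included because positivity near the end points is read off from them.\<close>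

definition res_const :: "nat \<Rightarrow> real \<Rightarrow> real \<Rightarrow> bool" where
  "res_const m \<mu> C \<longleftrightarrow> 0 < C \<and> \<not> eig m \<mu> \<and> (\<forall>f. continuous_on {a..b} f \<longrightarrow>
     (\<exists>g. X m g \<and> (\<forall>t\<in>{a..b}. op m g t - \<mu> * g 0 t = f t) \<and>
        (\<forall>F. (\<forall>t\<in>{a..b}. \<bar>f t\<bar> \<le> F) \<longrightarrow> (\<forall>i\<le>n. \<forall>t\<in>{a..b}. \<bar>g i t\<bar> \<le> C * F))))"

lemma res_const_exists:
  assumes m: "m \<le> n" and ne: "\<not> eig m \<mu>"
  shows "\<exists>C. res_const m \<mu> C"
proof -
  let ?p = "p(0 := \<lambda>t. p 0 t - (-1) ^ (n - m) * \<mu>)"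
  have a: "a \<in> {a..b}" using ab by simp
  have lin: "lin_op n ?p g t = (-1) ^ (n - m) * (op m g t - \<mu> * g 0 t)" for g t
    using shifted_op[of m \<mu> g t] by (metis left_minus_one_mult_self)
  have "\<forall>j. \<exists>z. ts z \<and> (\<forall>t\<in>{a..b}. op m z t = \<mu> * z 0 t) \<and> (\<forall>i<m. z i a = 0) \<and>
    (\<forall>i<n-m. z i b = (if i = j then 1 else 0))"
    by (intro allI boundary_solvable[OF m ne])
  from choice[OF this] obtain Z where Z: "\<And>j. ts (Z j)" "\<And>j t. t \<in> {a..b} \<Longrightarrow> op m (Z j) t = \<mu> * Z j 0 t"
    "\<And>i j. i < m \<Longrightarrow> Z j i a = 0" "\<And>i j. i < n - m \<Longrightarrow> Z j i b = (if i = j then 1 else 0)"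
    by blast
  show ?thesis
  proof (rule lin_op_apriori[of n a b ?p, OF shifted_cont])
    fix C assume C: "0 \<le> C" "\<And>g F t0 t i. ts g \<Longrightarrow> (\<And>s. s \<in> {a..b} \<Longrightarrow> \<bar>lin_op n ?p g s\<bar> \<le> F) \<Longrightarrow>
       t0 \<in> {a..b} \<Longrightarrow> t \<in> {a..b} \<Longrightarrow> i \<le> n \<Longrightarrow> \<bar>g i t\<bar> \<le> C * ((\<Sum>j<n. \<bar>g j t0\<bar>) + F)"
    define D where "D = (\<lambda>j. C * (\<Sum>l<n. \<bar>Z j l a\<bar>))"
    have D: "\<bar>Z j i t\<bar> \<le> D j" if "i \<le> n" "t \<in> {a..b}" for i j t
      using C(2)[of "Z j" 0 a t i] Z(1,2) that a by (simp add: D_def lin)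
    \<comment> \<open>The particular solution \<open>r\<close> with zero jet at \<open>a\<close> has
      size \<open>C * F\<close>; removing its derivatives at \<open>b\<close> by means of the
      solutions \<open>Z j\<close> costs the sum. The summand 1 makes the constant positive.\<close>
    define C' where "C' = C + (\<Sum>j<n-m. C * D j) + 1"
    have D0: "0 \<le> D j" for j using C(1) by (simp add: D_def sum_nonneg)
    have C': "0 < C'" "C + (\<Sum>j<n-m. C * D j) \<le> C'"
      using C(1) D0 by (auto simp: C'_def intro!: add_nonneg_pos add_nonneg_nonneg sum_nonneg)
    have "\<exists>g. X m g \<and> (\<forall>t\<in>{a..b}. op m g t - \<mu> * g 0 t = f t) \<and>
        (\<forall>F. (\<forall>t\<in>{a..b}. \<bar>f t\<bar> \<le> F) \<longrightarrow> (\<forall>i\<le>n. \<forall>t\<in>{a..b}. \<bar>g i t\<bar> \<le> C' * F))"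
      if f: "continuous_on {a..b} f" for f
    proof -
      have "\<exists>r. ts r \<and> (\<forall>i<n. r i a = 0) \<and> (\<forall>t\<in>{a..b}. lin_op n ?p r t = (-1) ^ (n - m) * f t)"
        by (rule ivp[OF less_imp_le[OF ab] shifted_cont _ a]) (assumption, intro continuous_intros f)
      then obtain r where r: "ts r" "\<And>i. i < n \<Longrightarrow> r i a = 0"
        "\<And>t. t \<in> {a..b} \<Longrightarrow> op m r t - \<mu> * r 0 t = f t"
        unfolding lin by auto
      define g where "g = (\<lambda>i t. r i t - (\<Sum>j<n-m. r j b * Z j i t))"
      have "ts g" unfolding g_def by (intro tower_diff r tower_sum tower_scale Z) auto
      then have "X m g"
        using r(2) m by (simp add: X_def g_def Z if_distrib cong: if_cong)
      moreover have "op m g t - \<mu> * g 0 t = f t" if t: "t \<in> {a..b}" for t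
      proof -
        have "op m (\<lambda>i t. \<Sum>j<n-m. r j b * Z j i t) t = (\<Sum>j<n-m. r j b * op m (Z j) t)"
          unfolding op_def lin_op_sum by (simp add: sum_distrib_left mult_ac)
        also have "\<dots> = \<mu> * (\<Sum>j<n-m. r j b * Z j 0 t)"
          by (simp add: Z(2)[OF t] sum_distrib_left mult_ac)
        finally show ?thesis using r(3)[OF t] unfolding g_def op_diff by (simp add: right_diff_distrib)
      qed
      moreover have "\<bar>g i t\<bar> \<le> C' * F" if F: "\<forall>t\<in>{a..b}. \<bar>f t\<bar> \<le> F" and i: "i \<le> n" and t: "t \<in> {a..b}" for F i t
      proof -
        have F0: "0 \<le> F" using F a by force
        have rb: "\<bar>r j s\<bar> \<le> C * F" if "j \<le> n" "s \<in> {a..b}" for j s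
          using C(2)[of r F a s j] r F that a by (simp add: lin abs_mult)
        have "\<bar>g i t\<bar> \<le> \<bar>r i t\<bar> + (\<Sum>j<n-m. \<bar>r j b * Z j i t\<bar>)"
          unfolding g_def by (rule order_trans[OF abs_triangle_ineq4 add_left_mono[OF sum_abs]])
        also have "\<dots> \<le> C * F + (\<Sum>j<n-m. (C * F) * D j)"
          unfolding abs_mult using rb D i t ab C(1) F0
          by (intro add_mono sum_mono mult_mono) auto
        also have "\<dots> = (C + (\<Sum>j<n-m. C * D j)) * F"
          by (simp add: algebra_simps sum_distrib_left)
        also have "\<dots> \<le> C' * F" by (rule mult_right_mono[OF C'(2) F0])
        finally show ?thesis .
      qed
      ultimately show ?thesis by (intro exI[of _ g]) blast
    qed
    with C'(1) ne show "\<exists>C. res_const m \<mu> C" unfolding res_const_def by (intro exI[of _ C']) blast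
  qed
qed

lemma resolvent:
  assumes "m \<le> n" "\<not> eig m \<mu>" "continuous_on {a..b} f"
  obtains g where "X m g" "\<forall>t\<in>{a..b}. op m g t = \<mu> * g 0 t + f t"
proof -
  obtain C where "res_const m \<mu> C" using res_const_exists assms by blast
  with assms(3) obtain g where "X m g" "\<forall>t\<in>{a..b}. op m g t - \<mu> * g 0 t = f t"
    unfolding res_const_def by blast
  then show ?thesis by (intro that[of g]) (auto simp: algebra_simps)
qed

text \<open>Perturbation of the resolvent: moving the parameter by at most
  \<open>1 / (8 * C)\<close> at most doubles the constant. The 1/8 suits \<open>IP_near\<close>,
  where two such displacements against the constant \<open>2 * C\<close> must leave a factor
  1/2.\<close>

lemma res_const_bound:
  assumes C: "res_const m s C" and near: "\<bar>\<mu> - s\<bar> * C \<le> 1 / 8"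
    and g: "X m g" "\<And>t. t \<in> {a..b} \<Longrightarrow> \<bar>op m g t - \<mu> * g 0 t\<bar> \<le> F"
    and i: "i \<le> n" "t \<in> {a..b}"
  shows "\<bar>g i t\<bar> \<le> 2 * C * F"
proof -
  have C0: "0 < C" and ne: "\<not> eig m s" using C by (auto simp: res_const_def)
  obtain r where r: "r \<in> {a..b}" "\<forall>t\<in>{a..b}. \<bar>g 0 t\<bar> \<le> \<bar>g 0 r\<bar>"
    using sup_attained[OF X_cont[OF g(1) le0] less_imp_le[OF ab]] by blast
  define G where "G = \<bar>g 0 r\<bar>"
  have G: "r \<in> {a..b}" "\<bar>g 0 r\<bar> = G" "\<And>t. t \<in> {a..b} \<Longrightarrow> \<bar>g 0 t\<bar> \<le> G"
    using r by (auto simp: G_def)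
  have "continuous_on {a..b} (\<lambda>t. op m g t - s * g 0 t)"
    using g(1) by (intro continuous_intros op_cont X_cont[OF g(1)]) (auto simp: X_def)
  with C obtain h where h: "X m h" "\<forall>t\<in>{a..b}. op m h t - s * h 0 t = op m g t - s * g 0 t"
    "\<And>F. (\<forall>t\<in>{a..b}. \<bar>op m g t - s * g 0 t\<bar> \<le> F) \<Longrightarrow> \<forall>i\<le>n. \<forall>t\<in>{a..b}. \<bar>h i t\<bar> \<le> C * F"
    unfolding res_const_def by blast
  have eq: "h i t = g i t" if "i \<le> n" "t \<in> {a..b}" for i t
  proof (rule tower_eq[OF X_ts[OF h(1)] X_ts[OF g(1)] _ that])
    fix t assume t: "t \<in> {a..b}"
    have "h 0 t - g 0 t = 0"
      by (rule not_eig_D[OF ne X_diff[OF h(1) g(1)] _ t])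
        (use h(2) in \<open>auto simp: op_diff algebra_simps\<close>)
    then show "h 0 t = g 0 t" by simp
  qed
  have "\<bar>op m g t - s * g 0 t\<bar> \<le> F + \<bar>\<mu> - s\<bar> * G" if t: "t \<in> {a..b}" for t
  proof -
    have "op m g t - s * g 0 t = (op m g t - \<mu> * g 0 t) + (\<mu> - s) * g 0 t" by (simp add: algebra_simps)
    then have "\<bar>op m g t - s * g 0 t\<bar> \<le> \<bar>op m g t - \<mu> * g 0 t\<bar> + \<bar>\<mu> - s\<bar> * \<bar>g 0 t\<bar>"
      by (metis abs_mult abs_triangle_ineq)
    also have "\<dots> \<le> F + \<bar>\<mu> - s\<bar> * G" using g(2)[OF t] G(3)[OF t] by (intro add_mono mult_left_mono) auto
    finally show ?thesis .
  qed
  then have b: "\<bar>g i t\<bar> \<le> C * (F + \<bar>\<mu> - s\<bar> * G)" if "i \<le> n" "t \<in> {a..b}" for i t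
    using h(3)[of "F + \<bar>\<mu> - s\<bar> * G"] eq[OF that] that by metis
  have small: "C * (\<bar>\<mu> - s\<bar> * G) \<le> (1/8) * G"
    using mult_right_mono[OF near, of G] G by (simp add: mult_ac)
  have "G \<le> C * F + (1/8) * G" using b[OF _ G(1), of 0] G(2) small by (simp add: distrib_left)
  then have "(1/8) * G \<le> C * F" using G(2) by linarith
  with b[OF i] small show ?thesis by (simp add: distrib_left)
qed

lemma near_not_eig:
  assumes C: "res_const m s C" and near: "\<bar>\<mu> - s\<bar> * C \<le> 1 / 8"
  shows "\<not> eig m \<mu>"
proof
  assume "eig m \<mu>"
  then obtain g r where g: "X m g" "r \<in> {a..b}" "g 0 r \<noteq> 0" "\<And>t. t \<in> {a..b} \<Longrightarrow> op m g t = \<mu> * g 0 t"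
    unfolding eig_def by blast
  have "\<bar>g 0 r\<bar> \<le> 2 * C * 0" by (rule res_const_bound[OF C near g(1) _ _ g(2)]) (use g in auto)
  with g(3) show False by simp
qed

text \<open>With \<open>u\<close> the negative part of \<open>g\<close> and \<open>v\<close> its
  resolvent at \<mu>, the function \<open>g + (\<mu>' - \<mu>) * v\<close> is a supersolution for
  \<mu>, hence nonnegative; so \<open>u\<close> is at most half its own maximum. The common centre
  \<open>s\<close> lets the rule both reach a limit parameter from the left and leave it to the
  right.\<close>

lemma IP_near:
  assumes m: "m \<le> n" and C: "res_const m s C" and near: "\<bar>\<mu> - s\<bar> * C \<le> 1 / 8" "\<bar>\<mu>' - s\<bar> * C \<le> 1 / 8"
    and le: "\<mu> \<le> \<mu>'" and IP: "IP m \<mu>"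
  shows "IP m \<mu>'"
  unfolding IP_def
proof (intro allI impI ballI)
  fix g t assume g: "X m g" "\<forall>t\<in>{a..b}. \<mu>' * g 0 t \<le> op m g t" and t: "t \<in> {a..b}"
  define u where "u = (\<lambda>t. max 0 (- g 0 t))"
  have u: "continuous_on {a..b} u" unfolding u_def by (intro continuous_intros X_cont[OF g(1)]) auto
  have C0: "0 < C" using C by (simp add: res_const_def)
  obtain r where r: "r \<in> {a..b}" "\<forall>t\<in>{a..b}. \<bar>u t\<bar> \<le> \<bar>u r\<bar>"
    using sup_attained[OF u less_imp_le[OF ab]] by blast
  define U where "U = \<bar>u r\<bar>"
  have U: "r \<in> {a..b}" "\<bar>u r\<bar> = U" "\<And>t. t \<in> {a..b} \<Longrightarrow> \<bar>u t\<bar> \<le> U"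
    using r by (auto simp: U_def)
  obtain v where v: "X m v" "\<forall>t\<in>{a..b}. op m v t = \<mu> * v 0 t + u t"
    using resolvent[OF m near_not_eig[OF C near(1)] u] by blast
  have vU: "\<bar>v 0 t\<bar> \<le> 2 * C * U" if "t \<in> {a..b}" for t
    by (rule res_const_bound[OF C near(1) v(1) _ _ that]) (use v(2) U in auto)
  have "0 \<le> g 0 t + (\<mu>' - \<mu>) * v 0 t" if t: "t \<in> {a..b}" for t
  proof (rule IP_D[OF IP X_add[OF g(1) X_scale[OF v(1)]] _ t])
    fix t assume t: "t \<in> {a..b}"
    have "0 \<le> (\<mu>' - \<mu>) * (g 0 t + u t)" using le by (intro mult_nonneg_nonneg) (auto simp: u_def)
    moreover have "\<mu>' * g 0 t \<le> op m g t" using g(2) t by blast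
    moreover have "op m v t = \<mu> * v 0 t + u t" using v(2) t by blast
    ultimately show "\<mu> * (g 0 t + (\<mu>' - \<mu>) * v 0 t) \<le> op m (\<lambda>i t. g i t + (\<mu>' - \<mu>) * v i t) t"
      unfolding op_add op_scale by (simp add: algebra_simps)
  qed
  then have ub: "u t \<le> (\<mu>' - \<mu>) * (2 * C * U)" if "t \<in> {a..b}" for t
    using mult_left_mono[of "v 0 t" "2 * C * U" "\<mu>' - \<mu>"] vU[OF that] le that C0 U
    by (fastforce simp: u_def)
  have "(\<mu>' - \<mu>) * C \<le> (\<bar>\<mu> - s\<bar> + \<bar>\<mu>' - s\<bar>) * C" using C0 by (intro mult_right_mono) auto
  then have "(\<mu>' - \<mu>) * C \<le> 1 / 4" using near by (simp add: distrib_right)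
  from mult_right_mono[OF this, of "2 * U"] have "(\<mu>' - \<mu>) * (2 * C * U) \<le> U / 2" using U by simp
  with ub[OF U(1)] U(2) have "U \<le> U / 2" by (auto simp: u_def)
  then have "U \<le> 0" by simp
  with U(3)[OF t] show "0 \<le> g 0 t" by (auto simp: u_def)
qed

lemma res_const_radius:
  assumes "res_const m s C"
  shows "0 < 1 / (8 * C)" "\<bar>\<mu> - s\<bar> \<le> 1 / (8 * C) \<Longrightarrow> \<bar>\<mu> - s\<bar> * C \<le> 1 / 8"
  using assms by (auto simp: res_const_def field_simps)

lemma IP_interval:
  assumes m: "m \<le> n" and IP: "IP m \<mu>0" and le: "\<mu>0 \<le> \<mu>1"
    and ne: "\<And>\<mu>. \<mu>0 \<le> \<mu> \<Longrightarrow> \<mu> \<le> \<mu>1 \<Longrightarrow> \<not> eig m \<mu>"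
  shows "IP m \<mu>1"
proof -
  have "\<forall>\<mu>. \<mu>0 \<le> \<mu> \<and> \<mu> \<le> \<mu>1 \<longrightarrow> IP m \<mu>"
  proof (rule real_interval_induct[of "IP m", OF IP le])
    fix s assume s: "\<mu>0 < s" "s \<le> \<mu>1" "\<And>x. \<mu>0 \<le> x \<Longrightarrow> x < s \<Longrightarrow> IP m x"
    obtain C where C: "res_const m s C" using res_const_exists[OF m ne[of s]] s by auto
    note rad = res_const_radius[OF C]
    define x where "x = max \<mu>0 (s - 1 / (8 * C))"
    have x: "\<mu>0 \<le> x" "x < s" "\<bar>x - s\<bar> \<le> 1 / (8 * C)" using rad(1) s(1) by (auto simp: x_def)
    show "IP m s"
      by (rule IP_near[OF m C rad(2)[OF x(3)] _ less_imp_le[OF x(2)] s(3)[OF x(1,2)]]) simp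
  next
    fix s assume s: "\<mu>0 \<le> s" "s < \<mu>1" "\<And>x. \<mu>0 \<le> x \<Longrightarrow> x \<le> s \<Longrightarrow> IP m x"
    obtain C where C: "res_const m s C" using res_const_exists[OF m ne[of s]] s by auto
    note rad = res_const_radius[OF C]
    have "IP m x" if "s < x" "x < s + 1 / (8 * C)" for x
      by (rule IP_near[OF m C _ rad(2) _ s(3)[of s]]) (use that s in auto)
    then show "\<exists>\<delta>>0. \<forall>x. s < x \<and> x < s + \<delta> \<and> x \<le> \<mu>1 \<longrightarrow> IP m x" using rad(1) by blast
  qed
  with le show ?thesis by blast
qed

lemma IP_0: "IP m 0"
  unfolding IP_def using solution_nonneg by auto

lemma not_eig_0: "\<not> eig m 0"
  by (rule IP_not_eig[OF IP_0])

text \<open>Otherwise inverse positivity holds for every nonnegative \<mu>. Let \<open>f\<close> be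
  a bump supported inside (a,b) and \<open>g\<close> its positive solution. For large \<mu> one has
  \<open>f \<le> \<mu> * g\<close>, so \<open>- g\<close> is a supersolution and would have to be
  nonnegative.\<close>

lemma pos_eig_exists:
  assumes m: "1 \<le> m" "m < n"
  shows "\<exists>l>0. eig m l"
proof (rule ccontr)
  assume no: "\<not> ?thesis"
  have IP: "IP m \<mu>" if "0 \<le> \<mu>" for \<mu>
    by (rule IP_interval[OF less_imp_le[OF m(2)] IP_0 that])
      (use no not_eig_0 in \<open>auto simp: le_less\<close>)
  define c where "c = (2 * a + b) / 3"
  define d where "d = (a + 2 * b) / 3"
  have cd: "a < c" "c < d" "d < b" using ab by (auto simp: c_def d_def)
  define f where "f = (\<lambda>t. max 0 ((t - c) * (d - t)))"
  have f: "continuous_on {a..b} f" unfolding f_def by (intro continuous_intros)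
  obtain g where g: "X m g" "\<forall>t\<in>{a..b}. op m g t = 0 * g 0 t + f t"
    using resolvent[OF less_imp_le[OF m(2)] not_eig_0 f] by blast
  have g0: "0 \<le> g 0 t" if "t \<in> {a..b}" for t
    by (rule solution_nonneg[OF g(1) _ that]) (use g(2) in \<open>auto simp: f_def\<close>)
  have gpos: "0 < g 0 t" if "a < t" "t < b" for t
  proof (rule solution_pos[OF g(1) m _ _ _ _ that])
    define t0 where "t0 = (c + d) / 2"
    have t0: "c < t0" "t0 < d" using cd by (auto simp: t0_def)
    show "a < t0" "t0 < b" using t0 cd by auto
    have "0 < (t0 - c) * (d - t0)" using t0 by simp
    then show "0 < op m g t0" using g(2) t0 cd by (simp add: f_def)
  qed (use g(2) in \<open>auto simp: f_def\<close>)
  have gc: "continuous_on {c..d} (g 0)"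
    by (rule continuous_on_subset[OF X_cont[OF g(1)]]) (use cd in auto)
  obtain x where x: "x \<in> {c..d}" "\<And>t. t \<in> {c..d} \<Longrightarrow> g 0 x \<le> g 0 t"
    using continuous_attains_inf[OF _ _ gc] cd by auto
  have \<eta>: "0 < g 0 x" using gpos x(1) cd by auto
  obtain r where r: "\<forall>t\<in>{a..b}. \<bar>f t\<bar> \<le> \<bar>f r\<bar>"
    using sup_attained[OF f less_imp_le[OF ab]] by blast
  define F where "F = \<bar>f r\<bar>"
  have F: "\<And>t. t \<in> {a..b} \<Longrightarrow> \<bar>f t\<bar> \<le> F" using r by (auto simp: F_def)
  have F0: "0 \<le> F" using F[of a] ab by auto
  \<comment> \<open>On the support \<open>[c, d]\<close> the solution is at least
    \<open>g 0 x\<close>, and elsewhere \<open>f\<close> vanishes; so this quotient suffices for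
    \<open>f \<le> \<mu> * g 0\<close>.\<close>
  define \<mu> where "\<mu> = F / g 0 x"
  have \<mu>: "0 \<le> \<mu>" using F0 \<eta> by (simp add: \<mu>_def)
  have fle: "f t \<le> \<mu> * g 0 t" if t: "t \<in> {a..b}" for t
  proof (cases "t \<in> {c..d}")
    case True
    have "f t \<le> \<mu> * g 0 x" using F[OF t] \<eta> by (simp add: \<mu>_def)
    also have "\<dots> \<le> \<mu> * g 0 t" by (rule mult_left_mono[OF x(2)[OF True] \<mu>])
    finally show ?thesis .
  next
    case False
    then have "f t = 0" using cd by (auto simp: f_def mult_nonneg_nonpos mult_nonpos_nonneg)
    then show ?thesis using \<mu> g0[OF t] by simp
  qed
  have "0 \<le> - g 0 x"
  proof (rule IP_D[OF IP[OF \<mu>] X_minus[OF g(1)]])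
    show "\<mu> * (- g 0 t) \<le> op m (\<lambda>i t. - g i t) t" if "t \<in> {a..b}" for t
      using fle[OF that] g(2) that by (simp add: op_minus)
  qed (use x cd in auto)
  with \<eta> show False by simp
qed

section \<open>The least positive eigenvalue\<close>

definition least_pos_eig :: "nat \<Rightarrow> real \<Rightarrow> bool" where
  "least_pos_eig m l \<longleftrightarrow> 0 < l \<and> eig m l \<and> (\<forall>\<mu>. 0 < \<mu> \<longrightarrow> eig m \<mu> \<longrightarrow> l \<le> \<mu>)"

text \<open>Non-eigenvalues form an open set by the resolvent bound, so the infimum of the positive
  eigenvalues is an eigenvalue; it is not 0 because 0 is none.\<close>

lemma least_pos_eig_exists:
  assumes m: "1 \<le> m" "m < n"
  shows "\<exists>l. least_pos_eig m l"
proof -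
  define E where "E = {l. 0 < l \<and> eig m l}"
  have ne: "E \<noteq> {}" using pos_eig_exists[OF m] by (auto simp: E_def)
  have bdd: "bdd_below E" by (rule bdd_belowI[of _ 0]) (simp add: E_def)
  define l where "l = Inf E"
  have l0: "0 \<le> l" unfolding l_def by (rule cInf_greatest[OF ne]) (simp add: E_def)
  have lower: "l \<le> x" if "x \<in> E" for x unfolding l_def by (rule cInf_lower[OF that bdd])
  have "eig m l"
  proof (rule ccontr)
    assume "\<not> eig m l"
    then obtain C where C: "res_const m l C" using res_const_exists m by (meson less_imp_le)
    note rad = res_const_radius[OF C]
    have "l + 1 / (8 * C) \<le> x" if "x \<in> E" for x
    proof (rule ccontr)
      assume "\<not> l + 1 / (8 * C) \<le> x"
      then have "\<bar>x - l\<bar> \<le> 1 / (8 * C)" using lower[OF that] by simp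
      then have "\<not> eig m x" by (intro near_not_eig[OF C] rad)
      with that show False by (simp add: E_def)
    qed
    then have "l + 1 / (8 * C) \<le> l" unfolding l_def by (intro cInf_greatest[OF ne])
    with rad(1) show False by linarith
  qed
  moreover from this have "l \<noteq> 0" using not_eig_0 by auto
  ultimately show ?thesis using l0 lower unfolding least_pos_eig_def E_def by (intro exI[of _ l]) auto
qed

lemma IP_below_least:
  assumes "m \<le> n" "least_pos_eig m l" "0 \<le> \<mu>" "\<mu> < l"
  shows "IP m \<mu>"
proof (rule IP_interval[OF assms(1) IP_0 assms(3)])
  fix x assume x: "0 \<le> x" "x \<le> \<mu>"
  show "\<not> eig m x"
  proof (cases "x = 0")
    case False
    then have "0 < x" "\<not> l \<le> x" using x assms(4) by auto
    then show ?thesis using assms(2) unfolding least_pos_eig_def by blast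
  qed (use not_eig_0 in simp)
qed

text \<open>Let \<open>w\<close> be an eigenfunction for \<open>l\<close> and \<open>y\<close> the
  nonnegative solution at \<mu> with right-hand side \<open>|w|\<close>. For each \<open>x\<close>
  in \<open>[0, l)\<close> both \<open>(l - x) * y + w\<close> and \<open>(l - x) * y - w\<close>
  are supersolutions at \<open>x\<close>, hence nonnegative. Letting \<open>x\<close> tend to
  \<open>l\<close> forces \<open>w\<close> to vanish.\<close>

lemma not_IP_above_least:
  assumes m: "m \<le> n" and l: "least_pos_eig m l" and le: "l \<le> \<mu>"
  shows "\<not> IP m \<mu>"
proof
  assume IP: "IP m \<mu>"
  have l0: "0 < l" "eig m l" using l by (auto simp: least_pos_eig_def)
  then obtain w r where w: "X m w" "r \<in> {a..b}" "w 0 r \<noteq> 0" "\<And>t. t \<in> {a..b} \<Longrightarrow> op m w t = l * w 0 t"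
    unfolding eig_def by blast
  have wc: "continuous_on {a..b} (\<lambda>t. \<bar>w 0 t\<bar>)" by (intro continuous_intros X_cont[OF w(1)]) simp
  obtain y where y: "X m y" "\<forall>t\<in>{a..b}. op m y t = \<mu> * y 0 t + \<bar>w 0 t\<bar>"
    using resolvent[OF m IP_not_eig[OF IP] wc] by blast
  have y0: "0 \<le> y 0 t" if "t \<in> {a..b}" for t by (rule IP_D[OF IP y(1) _ that]) (use y(2) in auto)
  have "\<bar>w 0 r\<bar> \<le> (l - x) * y 0 r" if x: "0 \<le> x" "x < l" for x
  proof -
    have *: "0 \<le> (l - x) * y 0 r + c * w 0 r" if c: "c = 1 \<or> c = -1" for c
    proof (rule IP_D[OF IP_below_least[OF m l x] X_add[OF X_scale[OF y(1)] X_scale[OF w(1)]] _ w(2)])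
      fix t assume t: "t \<in> {a..b}"
      have "0 \<le> (l - x) * (\<bar>w 0 t\<bar> + c * w 0 t)" using c x by (intro mult_nonneg_nonneg) auto
      moreover have "0 \<le> (l - x) * ((\<mu> - x) * y 0 t)" using x le y0[OF t] by (intro mult_nonneg_nonneg) auto
      moreover have "op m y t = \<mu> * y 0 t + \<bar>w 0 t\<bar>" using y(2) t by blast
      ultimately show "x * ((l - x) * y 0 t + c * w 0 t) \<le> op m (\<lambda>i t. (l - x) * y i t + c * w i t) t"
        unfolding op_add op_scale using w(4)[OF t] by (simp add: algebra_simps)
    qed
    show ?thesis using *[of 1] *[of "-1"] by linarith
  qed
  note key = this
  have "\<bar>w 0 r\<bar> \<le> 0"
  proof (rule nonpos_if_le_small_multiples[OF l0(1) y0[OF w(2)]])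
    show "\<bar>w 0 r\<bar> \<le> \<delta> * y 0 r" if "0 < \<delta>" "\<delta> \<le> l" for \<delta>
      using key[of "l - \<delta>"] that by simp
  qed
  with w(3) show False by simp
qed

text \<open>The error of replacing \<nu> by \<open>x\<close> is repaired by \<open>\<nu> - x\<close>
  times the solution with image \<open>|g|\<close> at parameter 0. As no resolvent at
  \<open>- \<nu>\<close> enters, the end point of the parameter range is included.\<close>

lemma IP_closed_below:
  assumes m: "m \<le> n" and \<nu>: "0 < \<nu>" and IP: "\<And>x. 0 \<le> x \<Longrightarrow> x < \<nu> \<Longrightarrow> IP m (- x)"
  shows "IP m (- \<nu>)"
  unfolding IP_def
proof (intro allI impI ballI)
  fix g t assume g: "X m g" "\<forall>t\<in>{a..b}. - \<nu> * g 0 t \<le> op m g t" and t: "t \<in> {a..b}"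
  have gc: "continuous_on {a..b} (\<lambda>t. \<bar>g 0 t\<bar>)" by (intro continuous_intros X_cont[OF g(1)]) simp
  obtain y where y: "X m y" "\<forall>t\<in>{a..b}. op m y t = 0 * y 0 t + \<bar>g 0 t\<bar>"
    using resolvent[OF m not_eig_0 gc] by blast
  have y0: "0 \<le> y 0 t" if "t \<in> {a..b}" for t by (rule IP_D[OF IP_0 y(1) _ that]) (use y(2) in auto)
  have key: "0 \<le> g 0 t + (\<nu> - x) * y 0 t" if x: "0 \<le> x" "x < \<nu>" for x
  proof (rule IP_D[OF IP[OF x] X_add[OF g(1) X_scale[OF y(1)]] _ t])
    fix t assume t: "t \<in> {a..b}"
    have "0 \<le> (\<nu> - x) * (\<bar>g 0 t\<bar> - g 0 t)" using x by (intro mult_nonneg_nonneg) auto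
    moreover have "0 \<le> x * ((\<nu> - x) * y 0 t)" using x y0[OF t] by (intro mult_nonneg_nonneg) auto
    moreover have "op m y t = \<bar>g 0 t\<bar>" "- \<nu> * g 0 t \<le> op m g t" using y(2) g(2) t by auto
    ultimately show "- x * (g 0 t + (\<nu> - x) * y 0 t) \<le> op m (\<lambda>i t. g i t + (\<nu> - x) * y i t) t"
      unfolding op_add op_scale by (simp add: algebra_simps)
  qed
  have "- g 0 t \<le> 0"
  proof (rule nonpos_if_le_small_multiples[OF \<nu> y0[OF t]])
    show "- g 0 t \<le> \<delta> * y 0 t" if "0 < \<delta>" "\<delta> \<le> \<nu>" for \<delta>
      using key[of "\<nu> - \<delta>"] that by simp
  qed
  then show "0 \<le> g 0 t" by simp
qed

end

section \<open>Negative spectral parameters below the bound\<close>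

lemma near_left:
  fixes f :: "real \<Rightarrow> real"
  assumes f: "continuous_on {a..b} f" "0 < f a" and c: "a < c" "c \<le> b"
  shows "\<exists>r. a < r \<and> r \<le> c \<and> (\<forall>t\<in>{a..r}. f a / 2 < f t)"
proof -
  have "a \<in> {a..b}" using c by simp
  with f obtain d where d: "0 < d" "\<forall>t\<in>{a..b}. dist t a < d \<longrightarrow> dist (f t) (f a) < f a / 2"
    unfolding continuous_on_iff by (meson half_gt_zero)
  have "f a / 2 < f t" if t: "t \<in> {a..min c (a + d / 2)}" for t
  proof -
    have "dist t a < d" "t \<in> {a..b}" using t d(1) c by (auto simp: dist_real_def)
    then have "dist (f t) (f a) < f a / 2" using d(2) by blast
    then show ?thesis unfolding dist_real_def by linarith
  qed
  then show ?thesis using c d(1) by (intro exI[of _ "min c (a + d / 2)"]) auto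
qed

lemma near_right:
  fixes f :: "real \<Rightarrow> real"
  assumes f: "continuous_on {a..b} f" "0 < f b" and c: "a \<le> c" "c < b"
  shows "\<exists>r. c \<le> r \<and> r < b \<and> (\<forall>t\<in>{r..b}. f b / 2 < f t)"
proof -
  have "b \<in> {a..b}" using c by simp
  with f obtain d where d: "0 < d" "\<forall>t\<in>{a..b}. dist t b < d \<longrightarrow> dist (f t) (f b) < f b / 2"
    unfolding continuous_on_iff by (meson half_gt_zero)
  have "f b / 2 < f t" if t: "t \<in> {max c (b - d / 2)..b}" for t
  proof -
    have "dist t b < d" "t \<in> {a..b}" using t d(1) c by (auto simp: dist_real_def)
    then have "dist (f t) (f b) < f b / 2" using d(2) by blast
    then show ?thesis unfolding dist_real_def by linarith
  qed
  then show ?thesis using c d(1) by (intro exI[of _ "max c (b - d / 2)"]) auto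
qed

text \<open>Iterated mean value theorem in place of Taylor's formula: below order \<open>q\<close>
  the derivatives vanish at \<open>a\<close>, so the sign of the \<open>q\<close>-th derivative
  descends to the function.\<close>

lemma tower_left_sign:
  assumes g: "tower {a..b} n g" and q: "q \<le> n" "\<And>i. i < q \<Longrightarrow> g i a = 0" and r: "r \<le> b"
    and R: "R = (<) \<or> R = (\<le>)" and pos: "\<And>t. a < t \<Longrightarrow> t \<le> r \<Longrightarrow> R 0 (g q t)"
    and t: "a < t" "t \<le> r"
  shows "R 0 (g 0 t :: real)"
proof -
  have "\<forall>t. a < t \<and> t \<le> r \<longrightarrow> R 0 (g i t)" if "i \<le> q" for i
    using that
  proof (induction i rule: inc_induct)
    case base
    show ?case using pos by blast
  next
    case (step i)
    show ?case
    proof (intro allI impI)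
      fix t assume t: "a < t \<and> t \<le> r"
      obtain x where x: "a < x" "x < t" "g i t - g i a = g (Suc i) x * (t - a)"
        using mvt_within[of a t "{a..b}" "g i" "g (Suc i)"] tower_deriv[OF g, of i] t r step.hyps q(1) by auto
      have "R 0 (g (Suc i) x)" using step.IH x t by auto
      then have "R 0 (g (Suc i) x * (t - a))" using R t by auto
      then show "R 0 (g i t)" using x(3) q(2)[OF step.hyps(2)] by simp
    qed
  qed
  then show ?thesis using t by blast
qed

lemma tower_right_sign:
  assumes g: "tower {a..b} n g" and q: "q \<le> n" "\<And>i. i < q \<Longrightarrow> g i b = 0" and r: "a \<le> r"
    and R: "R = (<) \<or> R = (\<le>)" and pos: "\<And>t. r \<le> t \<Longrightarrow> t < b \<Longrightarrow> R 0 ((-1) ^ q * g q t)"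
    and t: "r \<le> t" "t < b"
  shows "R 0 (g 0 t :: real)"
proof -
  have "\<forall>t. r \<le> t \<and> t < b \<longrightarrow> R 0 ((-1) ^ i * g i t)" if "i \<le> q" for i
    using that
  proof (induction i rule: inc_induct)
    case base
    show ?case using pos by blast
  next
    case (step i)
    show ?case
    proof (intro allI impI)
      fix t assume t: "r \<le> t \<and> t < b"
      obtain x where x: "t < x" "x < b" "g i b - g i t = g (Suc i) x * (b - t)"
        using mvt_within[of t b "{a..b}" "g i" "g (Suc i)"] tower_deriv[OF g, of i] t r step.hyps q(1) by auto
      have "R 0 ((-1) ^ Suc i * g (Suc i) x)" using step.IH x t by auto
      then have "R 0 (((-1) ^ Suc i * g (Suc i) x) * (b - t))" using R t by (auto simp del: power_Suc)
      moreover have "((-1) ^ Suc i * g (Suc i) x) * (b - t) = (-1) ^ i * g i t"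
        using x(3)[symmetric] q(2)[OF step.hyps(2)] by (simp add: mult.assoc)
      ultimately show "R 0 ((-1) ^ i * g i t)" by simp
    qed
  qed
  from this[of 0] show ?thesis using t by auto
qed

lemma leading_left_nonneg:
  assumes g: "tower {a..b} n g" and q: "q \<le> n" "\<And>i. i < q \<Longrightarrow> g i a = 0" and "a < b"
    and nn: "\<And>t. t \<in> {a..b} \<Longrightarrow> 0 \<le> g 0 t"
  shows "0 \<le> g q a"
proof (rule ccontr)
  assume "\<not> 0 \<le> g q a"
  then obtain r where r: "a < r" "r \<le> b" "\<forall>t\<in>{a..r}. - g q a / 2 < - g q t"
    using near_left[of a b "\<lambda>t. - g q t" b] tower_continuous[OF g q(1)] \<open>a < b\<close>
    by (auto intro: continuous_on_minus)
  have "0 < -1 * g 0 r"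
  proof (rule tower_left_sign[OF tower_scale[OF g] q(1), of _ r "(<)"])
    show "0 < -1 * g q t" if "a < t" "t \<le> r" for t
    proof -
      have "- g q a / 2 < - g q t" using r(3) that by auto
      then show ?thesis using \<open>\<not> 0 \<le> g q a\<close> by simp
    qed
  qed (use r q(2) in auto)
  with nn[of r] r show False by simp
qed

lemma leading_right_nonneg:
  assumes g: "tower {a..b} n g" and q: "q \<le> n" "\<And>i. i < q \<Longrightarrow> g i b = 0" and "a < b"
    and nn: "\<And>t. t \<in> {a..b} \<Longrightarrow> 0 \<le> g 0 t"
  shows "0 \<le> (-1) ^ q * g q b"
proof (rule ccontr)
  assume neg: "\<not> 0 \<le> (-1) ^ q * g q b"
  have "continuous_on {a..b} (\<lambda>t. - ((-1) ^ q * g q t))"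
    by (intro continuous_intros tower_continuous[OF g q(1)])
  with neg obtain r where r: "a \<le> r" "r < b" "\<forall>t\<in>{r..b}. - ((-1) ^ q * g q b) / 2 < - ((-1) ^ q * g q t)"
    using near_right[of a b "\<lambda>t. - ((-1) ^ q * g q t)" a] \<open>a < b\<close> by auto
  have "0 < -1 * g 0 r"
  proof (rule tower_right_sign[OF tower_scale[OF g] q(1), of _ r "(<)"])
    show "0 < (-1) ^ q * (-1 * g q t)" if "r \<le> t" "t < b" for t
    proof -
      have "- ((-1) ^ q * g q b) / 2 < - ((-1) ^ q * g q t)" using r(3) that by auto
      then show ?thesis using neg by (simp add: mult.commute)
    qed
  qed (use r q(2) in auto)
  with nn[of r] r show False by simp
qed

section \<open>Tent functions\<close>

lemma hat_partition:
  fixes x :: real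
  shows "0 \<le> x \<Longrightarrow> x \<le> real N \<Longrightarrow> (\<Sum>i\<le>N. max 0 (1 - \<bar>x - real i\<bar>)) = 1"
proof (induction N)
  case (Suc N)
  show ?case
  proof (cases "x \<le> real N")
    case True
    then have "max 0 (1 - \<bar>x - real (Suc N)\<bar>) = 0" by simp
    then show ?thesis using Suc.IH Suc.prems True by simp
  next
    case False
    have "(\<Sum>i<N. max 0 (1 - \<bar>x - real i\<bar>)) = 0"
    proof (rule sum.neutral, rule ballI)
      fix i assume "i \<in> {..<N}"
      then have "real i + 1 \<le> real N" by simp
      then show "max 0 (1 - \<bar>x - real i\<bar>) = 0" using False by simp
    qed
    moreover have "{..Suc N} = insert (Suc N) (insert N {..<N})" by auto
    ultimately show ?thesis using False Suc.prems by simp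
  qed
qed simp

text \<open>To the left of the peak \<open>s\<close> the tent rises with slope \<open>K\<close>,
  which is at least the Lipschitz constant of \<open>\<nu> * u\<close>, so the difference cannot
  drop from \<open>t1\<close> to a point \<open>t2 \<le> s\<close>. To the right of \<open>s\<close>
  the same argument starts from \<open>t3\<close>. Nonnegativity of \<open>u\<close> puts the
  starting point into the support of the tent.\<close>

lemma tent_avoids:
  fixes u :: "real \<Rightarrow> real"
  assumes lip: "\<And>x y. a \<le> x \<Longrightarrow> x \<le> y \<Longrightarrow> y \<le> b \<Longrightarrow> \<bar>u y - u x\<bar> \<le> D * (y - x)"
    and \<nu>: "0 \<le> \<nu>" "\<nu> * D \<le> K" and u: "\<And>t. a \<le> t \<Longrightarrow> t \<le> b \<Longrightarrow> 0 \<le> u t"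
    and t: "a < t1" "t1 < t2" "t2 < t3" "t3 \<le> b"
    and h: "0 < max 0 (1 - K * \<bar>t1 - s\<bar>) - \<nu> * u t1" "0 < max 0 (1 - K * \<bar>t3 - s\<bar>) - \<nu> * u t3"
  shows "0 \<le> max 0 (1 - K * \<bar>t2 - s\<bar>) - \<nu> * u t2"
proof -
  have \<nu>u: "0 \<le> \<nu> * u t" if "a \<le> t" "t \<le> b" for t using \<nu>(1) u[OF that] by simp
  have step: "\<nu> * \<bar>u y - u x\<bar> \<le> K * (y - x)" if "a \<le> x" "x \<le> y" "y \<le> b" for x y
  proof -
    have "\<nu> * \<bar>u y - u x\<bar> \<le> \<nu> * (D * (y - x))" using lip[OF that] \<nu>(1) by (rule mult_left_mono)
    also have "\<dots> \<le> K * (y - x)" using mult_right_mono[OF \<nu>(2), of "y - x"] that by (simp add: mult.assoc)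
    finally show ?thesis .
  qed
  show ?thesis
  proof (cases "t2 \<le> s")
    case True
    have "\<nu> * (u t2 - u t1) \<le> \<nu> * \<bar>u t2 - u t1\<bar>" using \<nu>(1) by (intro mult_left_mono) auto
    with step[of t1 t2] t have "\<nu> * (u t2 - u t1) \<le> K * (t2 - t1)" by simp
    moreover have "0 < 1 - K * (s - t1) - \<nu> * u t1"
      using h(1) \<nu>u[of t1] t True by (auto simp: max_def split: if_splits)
    moreover have "1 - K * (s - t2) \<le> max 0 (1 - K * \<bar>t2 - s\<bar>)" using True by simp
    ultimately show ?thesis by (simp add: algebra_simps)
  next
    case False
    have "\<nu> * (u t2 - u t3) \<le> \<nu> * \<bar>u t3 - u t2\<bar>" using \<nu>(1) by (intro mult_left_mono) auto
    with step[of t2 t3] t have "\<nu> * (u t2 - u t3) \<le> K * (t3 - t2)" by simp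
    moreover have "0 < 1 - K * (t3 - s) - \<nu> * u t3"
      using h(2) \<nu>u[of t3] t False by (auto simp: max_def split: if_splits)
    moreover have "1 - K * (t2 - s) \<le> max 0 (1 - K * \<bar>t2 - s\<bar>)" using False by simp
    ultimately show ?thesis by (simp add: algebra_simps)
  qed
qed

context disconj_op
begin

section \<open>Strict positivity and its stability\<close>

lemma X_zero_imp_op_zero:
  assumes "X m u" "\<And>t. t \<in> {a..b} \<Longrightarrow> u 0 t = 0" "t \<in> {a..b}"
  shows "op m u t = 0"
proof -
  have "u i t = 0" if "i \<le> n" for i
    using tower_eq[OF X_ts[OF assms(1)] tower_zero _ that assms(3)] assms(2) by simp
  then show ?thesis by (simp add: op_def lin_op_def)
qed

text \<open>If the leading coefficient at \<open>a\<close> vanished, \<open>u\<close> would lie in \<open>X (Suc k)\<close>, where the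
  operator with the opposite sign forces \<open>u \<le> 0\<close>.\<close>

lemma leading_left_pos:
  assumes k: "k < n" and u: "X k u" "\<And>t. t \<in> {a..b} \<Longrightarrow> 0 \<le> u 0 t"
    and f: "\<And>t. t \<in> {a..b} \<Longrightarrow> - \<nu> * u 0 t \<le> op k u t" and s: "s \<in> {a..b}" "op k u s \<noteq> - \<nu> * u 0 s"
    and IP: "IP (Suc k) \<nu>"
  shows "0 < u k a"
proof -
  have "0 \<le> u k a"
    by (rule leading_left_nonneg[OF X_ts[OF u(1)] _ _ ab u(2)]) (use k u in \<open>auto simp: X_def\<close>)
  moreover have "u k a \<noteq> 0"
  proof
    assume "u k a = 0"
    then have Xk: "X (Suc k) u" using u(1) by (auto simp: X_def less_Suc_eq)
    have "0 \<le> - u 0 t" if "t \<in> {a..b}" for t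
      by (rule IP_D[OF IP X_minus[OF Xk] _ that]) (use f k in \<open>simp add: op_minus op_Suc\<close>)
    then have 0: "u 0 t = 0" if "t \<in> {a..b}" for t using u(2)[OF that] that by force
    then show False using s X_zero_imp_op_zero[OF u(1) 0 s(1)] by simp
  qed
  ultimately show ?thesis by simp
qed

text \<open>Mirror image at \<open>b\<close>: a vanishing leading coefficient adds a zero at
  \<open>b\<close> and puts \<open>u\<close> into \<open>X (k - 1)\<close>, where the operator again
  carries the opposite sign.\<close>

lemma leading_right_pos:
  assumes k: "1 \<le> k" "k \<le> n" and u: "X k u" "\<And>t. t \<in> {a..b} \<Longrightarrow> 0 \<le> u 0 t"
    and f: "\<And>t. t \<in> {a..b} \<Longrightarrow> - \<nu> * u 0 t \<le> op k u t" and s: "s \<in> {a..b}" "op k u s \<noteq> - \<nu> * u 0 s"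
    and IP: "IP (k - 1) \<nu>"
  shows "0 < (-1) ^ (n - k) * u (n - k) b"
proof -
  have "0 \<le> (-1) ^ (n - k) * u (n - k) b"
    by (rule leading_right_nonneg[OF X_ts[OF u(1)] _ _ ab u(2)]) (use k u in \<open>auto simp: X_def\<close>)
  moreover have "u (n - k) b \<noteq> 0"
  proof
    assume "u (n - k) b = 0"
    moreover have "n - (k - 1) = Suc (n - k)" using k by simp
    ultimately have Xk: "X (k - 1) u" using u(1) by (auto simp: X_def less_Suc_eq)
    have "op k g t = - op (k - 1) g t" for g t using op_Suc[of "k - 1" g t] k by simp
    then have "0 \<le> - u 0 t" if "t \<in> {a..b}" for t
      by (intro IP_D[OF IP X_minus[OF Xk] _ that]) (use f in \<open>simp add: op_minus\<close>)
    then have 0: "u 0 t = 0" if "t \<in> {a..b}" for t using u(2)[OF that] that by force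
    then show False using s X_zero_imp_op_zero[OF u(1) 0 s(1)] by simp
  qed
  ultimately show ?thesis by (simp add: order_less_le)
qed

text \<open>Functions close to \<open>u\<close> in the C^n sense share the signs of its leading
  derivatives near the end points; with \<open>k\<close> zeros at \<open>a\<close> and
  \<open>n - k\<close> at \<open>b\<close> this determines the sign of the function there. The
  points \<open>c\<close> and \<open>d\<close> keep the two neighbourhoods apart.\<close>

lemma X_pos_near_ends:
  assumes k: "k \<le> n" and u: "X k u" "0 < u k a" "0 < (-1) ^ (n - k) * u (n - k) b"
    and c: "a < c" "c < d" "d < b"
  obtains r1 r2 \<epsilon> where "a < r1" "r1 \<le> c" "d \<le> r2" "r2 < b" "0 < \<epsilon>"
    "\<And>v t. X k v \<Longrightarrow> (\<And>i t. i \<le> n \<Longrightarrow> t \<in> {a..b} \<Longrightarrow> \<bar>v i t - u i t\<bar> \<le> \<epsilon>) \<Longrightarrow>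
       a < t \<and> t \<le> r1 \<or> r2 \<le> t \<and> t < b \<Longrightarrow> 0 < v 0 t"
proof -
  have uc: "continuous_on {a..b} (u k)" by (rule X_cont[OF u(1) k])
  have ub: "continuous_on {a..b} (\<lambda>t. (-1) ^ (n - k) * u (n - k) t)"
    by (intro continuous_intros X_cont[OF u(1)]) simp
  have c': "c \<le> b" "a \<le> d" using c by auto
  from near_left[OF uc u(2) c(1) c'(1)]
  obtain r1 where r1: "a < r1" "r1 \<le> c" "\<forall>t\<in>{a..r1}. u k a / 2 < u k t" by blast
  from near_right[OF ub u(3) c'(2) c(3)]
  obtain r2 where r2: "d \<le> r2" "r2 < b"
    "\<forall>t\<in>{r2..b}. (-1) ^ (n - k) * u (n - k) b / 2 < (-1) ^ (n - k) * u (n - k) t" by blast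
  define \<epsilon> where "\<epsilon> = min (u k a / 2) ((-1) ^ (n - k) * u (n - k) b / 2)"
  have \<epsilon>: "0 < \<epsilon>" using u by (simp add: \<epsilon>_def)
  have "0 < v 0 t" if v: "X k v" "\<And>i t. i \<le> n \<Longrightarrow> t \<in> {a..b} \<Longrightarrow> \<bar>v i t - u i t\<bar> \<le> \<epsilon>"
    and t: "a < t \<and> t \<le> r1 \<or> r2 \<le> t \<and> t < b" for v t
    using t
  proof
    assume t: "a < t \<and> t \<le> r1"
    show "0 < v 0 t"
    proof (rule tower_left_sign[OF X_ts[OF v(1)] k, of r1 "(<)"])
      show "0 < v k x" if "a < x" "x \<le> r1" for x
      proof -
        have "\<bar>v k x - u k x\<bar> \<le> \<epsilon>" by (rule v(2)) (use k that r1 c in auto)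
        moreover have "u k a / 2 < u k x" using r1(3) that by auto
        moreover have "\<epsilon> \<le> u k a / 2" by (simp add: \<epsilon>_def)
        ultimately show ?thesis by linarith
      qed
    qed (use v(1) t r1 c in \<open>auto simp: X_def\<close>)
  next
    assume t: "r2 \<le> t \<and> t < b"
    show "0 < v 0 t"
    proof (rule tower_right_sign[OF X_ts[OF v(1)], of "n - k" r2 "(<)"])
      show "0 < (-1) ^ (n - k) * v (n - k) x" if "r2 \<le> x" "x < b" for x
      proof -
        have "\<bar>v (n - k) x - u (n - k) x\<bar> \<le> \<epsilon>" by (rule v(2)) (use that r2 c in auto)
        then have "\<bar>(-1) ^ (n - k) * v (n - k) x - (-1) ^ (n - k) * u (n - k) x\<bar> \<le> \<epsilon>"
          by (simp add: right_diff_distrib[symmetric] abs_mult)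
        moreover have "(-1) ^ (n - k) * u (n - k) b / 2 < (-1) ^ (n - k) * u (n - k) x" using r2(3) that by auto
        moreover have "\<epsilon> \<le> (-1) ^ (n - k) * u (n - k) b / 2" by (simp add: \<epsilon>_def)
        ultimately show ?thesis by linarith
      qed
    qed (use v(1) t r2 c in \<open>auto simp: X_def\<close>)
  qed
  with r1 r2 \<epsilon> show ?thesis by (intro that[of r1 r2 \<epsilon>]) auto
qed

text \<open>\<open>u\<close> is an interior point of the cone of nonnegative functions in
  \<open>X k\<close> for the C^n norm: the leading derivatives give room near the ends, compactness
  gives it in between.\<close>

lemma strict_pos_open:
  assumes k: "1 \<le> k" "k < n" and u: "X k u" "0 < u k a" "0 < (-1) ^ (n - k) * u (n - k) b"
    and pos: "\<And>t. a < t \<Longrightarrow> t < b \<Longrightarrow> 0 < u 0 t"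
  shows "\<exists>\<epsilon>>0. \<forall>v. X k v \<longrightarrow> (\<forall>i\<le>n. \<forall>t\<in>{a..b}. \<bar>v i t - u i t\<bar> \<le> \<epsilon>) \<longrightarrow> (\<forall>t\<in>{a..b}. 0 \<le> v 0 t)"
proof -
  define c where "c = (2 * a + b) / 3"
  define d where "d = (a + 2 * b) / 3"
  have cd: "a < c" "c < d" "d < b" using ab by (auto simp: c_def d_def)
  obtain r1 r2 \<epsilon> where r: "a < r1" "r1 \<le> c" "d \<le> r2" "r2 < b" "0 < \<epsilon>"
    "\<And>v t. X k v \<Longrightarrow> (\<And>i t. i \<le> n \<Longrightarrow> t \<in> {a..b} \<Longrightarrow> \<bar>v i t - u i t\<bar> \<le> \<epsilon>) \<Longrightarrow>
       a < t \<and> t \<le> r1 \<or> r2 \<le> t \<and> t < b \<Longrightarrow> 0 < v 0 t"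
    by (rule X_pos_near_ends[OF less_imp_le[OF k(2)] u cd]) blast
  have "continuous_on {r1..r2} (u 0)"
    by (rule continuous_on_subset[OF X_cont[OF u(1) le0]]) (use r in auto)
  then obtain x where x: "x \<in> {r1..r2}" "\<forall>t\<in>{r1..r2}. u 0 x \<le> u 0 t"
    using continuous_attains_inf[of "{r1..r2}" "u 0"] r cd by auto
  define \<eta> where "\<eta> = min \<epsilon> (u 0 x)"
  have "0 < u 0 x" using x(1) r cd by (intro pos) auto
  then have \<eta>: "0 < \<eta>" using r(5) by (simp add: \<eta>_def)
  have "0 \<le> v 0 t" if v: "X k v" "\<forall>i\<le>n. \<forall>t\<in>{a..b}. \<bar>v i t - u i t\<bar> \<le> \<eta>" and t: "t \<in> {a..b}" for v t
  proof -
    have ends: "0 < v 0 t" if "a < t \<and> t \<le> r1 \<or> r2 \<le> t \<and> t < b" for t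
      by (rule r(6)[OF v(1) _ that]) (use v(2) in \<open>force simp: \<eta>_def\<close>)
    consider "t = a" | "t = b" | "a < t \<and> t \<le> r1 \<or> r2 \<le> t \<and> t < b" | "t \<in> {r1..r2}" using t by fastforce
    then show ?thesis
    proof cases
      case 1
      then show ?thesis using v(1) k by (simp add: X_def)
    next
      case 2
      then show ?thesis using v(1) k by (simp add: X_def)
    next
      case 3
      then show ?thesis using ends by (simp add: less_imp_le)
    next
      case 4
      then have "\<bar>v 0 t - u 0 t\<bar> \<le> u 0 x" "u 0 x \<le> u 0 t" using v(2) t x(2) by (auto simp: \<eta>_def)
      then show ?thesis by linarith
    qed
  qed
  with \<eta> show ?thesis by blast
qed

text \<open>Since \<open>u\<close> is positive near both ends, an interior nonpositive value would
  complete the forbidden pattern of a nonpositive value between two positive ones.\<close>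

lemma solution_strictly_pos:
  assumes k: "1 \<le> k" "k < n" and u: "X k u" "0 < u k a" "0 < (-1) ^ (n - k) * u (n - k) b"
    and av: "avoids (op k u)" and t: "a < t" "t < b"
  shows "0 < u 0 t"
proof (rule ccontr)
  assume neg: "\<not> 0 < u 0 t"
  define c where "c = (a + t) / 2"
  define d where "d = (t + b) / 2"
  have cd: "a < c" "c < d" "d < b" "c < t" "t < d" using t by (auto simp: c_def d_def)
  obtain r1 r2 \<epsilon> where r: "a < r1" "r1 \<le> c" "d \<le> r2" "r2 < b" "0 < \<epsilon>"
    "\<And>v t. X k v \<Longrightarrow> (\<And>i t. i \<le> n \<Longrightarrow> t \<in> {a..b} \<Longrightarrow> \<bar>v i t - u i t\<bar> \<le> \<epsilon>) \<Longrightarrow>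
       a < t \<and> t \<le> r1 \<or> r2 \<le> t \<and> t < b \<Longrightarrow> 0 < v 0 t"
    by (rule X_pos_near_ends[OF less_imp_le[OF k(2)] u cd(1-3)]) blast
  have "0 < u 0 r1" "0 < u 0 r2" by (rule r(6)[OF u(1)]; use r in simp)+
  moreover have "a < r1" "r1 < t" "t < r2" "r2 \<le> b" using r cd by auto
  ultimately show False
    using solution_strictly_avoids[OF u(1) av] neg unfolding strictly_avoids_def by force
qed

text \<open>Resolvent identity: the difference solves the equation at \<mu> with right-hand side
  \<open>(\<mu>' - \<mu>) * v\<close>, and \<open>v\<close> is itself bounded by
  \<open>2 * C\<close>.\<close>

lemma resolvent_difference:
  assumes C: "res_const k s0 C" and near: "\<bar>\<mu> - s0\<bar> * C \<le> 1 / 8" "\<bar>\<mu>' - s0\<bar> * C \<le> 1 / 8"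
    and f: "\<And>t. t \<in> {a..b} \<Longrightarrow> \<bar>f t\<bar> \<le> 1"
    and u: "X k u" "\<And>t. t \<in> {a..b} \<Longrightarrow> op k u t = \<mu> * u 0 t + f t"
    and v: "X k v" "\<And>t. t \<in> {a..b} \<Longrightarrow> op k v t = \<mu>' * v 0 t + f t"
    and i: "i \<le> n" "t \<in> {a..b}"
  shows "\<bar>v i t - u i t\<bar> \<le> 2 * C * (\<bar>\<mu>' - \<mu>\<bar> * (2 * C))"
proof (rule res_const_bound[OF C near(1) X_diff[OF v(1) u(1)] _ i])
  fix t assume t: "t \<in> {a..b}"
  have "\<bar>v 0 t\<bar> \<le> 2 * C * 1"
    by (rule res_const_bound[OF C near(2) v(1) _ le0 t]) (use v(2) f in auto)
  then have "\<bar>\<mu>' - \<mu>\<bar> * \<bar>v 0 t\<bar> \<le> \<bar>\<mu>' - \<mu>\<bar> * (2 * C)" by (intro mult_left_mono) auto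
  moreover have "op k (\<lambda>i t. v i t - u i t) t - \<mu> * (v 0 t - u 0 t) = (\<mu>' - \<mu>) * v 0 t"
    unfolding op_diff u(2)[OF t] v(2)[OF t] by (simp add: algebra_simps)
  ultimately show "\<bar>op k (\<lambda>i t. v i t - u i t) t - \<mu> * (v 0 t - u 0 t)\<bar> \<le> \<bar>\<mu>' - \<mu>\<bar> * (2 * C)"
    by (simp add: abs_mult)
qed

text \<open>Homotopy in \<open>\<nu>\<close>: as long as the solution for the tent is nonnegative, the sign pattern
  \<open>(-, +, -)\<close> of \<open>op k u\<close> makes it strictly positive, hence it stays nonnegative for slightly
  larger \<open>\<nu>\<close>.\<close>

lemma tent_solution_nonneg:
  assumes k: "1 \<le> k" "k < n" and C: "res_const k (- m) C" and m: "0 \<le> m" "m \<le> \<nu>1" "(\<nu>1 - m) * C \<le> 1 / 8"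
    and IPs: "\<And>\<nu>. m \<le> \<nu> \<Longrightarrow> \<nu> \<le> \<nu>1 \<Longrightarrow> IP (Suc k) \<nu>" "\<And>\<nu>. m \<le> \<nu> \<Longrightarrow> \<nu> \<le> \<nu>1 \<Longrightarrow> IP (k - 1) \<nu>"
    and IP: "IP k (- m)" and K: "\<nu>1 * (2 * C) \<le> K" and s: "s \<in> {a..b}"
    and u: "X k u" "\<And>t. t \<in> {a..b} \<Longrightarrow> op k u t = - \<nu>1 * u 0 t + max 0 (1 - K * \<bar>t - s\<bar>)"
    and t: "t \<in> {a..b}"
  shows "0 \<le> u 0 t"
proof -
  define \<tau> where "\<tau> = (\<lambda>t. max 0 (1 - K * \<bar>t - s\<bar>))"
  have C0: "0 < C" using C by (simp add: res_const_def)
  have K0: "0 \<le> K" using K C0 m by (smt (verit) mult_nonneg_nonneg)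
  have \<tau>: "0 \<le> \<tau> t" "\<bar>\<tau> t\<bar> \<le> 1" for t using K0 by (auto simp: \<tau>_def)
  have near: "\<bar>- \<nu> - (- m)\<bar> * C \<le> 1 / 8" if "m \<le> \<nu>" "\<nu> \<le> \<nu>1" for \<nu>
  proof -
    have "\<bar>- \<nu> - (- m)\<bar> * C \<le> (\<nu>1 - m) * C" using that C0 by (intro mult_right_mono) auto
    with m(3) show ?thesis by simp
  qed
  have \<tau>c: "continuous_on {a..b} \<tau>" unfolding \<tau>_def by (intro continuous_intros)
  define sol where "sol = (\<lambda>\<nu> u. X k u \<and> (\<forall>t\<in>{a..b}. op k u t = - \<nu> * u 0 t + \<tau> t))"
  define P where "P = (\<lambda>\<nu>. \<forall>u. sol \<nu> u \<longrightarrow> (\<forall>t\<in>{a..b}. 0 \<le> u 0 t))"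
  have ex: "\<exists>u. sol \<nu> u" if range: "m \<le> \<nu>" "\<nu> \<le> \<nu>1" for \<nu>
  proof -
    obtain u where "X k u" "\<forall>t\<in>{a..b}. op k u t = - \<nu> * u 0 t + \<tau> t"
      by (rule resolvent[OF less_imp_le[OF k(2)] near_not_eig[OF C near[OF range]] \<tau>c])
    then show ?thesis unfolding sol_def by blast
  qed
  have diff: "\<bar>v i t - u i t\<bar> \<le> 2 * C * (\<bar>\<nu>' - \<nu>\<bar> * (2 * C))"
    if "m \<le> \<nu>" "\<nu> \<le> \<nu>1" "m \<le> \<nu>'" "\<nu>' \<le> \<nu>1" "sol \<nu> u" "sol \<nu>' v" "i \<le> n" "t \<in> {a..b}" for \<nu> \<nu>' u v i t
    using resolvent_difference[OF C near[OF that(1,2)] near[OF that(3,4)], of \<tau> u v i t] \<tau>(2) that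
    unfolding sol_def by (simp add: abs_minus_commute)
  have "\<forall>\<nu>. m \<le> \<nu> \<and> \<nu> \<le> \<nu>1 \<longrightarrow> P \<nu>"
  proof (rule real_interval_induct[OF _ m(2)])
    show "P m" unfolding P_def sol_def using IP \<tau>(1) unfolding IP_def by simp
  next
    fix \<nu> assume \<nu>: "m < \<nu>" "\<nu> \<le> \<nu>1" "\<And>x. m \<le> x \<Longrightarrow> x < \<nu> \<Longrightarrow> P x"
    show "P \<nu>"
      unfolding P_def
    proof (intro allI impI ballI)
      fix v t assume v: "sol \<nu> v" and t: "t \<in> {a..b}"
      have "- v 0 t \<le> 0"
      proof (rule nonpos_if_le_small_multiples[of "\<nu> - m" "4 * C * C"])
        fix \<delta> assume \<delta>: "0 < \<delta>" "\<delta> \<le> \<nu> - m"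
        obtain u where u: "sol (\<nu> - \<delta>) u" using ex[of "\<nu> - \<delta>"] \<delta> \<nu>(2) by auto
        have "0 \<le> u 0 t" using \<nu>(3)[of "\<nu> - \<delta>"] \<delta> u t unfolding P_def by auto
        moreover have "\<bar>v 0 t - u 0 t\<bar> \<le> 2 * C * (\<bar>\<nu> - (\<nu> - \<delta>)\<bar> * (2 * C))"
          by (rule diff[OF _ _ _ _ u v le0 t]) (use \<delta> \<nu> in auto)
        moreover have "2 * C * (\<bar>\<nu> - (\<nu> - \<delta>)\<bar> * (2 * C)) = \<delta> * (4 * C * C)" using \<delta> by simp
        ultimately show "- v 0 t \<le> \<delta> * (4 * C * C)" by linarith
      qed (use \<nu>(1) C0 in auto)
      then show "0 \<le> v 0 t" by simp
    qed
  next
    fix \<nu> assume \<nu>: "m \<le> \<nu>" "\<nu> < \<nu>1" "\<And>x. m \<le> x \<Longrightarrow> x \<le> \<nu> \<Longrightarrow> P x"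
    obtain u where u: "sol \<nu> u" using ex[of \<nu>] \<nu> by auto
    have uX: "X k u" and uo: "\<And>t. t \<in> {a..b} \<Longrightarrow> op k u t = - \<nu> * u 0 t + \<tau> t"
      using u by (auto simp: sol_def)
    have u0: "0 \<le> u 0 t" if "t \<in> {a..b}" for t using \<nu>(3)[OF \<nu>(1) order_refl] u that unfolding P_def by blast
    \<comment> \<open>The tent has value 1 at its peak, which excludes the zero solution and makes
      both leading coefficients strictly positive.\<close>
    have ne: "op k u s \<noteq> - \<nu> * u 0 s" using uo[OF s] by (simp add: \<tau>_def)
    have ge: "- \<nu> * u 0 t \<le> op k u t" if "t \<in> {a..b}" for t using uo[OF that] \<tau>(1)[of t] by simp
    have l: "0 < u k a"
      by (rule leading_left_pos[OF k(2) uX u0 ge s ne IPs(1)]) (use \<nu> in auto)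
    have r: "0 < (-1) ^ (n - k) * u (n - k) b"
      by (rule leading_right_pos[OF k(1) less_imp_le[OF k(2)] uX u0 ge s ne IPs(2)]) (use \<nu> in auto)
    \<comment> \<open>The Lipschitz constant \<open>2 * C\<close> is the same for all parameters
      between \<open>m\<close> and \<open>\<nu>1\<close>, so one slope \<open>K\<close> serves the
      entire homotopy.\<close>
    have lip: "\<bar>u 0 y - u 0 x\<bar> \<le> (2 * C) * (y - x)" if xy: "a \<le> x" "x \<le> y" "y \<le> b" for x y
    proof (cases "x = y")
      case False
      have "\<And>t. t \<in> {a..b} \<Longrightarrow> (u 0 has_real_derivative u (Suc 0) t) (at t within {a..b})"
        using tower_deriv[OF X_ts[OF uX] n_pos] by simp
      then obtain z where z: "x < z" "z < y" "u 0 y - u 0 x = u (Suc 0) z * (y - x)"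
        using mvt_within[of x y "{a..b}" "u 0" "u (Suc 0)"] xy False by auto
      have "\<bar>u (Suc 0) z\<bar> \<le> 2 * C * 1"
        by (rule res_const_bound[OF C near uX]) (use \<nu> uo \<tau>(2) n_pos z xy in auto)
      then show ?thesis unfolding z(3) abs_mult using xy by (simp add: mult_right_mono)
    qed simp
    have "avoids (op k u)"
      unfolding avoids_def
    proof
      assume "\<exists>t1 t2 t3. a < t1 \<and> t1 < t2 \<and> t2 < t3 \<and> t3 \<le> b \<and> 0 < op k u t1 \<and> op k u t2 < 0 \<and> 0 < op k u t3"
      then obtain t1 t2 t3 where t: "a < t1" "t1 < t2" "t2 < t3" "t3 \<le> b"
        "0 < op k u t1" "op k u t2 < 0" "0 < op k u t3" by blast
      have "\<nu> * (2 * C) \<le> \<nu>1 * (2 * C)" using \<nu> C0 by (intro mult_right_mono) auto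
      then have \<nu>K: "0 \<le> \<nu>" "\<nu> * (2 * C) \<le> K" using K \<nu> m by auto
      have "0 \<le> max 0 (1 - K * \<bar>t2 - s\<bar>) - \<nu> * u 0 t2"
        by (rule tent_avoids[OF lip \<nu>K _ t(1-4)]) (use u0 t uo in \<open>auto simp: \<tau>_def\<close>)
      moreover have "op k u t2 = - \<nu> * u 0 t2 + max 0 (1 - K * \<bar>t2 - s\<bar>)"
        using uo[of t2] t by (simp add: \<tau>_def)
      ultimately show False using t(6) by linarith
    qed
    then have pos: "0 < u 0 t" if "a < t" "t < b" for t
      by (rule solution_strictly_pos[OF k uX l r _ that])
    obtain \<epsilon> where \<epsilon>: "0 < \<epsilon>" "\<And>v. X k v \<Longrightarrow> (\<forall>i\<le>n. \<forall>t\<in>{a..b}. \<bar>v i t - u i t\<bar> \<le> \<epsilon>) \<Longrightarrow> \<forall>t\<in>{a..b}. 0 \<le> v 0 t"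
      using strict_pos_open[OF k uX l r pos] by blast
    \<comment> \<open>By \<open>diff\<close>, a parameter shift of at most \<delta> moves the
      solution by at most \<open>\<delta> * (4 * C * C)\<close>, which is the admissible distance
      \<epsilon>.\<close>
    define \<delta> where "\<delta> = \<epsilon> / (4 * C * C)"
    have "P x" if x: "\<nu> < x" "x < \<nu> + \<delta>" "x \<le> \<nu>1" for x
      unfolding P_def
    proof (intro allI impI)
      fix v assume v: "sol x v"
      have "\<bar>v i t - u i t\<bar> \<le> \<epsilon>" if "i \<le> n" "t \<in> {a..b}" for i t
      proof -
        have "\<bar>v i t - u i t\<bar> \<le> 2 * C * (\<bar>x - \<nu>\<bar> * (2 * C))"
          by (rule diff[OF _ _ _ _ u v that]) (use x \<nu> in auto)
        also have "\<dots> = (x - \<nu>) * (4 * C * C)" using x by simp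
        also have "\<dots> \<le> \<delta> * (4 * C * C)" using x C0 by (intro mult_right_mono) auto
        also have "\<dots> = \<epsilon>" using C0 by (simp add: \<delta>_def)
        finally show ?thesis .
      qed
      then show "\<forall>t\<in>{a..b}. 0 \<le> v 0 t" using v by (intro \<epsilon>(2)) (auto simp: sol_def)
    qed
    moreover have "0 < \<delta>" using \<epsilon>(1) C0 by (simp add: \<delta>_def)
    ultimately show "\<exists>\<delta>>0. \<forall>x. \<nu> < x \<and> x < \<nu> + \<delta> \<and> x \<le> \<nu>1 \<longrightarrow> P x" by blast
  qed
  then have "P \<nu>1" using m(2) by blast
  moreover have "sol \<nu>1 u" using u by (simp add: sol_def \<tau>_def)
  ultimately show ?thesis using t unfolding P_def by blast
qed

text \<open>Piecewise linear interpolation, stated for all large \<open>N\<close> because the slope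
  \<open>N / (b - a)\<close> of the tents must exceed a second, unrelated bound as well.\<close>

lemma tent_approximation:
  assumes f: "continuous_on {a..b} f" and "0 < e"
  shows "\<exists>K1. \<forall>N. K1 < real N \<longrightarrow> (\<forall>t\<in>{a..b}. \<bar>f t - (\<Sum>i\<le>N. f (a + (b - a) / real N * real i) *
    max 0 (1 - real N / (b - a) * \<bar>t - (a + (b - a) / real N * real i)\<bar>))\<bar> \<le> e)"
proof -
  have "uniformly_continuous_on {a..b} f" by (intro compact_uniformly_continuous f) auto
  then obtain d where d: "0 < d" "\<And>x y. x \<in> {a..b} \<Longrightarrow> y \<in> {a..b} \<Longrightarrow> dist y x < d \<Longrightarrow> dist (f y) (f x) < e"
    unfolding uniformly_continuous_on_def using \<open>0 < e\<close> by metis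
  have "\<bar>f t - (\<Sum>i\<le>N. f (a + (b - a) / real N * real i) *
    max 0 (1 - real N / (b - a) * \<bar>t - (a + (b - a) / real N * real i)\<bar>))\<bar> \<le> e"
    if N: "max 1 ((b - a) / d) < real N" and t: "t \<in> {a..b}" for N t
  proof -
    define s where "s = (\<lambda>i::nat. a + (b - a) / real N * real i)"
    define w where "w = (\<lambda>i::nat. max 0 (1 - real N / (b - a) * \<bar>t - s i\<bar>))"
    have N0: "0 < real N" using N by linarith
    define x where "x = (t - a) * N / (b - a)"
    have x: "0 \<le> x" "x \<le> real N" using t ab N0 by (auto simp: x_def field_simps)
    have w: "w i = max 0 (1 - \<bar>x - real i\<bar>)" for i
    proof -
      have "x - real i = real N / (b - a) * (t - s i)" using ab N0 by (simp add: x_def s_def field_simps)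
      then have "\<bar>x - real i\<bar> = real N / (b - a) * \<bar>t - s i\<bar>" using ab N0 by (simp add: abs_mult)
      then show ?thesis by (simp add: w_def)
    qed
    have sum1: "(\<Sum>i\<le>N. w i) = 1" unfolding w by (rule hat_partition[OF x])
    have le: "\<bar>f t - f (s i)\<bar> * w i \<le> e * w i" if i: "i \<le> N" for i
    proof (cases "w i = 0")
      case False
      have si: "s i \<in> {a..b}"
      proof -
        have "(b - a) / real N * real i \<le> (b - a) / real N * real N" using i ab by (intro mult_left_mono) auto
        then show ?thesis using ab N0 by (auto simp: s_def)
      qed
      from False have "\<not> 1 - real N / (b - a) * \<bar>t - s i\<bar> \<le> 0" by (auto simp: w_def)
      then have "real N / (b - a) * \<bar>t - s i\<bar> < 1" by linarith
      then have "\<bar>t - s i\<bar> < (b - a) / N" using ab N0 by (simp add: field_simps)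
      also have "\<dots> < d" using N d(1) N0 by (simp add: field_simps)
      finally have "dist (f t) (f (s i)) < e" by (intro d(2) si t) (simp add: dist_real_def)
      then show ?thesis by (intro mult_right_mono) (auto simp: dist_real_def w_def)
    qed simp
    have "f t - (\<Sum>i\<le>N. f (s i) * w i) = (\<Sum>i\<le>N. (f t - f (s i)) * w i)"
      using sum1 by (simp add: left_diff_distrib sum_subtractf sum_distrib_left[symmetric])
    also have "\<bar>\<dots>\<bar> \<le> (\<Sum>i\<le>N. \<bar>(f t - f (s i)) * w i\<bar>)" by (rule sum_abs)
    also have "\<dots> \<le> (\<Sum>i\<le>N. e * w i)"
      by (intro sum_mono) (use le in \<open>simp add: abs_mult w_def\<close>)
    also have "\<dots> = e" using sum1 by (simp add: sum_distrib_left[symmetric])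
    finally show ?thesis unfolding s_def w_def .
  qed
  then show ?thesis by (intro exI[of _ "max 1 ((b - a) / d)"]) blast
qed

text \<open>A nonnegative right-hand side is, up to a small error, a nonnegative combination of
  tents, whose solutions are nonnegative. The step length depends only on the resolvent constant at
  \<open>- m\<close> and on the distance to \<open>l\<close>, not on the function or the
  accuracy.\<close>

lemma IP_local_step:
  assumes k: "1 \<le> k" "k < n" and m: "0 \<le> m" "m < l" and IP: "IP k (- m)"
    and IPs: "\<And>\<nu>. 0 \<le> \<nu> \<Longrightarrow> \<nu> < l \<Longrightarrow> IP (Suc k) \<nu>" "\<And>\<nu>. 0 \<le> \<nu> \<Longrightarrow> \<nu> < l \<Longrightarrow> IP (k - 1) \<nu>"
  shows "\<exists>\<delta>>0. \<forall>\<nu>. m < \<nu> \<and> \<nu> < m + \<delta> \<longrightarrow> IP k (- \<nu>)"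
proof -
  obtain C where C: "res_const k (- m) C"
    using res_const_exists[OF less_imp_le[OF k(2)] IP_not_eig[OF IP]] by blast
  have C0: "0 < C" using C by (simp add: res_const_def)
  define \<delta> where "\<delta> = min (1 / (8 * C)) (l - m)"
  have "IP k (- \<nu>)" if \<nu>: "m < \<nu>" "\<nu> < m + \<delta>" for \<nu>
    unfolding IP_def
  proof (intro allI impI ballI)
    fix g t assume g: "X k g" "\<forall>t\<in>{a..b}. - \<nu> * g 0 t \<le> op k g t" and t: "t \<in> {a..b}"
    have \<nu>l: "\<nu> < l" "\<nu> - m < 1 / (8 * C)" using \<nu> by (auto simp: \<delta>_def)
    then have \<nu>C: "(\<nu> - m) * C \<le> 1 / 8" using C0 by (simp add: field_simps)
    then have near: "\<bar>- \<nu> - (- m)\<bar> * C \<le> 1 / 8" using \<nu> by simp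
    note ne = near_not_eig[OF C near]
    define f where "f = (\<lambda>t. op k g t + \<nu> * g 0 t)"
    have f: "continuous_on {a..b} f" unfolding f_def
      by (intro continuous_intros op_cont[OF X_ts[OF g(1)]] X_cont[OF g(1) le0])
    have f0: "0 \<le> f t" if "t \<in> {a..b}" for t
    proof -
      have "- \<nu> * g 0 t \<le> op k g t" using g(2) that by blast
      then show ?thesis by (simp add: f_def)
    qed
    have "- g 0 t \<le> 0"
    proof (rule field_le_epsilon)
      fix e' :: real assume e': "0 < e'"
      define e where "e = e' / (2 * C)"
      have e: "0 < e" "2 * C * e = e'" using e' C0 by (auto simp: e_def)
      obtain K1 where K1: "\<forall>N. K1 < real N \<longrightarrow> (\<forall>t\<in>{a..b}. \<bar>f t - (\<Sum>i\<le>N. f (a + (b - a) / real N * real i) *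
          max 0 (1 - real N / (b - a) * \<bar>t - (a + (b - a) / real N * real i)\<bar>))\<bar> \<le> e)"
        using tent_approximation[OF f e(1)] by blast
      \<comment> \<open>\<open>K1\<close> secures the accuracy; the last bound makes the tents at
        least as steep as \<nu> times any solution for a tent.\<close>
      obtain N :: nat where N: "max (max 1 K1) (\<nu> * (2 * C) * (b - a)) < real N"
        using reals_Archimedean2 by blast
      define K where "K = real N / (b - a)"
      define s where "s = (\<lambda>i::nat. a + (b - a) / real N * real i)"
      have N0: "0 < real N" using N by linarith
      have K: "\<nu> * (2 * C) \<le> K" using N ab by (simp add: K_def field_simps)
      have s: "s i \<in> {a..b}" if "i \<le> N" for i
      proof -
        have "(b - a) / real N * real i \<le> (b - a) / real N * real N" using that ab by (intro mult_left_mono) auto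
        then show ?thesis using ab N0 by (auto simp: s_def)
      qed
      have "\<forall>i. \<exists>u. X k u \<and> (\<forall>t\<in>{a..b}. op k u t = - \<nu> * u 0 t + max 0 (1 - K * \<bar>t - s i\<bar>))"
      proof
        fix i
        have "continuous_on {a..b} (\<lambda>t. max 0 (1 - K * \<bar>t - s i\<bar>))" by (intro continuous_intros)
        from resolvent[OF less_imp_le[OF k(2)] ne this]
        show "\<exists>u. X k u \<and> (\<forall>t\<in>{a..b}. op k u t = - \<nu> * u 0 t + max 0 (1 - K * \<bar>t - s i\<bar>))" by metis
      qed
      from choice[OF this] obtain u where u: "\<forall>i. X k (u i) \<and>
        (\<forall>t\<in>{a..b}. op k (u i) t = - \<nu> * u i 0 t + max 0 (1 - K * \<bar>t - s i\<bar>))" ..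
      have uX: "X k (u i)" for i using u by blast
      have uo: "op k (u i) t = - \<nu> * u i 0 t + max 0 (1 - K * \<bar>t - s i\<bar>)" if "t \<in> {a..b}" for i t
        using u that by blast
      have u0: "0 \<le> u i 0 t" if "i \<le> N" for i
        by (rule tent_solution_nonneg[OF k C m(1) less_imp_le[OF \<nu>(1)] \<nu>C _ _ IP K s[OF that] uX uo t])
          (use IPs m \<nu>l in auto)
      define h where "h = (\<lambda>j t. \<Sum>i\<le>N. f (s i) * u i j t)"
      have hX: "X k h"
        unfolding X_def h_def using uX unfolding X_def by (auto intro!: tower_sum tower_scale)
      have h0: "0 \<le> h 0 t" unfolding h_def using u0 f0 s by (intro sum_nonneg) auto
      have ho: "op k h t + \<nu> * h 0 t = (\<Sum>i\<le>N. f (s i) * max 0 (1 - K * \<bar>t - s i\<bar>))" if "t \<in> {a..b}" for t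
      proof -
        have "op k h t = (\<Sum>i\<le>N. f (s i) * op k (u i) t)"
          unfolding op_def h_def lin_op_sum by (simp add: sum_distrib_left mult_ac)
        then show ?thesis
          by (simp add: uo[OF that] h_def sum_distrib_left sum.distrib[symmetric] algebra_simps)
      qed
      have "\<bar>g 0 t - h 0 t\<bar> \<le> 2 * C * e"
      proof (rule res_const_bound[OF C near X_diff[OF g(1) hX] _ le0 t])
        fix t assume t: "t \<in> {a..b}"
        have "op k (\<lambda>i t. g i t - h i t) t - - \<nu> * (g 0 t - h 0 t) = f t - (op k h t + \<nu> * h 0 t)"
          unfolding op_diff f_def by (simp add: algebra_simps)
        moreover have "\<bar>f t - (op k h t + \<nu> * h 0 t)\<bar> \<le> e"
          unfolding ho[OF t] using K1 N t unfolding s_def K_def by simp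
        ultimately show "\<bar>op k (\<lambda>i t. g i t - h i t) t - - \<nu> * (g 0 t - h 0 t)\<bar> \<le> e" by simp
      qed
      with h0 e(2) show "- g 0 t \<le> 0 + e'" by linarith
    qed
    then show "0 \<le> g 0 t" by simp
  qed
  moreover have "0 < \<delta>" using C0 m by (simp add: \<delta>_def)
  ultimately show ?thesis by blast
qed

lemma IP_negative:
  assumes k: "1 \<le> k" "k < n" and \<nu>: "0 \<le> \<nu>" "\<nu> \<le> l"
    and IPs: "\<And>\<nu>. 0 \<le> \<nu> \<Longrightarrow> \<nu> < l \<Longrightarrow> IP (Suc k) \<nu>" "\<And>\<nu>. 0 \<le> \<nu> \<Longrightarrow> \<nu> < l \<Longrightarrow> IP (k - 1) \<nu>"
  shows "IP k (- \<nu>)"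
proof -
  have l: "0 \<le> l" using \<nu> by simp
  have "\<forall>x. 0 \<le> x \<and> x \<le> l \<longrightarrow> IP k (- x)"
  proof (rule real_interval_induct[OF _ l])
    show "IP k (- 0)" using IP_0 by simp
    show "IP k (- s)" if "0 < s" "s \<le> l" "\<And>x. 0 \<le> x \<Longrightarrow> x < s \<Longrightarrow> IP k (- x)" for s
      by (rule IP_closed_below[OF less_imp_le[OF k(2)] that(1,3)])
    show "\<exists>\<delta>>0. \<forall>x. s < x \<and> x < s + \<delta> \<and> x \<le> l \<longrightarrow> IP k (- x)"
      if "0 \<le> s" "s < l" "\<And>x. 0 \<le> x \<Longrightarrow> x \<le> s \<Longrightarrow> IP k (- x)" for s
      using IP_local_step[OF k that(1,2) that(3)[OF that(1) order_refl] IPs] by blast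
  qed
  with \<nu> show ?thesis by blast
qed

end

section \<open>Failure of inverse positivity beyond the bound\<close>

lemma pos_part_power_deriv:
  fixes c r :: real
  shows "((\<lambda>t. max 0 (c * (t - r)) ^ Suc (Suc m)) has_real_derivative
    real (Suc (Suc m)) * c * max 0 (c * (t - r)) ^ Suc m) (at t within S)"
proof -
  define f where "f = (\<lambda>t. max 0 (c * (t - r)) ^ Suc (Suc m))"
  have "(f has_real_derivative real (Suc (Suc m)) * c * max 0 (c * (t - r)) ^ Suc m) (at t)"
  proof (cases "c * (t - r)" "0 :: real" rule: linorder_cases)
    case less
    have "open {z. c * (z - r) < 0}" by (intro open_Collect_less continuous_intros)
    then have "(f has_real_derivative 0) (at t)"
      by (intro has_field_derivative_transform_within_open[OF DERIV_const[of 0]])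
        (use less in \<open>auto simp: f_def max_def\<close>)
    then show ?thesis using less by (simp add: max_def)
  next
    case equal
    have "\<exists>g. (\<forall>z. f z - f t = g z * (z - t)) \<and> isCont g t \<and> g t = 0"
    proof (intro exI[of _ "\<lambda>z. c * max 0 (c * (z - r)) ^ Suc m"] conjI allI)
      fix z
      have "f t = 0" unfolding f_def equal by simp
      moreover have "c * (z - r) = c * (z - t)" using equal by (auto simp: right_diff_distrib)
      then have "f z = c * max 0 (c * (z - r)) ^ Suc m * (z - t)"
        unfolding f_def by (cases "0 \<le> c * (z - t)") (simp_all add: max_def)
      ultimately show "f z - f t = c * max 0 (c * (z - r)) ^ Suc m * (z - t)" by simp
    next
      show "isCont (\<lambda>z. c * max 0 (c * (z - r)) ^ Suc m) t" by (intro continuous_intros)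
    qed (use equal in auto)
    then have "(f has_real_derivative 0) (at t)" unfolding CARAT_DERIV .
    then show ?thesis using equal by auto
  next
    case greater
    have lin: "((\<lambda>t. c * (t - r)) has_real_derivative c) (at t)"
      by (auto intro!: derivative_eq_intros)
    have d: "((\<lambda>t. (c * (t - r)) ^ Suc (Suc m)) has_real_derivative
        real (Suc (Suc m)) * c * (c * (t - r)) ^ Suc m) (at t)"
      using DERIV_power[OF lin, of "Suc (Suc m)"] by (simp only: diff_Suc_Suc diff_zero mult.assoc)
    have "(f has_real_derivative real (Suc (Suc m)) * c * (c * (t - r)) ^ Suc m) (at t)"
    proof (rule has_field_derivative_transform_within_open[OF d])
      show "open {z. 0 < c * (z - r)}" by (intro open_Collect_less continuous_intros)
      show "t \<in> {z. 0 < c * (z - r)}" using greater by simp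
      fix z assume "z \<in> {z. 0 < c * (z - r)}"
      then have "max 0 (c * (z - r)) = c * (z - r)" by simp
      then show "(c * (z - r)) ^ Suc (Suc m) = f z" by (simp only: f_def)
    qed
    moreover have "max 0 (c * (t - r)) = c * (t - r)" using greater by simp
    ultimately show ?thesis by (simp only:)
  qed
  then show ?thesis unfolding f_def by (rule DERIV_subset[OF _ subset_UNIV])
qed

text \<open>For \<open>i \<le> N\<close> this is the \<open>i\<close>-th derivative of the truncated
  power with exponent \<open>N\<close>, living to the right of \<open>r\<close> for
  \<open>c = 1\<close> and to the left for \<open>c = -1\<close>. It is used with
  \<open>N = Suc n\<close>, so that derivatives up to order \<open>n\<close> are continuous.\<close>

definition trunc_power :: "real \<Rightarrow> real \<Rightarrow> nat \<Rightarrow> nat \<Rightarrow> real \<Rightarrow> real" where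
  "trunc_power c r N i t = c ^ i * (fact N / fact (N - i)) * max 0 (c * (t - r)) ^ (N - i)"

lemma trunc_power_tower: "tower S n (trunc_power c r (Suc n))"
  unfolding tower_def
proof (intro conjI allI impI ballI)
  fix i t assume i: "i < n"
  define m where "m = n - Suc i"
  have m: "Suc n - i = Suc (Suc m)" "Suc n - Suc i = Suc m" using i by (auto simp: m_def)
  have "(fact (Suc n) / fact (Suc m) :: real) = fact (Suc n) / fact (Suc (Suc m)) * real (Suc (Suc m))"
    unfolding fact_Suc[of "Suc m"] of_nat_mult by simp
  then have eq: "trunc_power c r (Suc n) (Suc i) t = c ^ i * (fact (Suc n) / fact (Suc (Suc m))) *
      (real (Suc (Suc m)) * c * max 0 (c * (t - r)) ^ Suc m)"
    unfolding trunc_power_def m by (simp only: power_Suc mult_ac)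
  have "trunc_power c r (Suc n) i = (\<lambda>t. c ^ i * (fact (Suc n) / fact (Suc (Suc m))) * max 0 (c * (t - r)) ^ Suc (Suc m))"
    unfolding trunc_power_def m ..
  then show "(trunc_power c r (Suc n) i has_real_derivative trunc_power c r (Suc n) (Suc i) t) (at t within S)"
    unfolding eq by (simp only:) (rule DERIV_cmult[OF pos_part_power_deriv])
next
  show "continuous_on S (trunc_power c r (Suc n) n)"
    unfolding trunc_power_def by (intro continuous_intros)
qed

text \<open>Finite smoothness is enough, so two truncated powers replace the usual exponential bump;
  since \<open>c < d\<close>, they never vanish together and their sum can be a denominator.\<close>

lemma smooth_cutoff:
  assumes "c < d"
  shows "\<exists>\<psi>. Cm_set S n \<psi> \<and> (\<forall>t\<le>c. \<psi> t = 1) \<and> (\<forall>t\<ge>d. \<psi> t = 0)"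
proof -
  define A where "A = trunc_power (-1) d (Suc n) 0"
  define B where "B = trunc_power 1 c (Suc n) 0"
  have A: "A t = max 0 (d - t) ^ Suc n" for t by (simp add: A_def trunc_power_def)
  have B: "B t = max 0 (t - c) ^ Suc n" for t by (simp add: B_def trunc_power_def)
  have Cm: "Cm_set S n A" "Cm_set S n B"
    unfolding A_def B_def using tower_imp_Cm_set[OF trunc_power_tower, of 0 n] by simp_all
  have "A t + B t \<noteq> 0" for t
  proof (cases "t < d")
    case True
    then have "0 < A t" "0 \<le> B t" by (simp_all only: A B) (auto simp del: power_Suc)
    then show ?thesis by simp
  next
    case False
    then have "0 \<le> A t" "0 < B t" using assms by (simp_all only: A B) (auto simp del: power_Suc)
    then show ?thesis by simp
  qed
  then have "Cm_set S n (\<lambda>t. A t / (A t + B t))" by (intro Cm_set_divide Cm_set_add Cm)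
  moreover have "A t / (A t + B t) = 1" if "t \<le> c" for t
  proof -
    have "B t = 0" unfolding B using that by simp
    then show ?thesis using \<open>\<And>t. A t + B t \<noteq> 0\<close>[of t] by simp
  qed
  moreover have "A t / (A t + B t) = 0" if "d \<le> t" for t
    using that by (simp add: A)
  ultimately show ?thesis by blast
qed

context disconj_op
begin

text \<open>Within distance \<delta> to the right of \<open>r\<close> the \<open>n\<close>-th
  derivative is linear in the distance \<phi> from \<open>r\<close>, and every lower one is smaller
  by at least a factor \<delta>. For small \<delta> the top term therefore absorbs all
  others.\<close>

lemma lin_op_trunc_power_nonneg:
  assumes K: "0 \<le> K" "(\<Sum>i<n. \<bar>p i t\<bar>) + \<bar>\<nu>\<bar> \<le> K" and \<delta>: "0 < \<delta>" "\<delta> \<le> 1" "\<delta> * K \<le> 1" "t - r \<le> \<delta>"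
  shows "0 \<le> L (trunc_power 1 r (Suc n)) t + \<nu> * trunc_power 1 r (Suc n) 0 t"
proof -
  let ?e = "trunc_power 1 r (Suc n)"
  define \<phi> where "\<phi> = max 0 (t - r)"
  have \<phi>: "0 \<le> \<phi>" "\<phi> \<le> \<delta>" "\<phi> \<le> 1" using \<delta> by (auto simp: \<phi>_def)
  have en: "?e n t = fact (Suc n) * \<phi>" by (simp add: trunc_power_def \<phi>_def)
  have ei: "\<bar>?e i t\<bar> \<le> fact (Suc n) * \<phi> * \<delta>" if i: "i < n" for i
  proof -
    define j where "j = n - Suc i"
    have j: "Suc n - i = Suc (Suc j)" using i by (simp add: j_def)
    have eq: "?e i t = fact (Suc n) / fact (Suc (Suc j)) * (\<phi> * \<phi> ^ Suc j)"
      unfolding trunc_power_def j by (simp add: \<phi>_def)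
    have "\<bar>?e i t\<bar> = fact (Suc n) / fact (Suc (Suc j)) * (\<phi> * \<phi> ^ Suc j)"
      unfolding eq using \<phi>(1) by (intro abs_of_nonneg mult_nonneg_nonneg divide_nonneg_nonneg) auto
    also have "\<dots> \<le> fact (Suc n) * (\<phi> * \<delta>)"
    proof (intro mult_mono)
      have "(fact (Suc n) / fact (Suc (Suc j)) :: real) \<le> fact (Suc n) / 1"
        by (rule divide_left_mono[OF fact_ge_1]) (simp_all del: fact_Suc)
      then show "(fact (Suc n) / fact (Suc (Suc j)) :: real) \<le> fact (Suc n)" by (simp only: div_by_1)
      have "\<phi> ^ Suc j \<le> \<phi> * 1" unfolding power_Suc using \<phi> by (intro mult_left_mono power_le_one) auto
      then show "\<phi> ^ Suc j \<le> \<delta>" using \<phi> by simp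
    qed (use \<phi> \<delta> in auto)
    finally show ?thesis by (simp only: mult.assoc)
  qed
  have "\<bar>(\<Sum>i<n. p i t * ?e i t) + \<nu> * ?e 0 t\<bar> \<le> (\<Sum>i<n. \<bar>p i t * ?e i t\<bar>) + \<bar>\<nu> * ?e 0 t\<bar>"
    by (rule order_trans[OF abs_triangle_ineq add_right_mono[OF sum_abs]])
  also have "\<dots> \<le> (\<Sum>i<n. \<bar>p i t\<bar> * (fact (Suc n) * \<phi> * \<delta>)) + \<bar>\<nu>\<bar> * (fact (Suc n) * \<phi> * \<delta>)"
    unfolding abs_mult by (intro add_mono sum_mono mult_left_mono ei) (use n_pos in auto)
  also have "\<dots> = ((\<Sum>i<n. \<bar>p i t\<bar>) + \<bar>\<nu>\<bar>) * (fact (Suc n) * \<phi> * \<delta>)"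
    by (simp only: distrib_right sum_distrib_right)
  also have "\<dots> \<le> K * (fact (Suc n) * \<phi> * \<delta>)"
    by (rule mult_right_mono[OF K(2)]) (use \<phi> \<delta> in auto)
  also have "\<dots> = (\<delta> * K) * (fact (Suc n) * \<phi>)" by (simp only: mult_ac)
  also have "\<dots> \<le> 1 * (fact (Suc n) * \<phi>)" by (rule mult_right_mono[OF \<delta>(3)]) (use \<phi> in auto)
  finally have "- (fact (Suc n) * \<phi>) \<le> (\<Sum>i<n. p i t * ?e i t) + \<nu> * ?e 0 t" by linarith
  then show ?thesis unfolding lin_op_def en by linarith
qed

text \<open>The truncated power concentrated near \<open>b\<close>, corrected by homogeneous solutions so as to lie
  in \<open>X k\<close>, has a nonnegative image; away from \<open>b\<close> it is proportional to \<open>Z (n - k - 1)\<close> in the limit.\<close>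

lemma boundary_solution_sign:
  assumes k: "k < n" and IP: "IP k (- \<nu>)"
    and Z: "\<And>i. ts (Z i)" "\<And>i t. t \<in> {a..b} \<Longrightarrow> op k (Z i) t = - \<nu> * Z i 0 t"
      "\<And>i j. j < k \<Longrightarrow> Z i j a = 0" "\<And>i j. j < n - k \<Longrightarrow> Z i j b = (if j = i then 1 else 0)"
    and t: "a \<le> t" "t < b"
  shows "0 \<le> (-1) ^ (n - Suc k) * Z (n - Suc k) 0 t"
proof -
  define q where "q = n - Suc k"
  have q: "n - k = Suc q" using k by (simp add: q_def)
  define C where "C = (\<lambda>i. fact (Suc n) / fact (Suc n - i) :: real)"
  have C: "0 < C i" for i by (simp add: C_def)
  obtain K0 where K0: "0 \<le> K0" "\<And>t. t \<in> {a..b} \<Longrightarrow> (\<Sum>i<n. \<bar>p i t\<bar>) \<le> K0"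
    using coefficients_bounded[of n a b p] cont by blast
  define K where "K = K0 + \<bar>\<nu>\<bar>"
  have K: "0 \<le> K" using K0 by (simp add: K_def)
  define D where "D = (\<Sum>i<q. C i / C q * \<bar>Z i 0 t\<bar>)"
  have D: "0 \<le> D" unfolding D_def using C by (intro sum_nonneg) (simp add: less_imp_le)
  have key: "- ((-1) ^ q * Z q 0 t) \<le> \<delta> * D" if \<delta>: "0 < \<delta>" "\<delta> \<le> 1" "\<delta> * K \<le> 1" "\<delta> < b - t" for \<delta>
  proof -
    define e where "e = trunc_power 1 (b - \<delta>) (Suc n)"
    define \<sigma> where "\<sigma> = ((-1) ^ (n - k) :: real)"
    have \<sigma>: "\<sigma> * \<sigma> = 1" "\<sigma> = - ((-1) ^ q)" by (simp_all add: \<sigma>_def q flip: power_add mult_2)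
    have e0: "e i s = 0" if "s \<le> b - \<delta>" "i \<le> n" for i s
      using that by (simp add: e_def trunc_power_def Suc_diff_le)
    have eb: "e i b = C i * \<delta> ^ (Suc n - i)" for i
      using \<delta> by (simp add: e_def trunc_power_def C_def)
    \<comment> \<open>The factor \<sigma> turns \<open>op k\<close> into \<open>L\<close> on
      \<open>e\<close>. The homogeneous solutions remove the derivatives at \<open>b\<close> that
      \<open>X k\<close> forbids, without changing the image under the shifted operator.\<close>
    define u where "u = (\<lambda>j s. \<sigma> * e j s - (\<Sum>i<n-k. (\<sigma> * e i b) * Z i j s))"
    have "ts e" unfolding e_def by (rule trunc_power_tower)
    then have uts: "ts u" unfolding u_def by (intro tower_diff tower_scale tower_sum Z) auto
    have "u j b = 0" if "j < n - k" for j
      unfolding u_def by (simp add: Z(4)[OF that] that if_distrib cong: if_cong)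
    moreover have "u j a = 0" if "j < k" for j
      unfolding u_def using e0[of a j] that \<delta> t k by (simp add: Z(3))
    ultimately have uX: "X k u" using uts by (simp add: X_def)
    have opu: "op k u s = L e s - (\<Sum>i<n-k. (\<sigma> * e i b) * op k (Z i) s)" for s
    proof -
      have "op k (\<lambda>j s. \<Sum>i<n-k. (\<sigma> * e i b) * Z i j s) s = (\<Sum>i<n-k. (\<sigma> * e i b) * op k (Z i) s)"
        unfolding op_def lin_op_sum by (simp add: sum_distrib_left mult_ac)
      moreover have "op k (\<lambda>j s. \<sigma> * e j s) s = L e s"
        unfolding op_scale op_def \<sigma>_def[symmetric] mult.assoc[symmetric] \<sigma>(1) by simp
      ultimately show ?thesis unfolding u_def op_diff by simp
    qed
    have uo: "op k u s + \<nu> * u 0 s = L e s + (\<nu> * \<sigma>) * e 0 s" if s: "s \<in> {a..b}" for s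
    proof -
      define S where "S = (\<Sum>i<n-k. (\<sigma> * e i b) * Z i 0 s)"
      have 1: "(\<Sum>i<n-k. (\<sigma> * e i b) * op k (Z i) s) = - \<nu> * S"
        unfolding S_def sum_distrib_left by (rule sum.cong) (simp_all add: Z(2)[OF s])
      have 2: "u 0 s = \<sigma> * e 0 s - S" by (simp add: u_def S_def)
      show ?thesis unfolding opu 1 2 by (simp add: right_diff_distrib)
    qed
    have "0 \<le> u 0 t"
    proof (rule IP_D[OF IP uX])
      fix s assume s: "s \<in> {a..b}"
      have "0 \<le> L e s + (\<nu> * \<sigma>) * e 0 s"
        unfolding e_def
      proof (rule lin_op_trunc_power_nonneg[OF K _ \<delta>(1-3)])
        show "(\<Sum>i<n. \<bar>p i s\<bar>) + \<bar>\<nu> * \<sigma>\<bar> \<le> K" using K0(2)[OF s] by (simp add: K_def abs_mult \<sigma>_def)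
        show "s - (b - \<delta>) \<le> \<delta>" using s by simp
      qed
      then show "- \<nu> * u 0 s \<le> op k u s" using uo[OF s] by simp
    qed (use t in simp)
    also have "u 0 t = - (\<sigma> * (\<Sum>i<n-k. e i b * Z i 0 t))"
      unfolding u_def using e0[of t 0] \<delta>(4) by (simp add: sum_distrib_left mult.assoc)
    also have "\<dots> = (-1) ^ q * (\<Sum>i<Suc q. e i b * Z i 0 t)"
      unfolding \<sigma>(2) q by simp
    also have "(\<Sum>i<Suc q. e i b * Z i 0 t) = (\<Sum>i<q. e i b * Z i 0 t) + e q b * Z q 0 t" by simp
    finally have 1: "- (e q b * ((-1) ^ q * Z q 0 t)) \<le> (-1) ^ q * (\<Sum>i<q. e i b * Z i 0 t)"
      by (simp add: algebra_simps)
    also have "\<dots> \<le> \<bar>(-1) ^ q * (\<Sum>i<q. e i b * Z i 0 t)\<bar>" by (rule abs_ge_self)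
    also have "\<dots> = \<bar>\<Sum>i<q. e i b * Z i 0 t\<bar>" by (simp add: abs_mult)
    also have "\<dots> \<le> (\<Sum>i<q. \<bar>e i b * Z i 0 t\<bar>)" by (rule sum_abs)
    \<comment> \<open>The \<open>i\<close>-th derivative of \<open>e\<close> at \<open>b\<close> has
      size \<open>C i * \<delta> ^ (Suc n - i)\<close>. So \<open>q\<close>, the largest index
      present, dominates, and every other term is smaller by at least one power of \<delta>.\<close>
    also have "\<dots> \<le> (\<Sum>i<q. (e q b * \<delta>) * (C i / C q * \<bar>Z i 0 t\<bar>))"
    proof (rule sum_mono)
      fix i assume "i \<in> {..<q}"
      then obtain j where j: "q - i = Suc j" by (metis Suc_diff_Suc lessThan_iff)
      have "Suc n - i = (Suc n - q) + Suc j" using j \<open>i \<in> {..<q}\<close> q by auto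
      then have "e i b = C i * (\<delta> ^ (Suc n - q) * (\<delta> * \<delta> ^ j))" by (simp add: eb power_add)
      also have "\<dots> \<le> C i * (\<delta> ^ (Suc n - q) * (\<delta> * 1))"
        using C[of i] \<delta> by (intro mult_left_mono power_le_one) auto
      also have "\<dots> = (e q b * \<delta>) * (C i / C q)" using C[of q] by (simp add: eb)
      finally have le: "e i b \<le> (e q b * \<delta>) * (C i / C q)" .
      have "0 \<le> e i b" using C[of i] \<delta> by (simp add: eb)
      then have "\<bar>e i b * Z i 0 t\<bar> = e i b * \<bar>Z i 0 t\<bar>" by (simp add: abs_mult)
      also have "\<dots> \<le> ((e q b * \<delta>) * (C i / C q)) * \<bar>Z i 0 t\<bar>" by (rule mult_right_mono[OF le]) simp
      finally show "\<bar>e i b * Z i 0 t\<bar> \<le> (e q b * \<delta>) * (C i / C q * \<bar>Z i 0 t\<bar>)" by (simp only: mult.assoc)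
    qed
    also have "\<dots> = e q b * (\<delta> * D)" by (simp add: D_def sum_distrib_left mult.assoc)
    finally have "e q b * (- ((-1) ^ q * Z q 0 t)) \<le> e q b * (\<delta> * D)" by simp
    moreover have "0 < e q b" using C \<delta> by (simp add: eb)
    ultimately show ?thesis by (simp only: mult_le_cancel_left_pos)
  qed
  define r where "r = min (1 / (1 + K)) ((b - t) / 2)"
  have "r \<le> (b - t) / 2" unfolding r_def by (rule min.cobounded2)
  moreover have "1 / (1 + K) \<le> 1" using K by simp
  moreover have r: "0 < r" "r \<le> 1 / (1 + K)" using K t by (simp_all add: r_def)
  ultimately have r': "r \<le> 1" "r < b - t" using t by auto
  have "- ((-1) ^ q * Z q 0 t) \<le> 0"
  proof (rule nonpos_if_le_small_multiples[OF r(1) D])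
    fix \<delta> assume \<delta>: "0 < \<delta>" "\<delta> \<le> r"
    have "\<delta> * K \<le> 1 / (1 + K) * (1 + K)" using \<delta> r K by (intro mult_mono) auto
    then have "\<delta> * K \<le> 1" using K by simp
    then show "- ((-1) ^ q * Z q 0 t) \<le> \<delta> * D" using \<delta> r' by (intro key) auto
  qed
  then show ?thesis by (simp add: q_def)
qed

text \<open>Near \<open>a\<close> this is a solution of the shifted equation whose first nonzero
  derivative has order \<open>k\<close>, near \<open>b\<close> it is zero. The shifted image is
  therefore supported in the interior, where any positive function can dominate it.\<close>

lemma cutoff_solution_exists:
  assumes k: "k < n" and c: "a < c" "c < d" "d < b"
  shows "\<exists>Q. X k Q \<and> Q k a = 1 \<and> (\<forall>t\<in>{a..c}. op k Q t = \<mu> * Q 0 t) \<and> (\<forall>t\<in>{d..b}. op k Q t = \<mu> * Q 0 t)"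
proof -
  let ?p = "p(0 := \<lambda>t. p 0 t - (-1) ^ (n - k) * \<mu>)"
  have a: "a \<in> {a..b}" using ab by simp
  have "\<exists>g. ts g \<and> (\<forall>i<n. g i a = (if i = k then 1 else 0)) \<and> (\<forall>t\<in>{a..b}. lin_op n ?p g t = 0)"
    by (rule ivp[OF less_imp_le[OF ab] shifted_cont continuous_on_const a])
  then obtain y where y: "ts y" "\<And>i. i < n \<Longrightarrow> y i a = (if i = k then 1 else 0)"
    "\<And>t. t \<in> {a..b} \<Longrightarrow> lin_op n ?p y t = 0" by blast
  have yo: "op k y t = \<mu> * y 0 t" if "t \<in> {a..b}" for t
    using shifted_op[of k \<mu> y t] y(3)[OF that] by simp
  obtain \<psi> where \<psi>: "Cm_set {a..b} n \<psi>" "\<forall>t\<le>c. \<psi> t = 1" "\<forall>t\<ge>d. \<psi> t = 0"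
    using smooth_cutoff[OF c(2)] by blast
  have "Cm_set {a..b} n (\<lambda>t. \<psi> t * y 0 t)"
    using tower_imp_Cm_set[OF y(1) le0] by (intro Cm_set_mult \<psi>(1)) simp
  then obtain Q where Q: "ts Q" "Q 0 = (\<lambda>t. \<psi> t * y 0 t)" using Cm_set_imp_tower by blast
  have Ql: "Q i t = y i t" if "i \<le> n" "t \<in> {a..c}" for i t
    by (rule tower_eq_on[OF Q(1) y(1) _ c(1) _ that]) (use c \<psi>(2) in \<open>auto simp: Q(2)\<close>)
  have Qr: "Q i t = 0" if "i \<le> n" "t \<in> {d..b}" for i t
    by (rule tower_eq_on[OF Q(1) tower_zero _ c(3) _ that]) (use c \<psi>(3) in \<open>auto simp: Q(2)\<close>)
  have "X k Q" unfolding X_def using Q(1) Ql Qr y(2) c k by auto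
  moreover have "Q k a = 1" using Ql[of k a] y(2)[OF k] c k by simp
  moreover have "op k Q t = \<mu> * Q 0 t" if "t \<in> {a..c}" for t
  proof -
    have "op k Q t = op k y t" using Ql that by (simp add: op_def lin_op_def)
    then show ?thesis using yo[of t] Ql[of 0 t] that c by simp
  qed
  moreover have "op k Q t = \<mu> * Q 0 t" if "t \<in> {d..b}" for t
    using Qr that by (simp add: op_def lin_op_def)
  ultimately show ?thesis by blast
qed

text \<open>The image of \<open>Q\<close> is controlled by a function that may vanish at the ends,
  although \<open>Q\<close> has leading coefficient 1 at \<open>a\<close>. Subtracting
  \<open>Q\<close> from a function whose leading coefficient at \<open>a\<close> vanishes destroys
  nonnegativity there.\<close>

lemma dominated_cutoff:
  assumes k: "k < n" and x: "continuous_on {a..b} x" "\<And>t. t \<in> {a..b} \<Longrightarrow> 0 \<le> x t" "\<And>t. a < t \<Longrightarrow> t < b \<Longrightarrow> 0 < x t"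
  shows "\<exists>Q D. X k Q \<and> Q k a = 1 \<and> (\<forall>t\<in>{a..b}. op k Q t - \<mu> * Q 0 t \<le> D * x t) \<and> 0 \<le> D"
proof -
  define c where "c = (2 * a + b) / 3"
  define d where "d = (a + 2 * b) / 3"
  have cd: "a < c" "c < d" "d < b" using ab by (auto simp: c_def d_def)
  obtain Q where Q: "X k Q" "Q k a = 1" "\<forall>t\<in>{a..c}. op k Q t = \<mu> * Q 0 t" "\<forall>t\<in>{d..b}. op k Q t = \<mu> * Q 0 t"
    using cutoff_solution_exists[OF k cd] by blast
  define f where "f = (\<lambda>t. op k Q t - \<mu> * Q 0 t)"
  have "continuous_on {a..b} f" unfolding f_def
    by (intro continuous_intros op_cont[OF X_ts[OF Q(1)]] X_cont[OF Q(1) le0])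
  from sup_attained[OF this less_imp_le[OF ab]]
  obtain r where r: "\<forall>t\<in>{a..b}. \<bar>f t\<bar> \<le> \<bar>f r\<bar>" by blast
  have "continuous_on {c..d} x" by (rule continuous_on_subset[OF x(1)]) (use cd in auto)
  then obtain s where s: "s \<in> {c..d}" "\<forall>t\<in>{c..d}. x s \<le> x t"
    using continuous_attains_inf[of "{c..d}" x] cd by auto
  have xs: "0 < x s" using s(1) cd by (intro x(3)) auto
  define D where "D = \<bar>f r\<bar> / x s"
  have D: "0 \<le> D" using xs by (simp add: D_def)
  have "f t \<le> D * x t" if t: "t \<in> {a..b}" for t
  proof (cases "t \<in> {c..d}")
    case True
    have "\<bar>f t\<bar> \<le> \<bar>f r\<bar>" using r t by blast
    then have "f t \<le> D * x s" using xs by (simp add: D_def)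
    also have "\<dots> \<le> D * x t" by (rule mult_left_mono[OF _ D]) (use s True in blast)
    finally show ?thesis .
  next
    case False
    then have "f t = 0" using Q(3,4) t by (auto simp: f_def)
    then show ?thesis using D x(2)[OF t] by simp
  qed
  with Q(1,2) D show ?thesis unfolding f_def by blast
qed

text \<open>The positive \<open>x\<close> in \<open>X (Suc k)\<close> satisfies
  \<open>op k x \<ge> - l * x\<close>, so it is a supersolution for \<open>- \<nu>\<close> with a
  gap, but it lacks one condition of \<open>X k\<close> at \<open>b\<close>. A nonnegative
  homogeneous solution \<open>z\<close> repairs this, and \<open>y = x - z\<close> in
  \<open>X k\<close> has nonnegative values and, because \<open>x k a = 0\<close>, a vanishing
  leading coefficient at \<open>a\<close>. The gap leaves room to subtract a cutoff from a multiple
  of \<open>y\<close> in the image, but there is no room in the values near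
  \<open>a\<close>.\<close>

lemma not_IP_beyond:
  assumes k: "Suc k < n" and l: "0 < l" "eig (Suc k) l" and \<nu>: "l < \<nu>"
  shows "\<not> IP k (- \<nu>)"
proof
  assume IP: "IP k (- \<nu>)"
  have k': "k < n" using k by simp
  define q where "q = n - Suc k"
  have q: "n - k = Suc q" "0 < q" using k by (auto simp: q_def)
  obtain w r where w: "X (Suc k) w" "r \<in> {a..b}" "w 0 r \<noteq> 0" "\<And>t. t \<in> {a..b} \<Longrightarrow> op (Suc k) w t = l * w 0 t"
    using l(2) unfolding eig_def by blast
  have "w 0 a = 0" "w 0 b = 0" using w(1) k by (auto simp: X_def)
  then have r: "a < r" "r < b" using w(2,3) by (metis atLeastAtMost_iff order_le_less)+
  \<comment> \<open>The eigenfunction \<open>w\<close> may change sign; the solution with image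
    \<open>l * |w|\<close> dominates it and is positive inside.\<close>
  have "continuous_on {a..b} (\<lambda>t. l * \<bar>w 0 t\<bar>)" by (intro continuous_intros X_cont[OF w(1) le0])
  then obtain x where x: "X (Suc k) x" "\<forall>t\<in>{a..b}. op (Suc k) x t = 0 * x 0 t + l * \<bar>w 0 t\<bar>"
    by (rule resolvent[OF less_imp_le[OF k] not_eig_0])
  have xo: "op (Suc k) x t = l * \<bar>w 0 t\<bar>" if "t \<in> {a..b}" for t using x(2) that by simp
  have xw: "\<bar>w 0 t\<bar> \<le> x 0 t" if t: "t \<in> {a..b}" for t
  proof -
    have "0 \<le> x 0 t + w 0 t"
      by (rule IP_D[OF IP_0 X_add[OF x(1) w(1)] _ t]) (use l xo w(4) in \<open>auto simp: op_add distrib_left[symmetric]\<close>)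
    moreover have "0 \<le> x 0 t - w 0 t"
      by (rule IP_D[OF IP_0 X_diff[OF x(1) w(1)] _ t]) (use l xo w(4) in \<open>auto simp: op_diff right_diff_distrib[symmetric]\<close>)
    ultimately show ?thesis by linarith
  qed
  have x0: "0 \<le> x 0 t" if "t \<in> {a..b}" for t using xw[OF that] by linarith
  have xpos: "0 < x 0 t" if "a < t" "t < b" for t
    by (rule solution_pos[OF x(1) _ k _ r _ that]) (use xo l w r in auto)
  have xk: "- \<nu> * x 0 t + (\<nu> - l) * x 0 t \<le> op k x t" if t: "t \<in> {a..b}" for t
  proof -
    have "op k x t = - (l * \<bar>w 0 t\<bar>)" using op_Suc[OF k', of x t] xo[OF t] by simp
    moreover have "l * \<bar>w 0 t\<bar> \<le> l * x 0 t" using l xw[OF t] by (intro mult_left_mono) auto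
    ultimately show ?thesis by (simp add: algebra_simps)
  qed
  have "\<forall>j. \<exists>z. ts z \<and> (\<forall>t\<in>{a..b}. op k z t = - \<nu> * z 0 t) \<and> (\<forall>i<k. z i a = 0) \<and>
    (\<forall>i<n-k. z i b = (if i = j then 1 else 0))"
    by (intro allI boundary_solvable[OF less_imp_le[OF k'] IP_not_eig[OF IP]])
  from choice[OF this] obtain Z where Z: "\<And>i. ts (Z i)" "\<And>i t. t \<in> {a..b} \<Longrightarrow> op k (Z i) t = - \<nu> * Z i 0 t"
      "\<And>i j. j < k \<Longrightarrow> Z i j a = 0" "\<And>i j. j < n - k \<Longrightarrow> Z i j b = (if j = i then 1 else 0)"
    by blast
  define \<beta> where "\<beta> = x q b"
  have \<beta>: "0 \<le> (-1) ^ q * \<beta>" unfolding \<beta>_def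
    by (rule leading_right_nonneg[OF X_ts[OF x(1)] _ _ ab x0]) (use x(1) in \<open>auto simp: X_def q_def\<close>)
  define z where "z = (\<lambda>i t. \<beta> * Z q i t)"
  have zts: "ts z" unfolding z_def by (rule tower_scale[OF Z(1)])
  have zo: "op k z t = - \<nu> * z 0 t" if "t \<in> {a..b}" for t
    using Z(2)[OF that] by (simp add: z_def op_scale)
  have zb: "z j b = (if j = q then \<beta> else 0)" if "j < n - k" for j using Z(4)[OF that] by (simp add: z_def)
  have z0: "0 \<le> z 0 t" if t: "t \<in> {a..b}" for t
  proof (cases "t = b")
    case True
    then show ?thesis using zb[of 0] q by simp
  next
    case False
    then have "0 \<le> (-1) ^ q * Z q 0 t"
      unfolding q_def using t by (intro boundary_solution_sign[OF k' IP Z]) auto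
    then have "0 \<le> ((-1) ^ q * \<beta>) * ((-1) ^ q * Z q 0 t)" using \<beta> by (rule mult_nonneg_nonneg[rotated])
    also have "\<dots> = ((-1) ^ q * (-1) ^ q) * (\<beta> * Z q 0 t)" by (simp only: mult_ac)
    also have "\<dots> = z 0 t" by (simp add: z_def flip: power_add mult_2)
    finally show ?thesis .
  qed
  define y where "y = (\<lambda>i t. x i t - z i t)"
  have yX: "X k y"
  proof -
    have "ts y" unfolding y_def by (rule tower_diff[OF X_ts[OF x(1)] zts])
    moreover have "y i a = 0" if "i < k" for i
      using x(1) that Z(3)[OF that] by (simp add: y_def z_def X_def)
    moreover have "y i b = 0" if "i < n - k" for i
    proof (cases "i = q")
      case True
      then show ?thesis using zb[OF that] by (simp add: y_def \<beta>_def)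
    next
      case False
      then have "i < n - Suc k" using that q by (simp add: q_def[symmetric])
      then show ?thesis using zb[OF that] False x(1) by (simp add: y_def X_def)
    qed
    ultimately show ?thesis by (simp add: X_def)
  qed
  have yo: "- \<nu> * y 0 t + (\<nu> - l) * x 0 t \<le> op k y t" if "t \<in> {a..b}" for t
    using xk[OF that] zo[OF that] by (simp add: y_def op_diff algebra_simps)
  have y0: "0 \<le> y 0 t" if "t \<in> {a..b}" for t
  proof (rule IP_D[OF IP yX _ that])
    fix s assume s: "s \<in> {a..b}"
    have "0 \<le> (\<nu> - l) * x 0 s" using \<nu> x0[OF s] by simp
    with yo[OF s] show "- \<nu> * y 0 s \<le> op k y s" by linarith
  qed
  \<comment> \<open>\<open>y\<close> and \<open>z\<close> are both nonnegative with \<open>k\<close>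
    zeros at \<open>a\<close>, so their leading coefficients there are nonnegative; these add up to
    \<open>x k a = 0\<close>.\<close>
  have yk: "y k a = 0"
  proof -
    have "0 \<le> y k a" by (rule leading_left_nonneg[OF X_ts[OF yX] _ _ ab y0]) (use yX k' in \<open>auto simp: X_def\<close>)
    moreover have "0 \<le> z k a"
      by (rule leading_left_nonneg[OF zts _ _ ab z0]) (use k' Z(3) in \<open>auto simp: z_def\<close>)
    moreover have "x k a = 0" using x(1) by (simp add: X_def)
    ultimately show ?thesis by (simp add: y_def)
  qed
  obtain Q D where Q: "X k Q" "Q k a = 1" "\<forall>t\<in>{a..b}. op k Q t - (- \<nu>) * Q 0 t \<le> D * x 0 t" "0 \<le> D"
    using dominated_cutoff[OF k' X_cont[OF x(1) le0] x0 xpos, of "- \<nu>"] by blast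
  \<comment> \<open>Dividing by the gap \<open>\<nu> - l\<close> makes the shifted image of
    \<open>E * y\<close> at least \<open>D * x\<close>, enough to cover that of
    \<open>Q\<close>.\<close>
  define E where "E = D / (\<nu> - l)"
  have E: "E * (\<nu> - l) = D" "0 \<le> E" using \<nu> Q(4) by (auto simp: E_def)
  define g where "g = (\<lambda>i t. E * y i t - Q i t)"
  have gX: "X k g" unfolding g_def by (intro X_diff X_scale yX Q(1))
  have "0 \<le> g 0 t" if "t \<in> {a..b}" for t
  proof (rule IP_D[OF IP gX _ that])
    fix s assume s: "s \<in> {a..b}"
    have "E * (- \<nu> * y 0 s + (\<nu> - l) * x 0 s) \<le> E * op k y s" by (rule mult_left_mono[OF yo[OF s] E(2)])
    then have "- \<nu> * (E * y 0 s) + D * x 0 s \<le> E * op k y s" unfolding E(1)[symmetric] by (simp add: algebra_simps)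
    moreover have "op k Q s - (- \<nu>) * Q 0 s \<le> D * x 0 s" using Q(3) s by blast
    ultimately show "- \<nu> * g 0 s \<le> op k g s" unfolding g_def op_diff op_scale by (simp add: algebra_simps)
  qed
  then have "0 \<le> g k a" by (intro leading_left_nonneg[OF X_ts[OF gX] _ _ ab]) (use gX k' in \<open>auto simp: X_def\<close>)
  then show False by (simp add: g_def yk Q(2))
qed

end

section \<open>Reflection and the characterization\<close>

text \<open>Under the substitution of \<open>a + b - t\<close> for \<open>t\<close> the derivative
  of order \<open>i\<close> acquires the sign \<open>(-1) ^ i\<close>; the sign chosen here keeps
  the operator monic after \<open>(-1) ^ n\<close> is factored out.\<close>

definition reflect_coeffs :: "real \<Rightarrow> real \<Rightarrow> nat \<Rightarrow> (nat \<Rightarrow> real \<Rightarrow> real) \<Rightarrow> nat \<Rightarrow> real \<Rightarrow> real" where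
  "reflect_coeffs a b n p i t = (-1) ^ (n - i) * p i (a + b - t)"

definition reflect :: "real \<Rightarrow> real \<Rightarrow> (nat \<Rightarrow> real \<Rightarrow> real) \<Rightarrow> nat \<Rightarrow> real \<Rightarrow> real" where
  "reflect a b g i t = (-1) ^ i * g i (a + b - t)"

lemma reflect_reflect: "reflect a b (reflect a b g) = g"
  by (simp add: reflect_def fun_eq_iff flip: power_add mult_2 mult.assoc)

lemma reflect_tower:
  fixes a b :: real
  assumes "tower {a..b} n g"
  shows "tower {a..b} n (reflect a b g)"
  unfolding tower_def
proof (intro conjI allI impI ballI)
  fix i t assume i: "i < n" and t: "t \<in> {a..b}"
  have im: "(\<lambda>t. a + b - t) ` {a..b} \<subseteq> {a..b}" by auto
  have "(g i has_real_derivative g (Suc i) (a + b - t)) (at (a + b - t) within {a..b})"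
    by (rule tower_deriv[OF assms i]) (use t in auto)
  then have "(g i has_real_derivative g (Suc i) (a + b - t)) (at (a + b - t) within (\<lambda>t. a + b - t) ` {a..b})"
    using im by (rule DERIV_subset)
  moreover have "((\<lambda>t. a + b - t) has_real_derivative -1) (at t within {a..b})"
    by (auto intro!: derivative_eq_intros)
  ultimately have "((\<lambda>t. g i (a + b - t)) has_real_derivative g (Suc i) (a + b - t) * -1) (at t within {a..b})"
    by (rule DERIV_image_chain[unfolded o_def])
  from DERIV_cmult[OF this, of "(-1) ^ i"]
  show "(reflect a b g i has_real_derivative reflect a b g (Suc i) t) (at t within {a..b})"
    by (simp add: reflect_def[abs_def])
next
  have "continuous_on {a..b} (\<lambda>t. g n (a + b - t))"
    by (rule continuous_on_compose2[OF tower_continuous[OF assms order_refl]])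
      (auto intro!: continuous_intros)
  then show "continuous_on {a..b} (reflect a b g n)"
    unfolding reflect_def by (intro continuous_intros)
qed

lemma reflect_lin_op:
  "lin_op n (reflect_coeffs a b n p) (reflect a b g) t = (-1) ^ n * lin_op n p g (a + b - t)"
proof -
  have "reflect_coeffs a b n p i t * reflect a b g i t = (-1) ^ n * (p i (a + b - t) * g i (a + b - t))" if "i < n" for i
  proof -
    have "(-1 :: real) ^ (n - i) * (-1) ^ i = (-1) ^ n" using that by (simp flip: power_add)
    then show ?thesis unfolding reflect_coeffs_def reflect_def by (metis mult.assoc mult.left_commute)
  qed
  then have "(\<Sum>i<n. reflect_coeffs a b n p i t * reflect a b g i t)
      = (-1) ^ n * (\<Sum>i<n. p i (a + b - t) * g i (a + b - t))"
    unfolding sum_distrib_left by (intro sum.cong) auto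
  then show ?thesis by (simp add: lin_op_def reflect_def distrib_left)
qed

context disconj_op
begin

lemma reflected: "disconj_op a b n (reflect_coeffs a b n p)"
proof
  fix i assume "i < n"
  have "continuous_on {a..b} (\<lambda>t. p i (a + b - t))"
    by (rule continuous_on_compose2[OF cont[OF \<open>i < n\<close>]]) (auto intro!: continuous_intros)
  then show "continuous_on {a..b} (reflect_coeffs a b n p i)"
    unfolding reflect_coeffs_def by (intro continuous_intros)
next
  fix g s t q
  assume g: "ts g" "\<forall>r\<in>{a..b}. lin_op n (reflect_coeffs a b n p) g r = 0" and st: "a \<le> s" "s < t" "t \<le> b"
    and q: "q \<le> n" "\<forall>i<q. g i s = 0" "\<forall>i<n-q. g i t = 0"
  define h where "h = reflect a b g"
  have h: "g = reflect a b h" unfolding h_def reflect_reflect ..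
  have "L h r = 0" if r: "r \<in> {a..b}" for r
  proof -
    have "(-1) ^ n * L h (a + b - (a + b - r)) = 0"
      using g(2) r unfolding h reflect_lin_op[of n a b p h "a + b - r", symmetric] by auto
    then show ?thesis by simp
  qed
  then have "\<forall>r\<in>{a..b}. h 0 r = 0"
    by (intro disc[of h "a + b - t" "a + b - s" "n - q"])
      (use reflect_tower[OF g(1)] st q in \<open>auto simp: h_def reflect_def\<close>)
  then show "\<forall>r\<in>{a..b}. g 0 r = 0" unfolding h by (auto simp: reflect_def)
qed (use ab n_pos in auto)

interpretation R: disconj_op a b n "reflect_coeffs a b n p"
  by (rule reflected)

lemma reflect_X: "m \<le> n \<Longrightarrow> X m g \<Longrightarrow> R.X (n - m) (reflect a b g)"
  unfolding X_def R.X_def by (auto simp: reflect_def intro: reflect_tower)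

lemma reflect_X': "m \<le> n \<Longrightarrow> R.X (n - m) (reflect a b g) \<Longrightarrow> X m g"
  using reflect_tower[of a b n "reflect a b g"] unfolding X_def R.X_def reflect_reflect by (auto simp: reflect_def)

text \<open>The sign \<open>(-1) ^ n\<close> of the reflected operator and the normalizing sign
  \<open>(-1) ^ m\<close> of the reflected space combine to the sign in \<open>op m\<close>, so
  eigenvalues and inverse positivity transfer with the same parameter.\<close>

lemma reflect_op:
  assumes "m \<le> n"
  shows "R.op (n - m) (reflect a b g) t = op m g (a + b - t)"
proof -
  have "(-1 :: real) ^ m * (-1) ^ n = (-1) ^ (n - m)"
  proof -
    have "m + n = (n - m) + 2 * m" using assms by simp
    then have "(-1 :: real) ^ (m + n) = (-1) ^ (n - m)" by (simp only: power_add power_mult) simp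
    then show ?thesis by (simp only: power_add)
  qed
  then show ?thesis using assms by (simp add: op_def R.op_def reflect_lin_op mult.assoc[symmetric])
qed

lemma reflect_eig:
  assumes m: "m \<le> n" and "eig m \<mu>"
  shows "R.eig (n - m) \<mu>"
proof -
  obtain g r where g: "X m g" "r \<in> {a..b}" "g 0 r \<noteq> 0" "\<forall>t\<in>{a..b}. op m g t = \<mu> * g 0 t"
    using assms(2) unfolding eig_def by blast
  have "R.op (n - m) (reflect a b g) t = \<mu> * reflect a b g 0 t" if "t \<in> {a..b}" for t
    using g(4) that unfolding reflect_op[OF m] by (auto simp: reflect_def)
  moreover have "reflect a b g 0 (a + b - r) \<noteq> 0" "a + b - r \<in> {a..b}" using g by (auto simp: reflect_def)
  ultimately show ?thesis using reflect_X[OF m g(1)] unfolding R.eig_def by blast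
qed

lemma reflect_IP:
  assumes m: "m \<le> n" and IP: "IP m \<mu>"
  shows "R.IP (n - m) \<mu>"
  unfolding R.IP_def
proof (intro allI impI ballI)
  fix h t assume h: "R.X (n - m) h" "\<forall>t\<in>{a..b}. \<mu> * h 0 t \<le> R.op (n - m) h t" and t: "t \<in> {a..b}"
  define g where "g = reflect a b h"
  have hg: "h = reflect a b g" unfolding g_def reflect_reflect ..
  have "X m g" by (rule reflect_X'[OF m]) (use h(1) hg in simp)
  moreover have "\<mu> * g 0 s \<le> op m g s" if s: "s \<in> {a..b}" for s
  proof -
    have "a + b - s \<in> {a..b}" using s by auto
    then have "\<mu> * h 0 (a + b - s) \<le> R.op (n - m) h (a + b - s)" using h(2) by blast
    then show ?thesis unfolding hg reflect_op[OF m] by (simp add: reflect_def)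
  qed
  ultimately have "0 \<le> g 0 (a + b - t)" by (rule IP_D[OF IP]) (use t in auto)
  then show "0 \<le> h 0 t" unfolding hg by (simp add: reflect_def)
qed

text \<open>Reflection carries \<open>X (k - 1)\<close> to the upper neighbour of the reflected
  space with index \<open>n - k\<close>; the bound \<open>2 \<le> k\<close> is the reflected form of
  \<open>Suc k < n\<close>.\<close>

lemma not_IP_beyond':
  assumes k: "2 \<le> k" "k < n" and l: "0 < l" "eig (k - 1) l" and \<nu>: "l < \<nu>"
  shows "\<not> IP k (- \<nu>)"
proof
  assume IP: "IP k (- \<nu>)"
  have eq: "n - (k - 1) = Suc (n - k)" using k by simp
  have "R.eig (n - (k - 1)) l" by (rule reflect_eig[OF _ l(2)]) (use k in simp)
  then have "R.eig (Suc (n - k)) l" unfolding eq .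
  then have "\<not> R.IP (n - k) (- \<nu>)" by (intro R.not_IP_beyond[OF _ l(1) _ \<nu>]) (use k in auto)
  with reflect_IP[OF less_imp_le[OF k(2)] IP] show False by simp
qed

text \<open>All \<open>n\<close> conditions sit at \<open>b\<close>, so this is an initial value
  problem, and uniqueness leaves only the zero function.\<close>

lemma not_eig_first: "\<not> eig 0 \<mu>"
proof
  assume "eig 0 \<mu>"
  then obtain g r where g: "X 0 g" "r \<in> {a..b}" "g 0 r \<noteq> 0" "\<forall>t\<in>{a..b}. op 0 g t = \<mu> * g 0 t"
    unfolding eig_def by blast
  have "g 0 r = 0"
  proof (rule lin_op_unique_zero[where p = "p(0 := \<lambda>t. p 0 t - (-1) ^ (n - 0) * \<mu>)" and n = n and a = a and b = b
        and g = g and i = 0 and t = r and ?t0.0 = b])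
    show "lin_op n (p(0 := \<lambda>t. p 0 t - (-1) ^ (n - 0) * \<mu>)) g t = 0" if "t \<in> {a..b}" for t
      using shifted_op[of 0 \<mu> g t] g(4) that by simp
    show "continuous_on {a..b} ((p(0 := \<lambda>t. p 0 t - (-1) ^ (n - 0) * \<mu>)) i)" if "i < n" for i
      by (rule shifted_cont[OF that])
  qed (use g ab in \<open>auto simp: X_def\<close>)
  with g(3) show False by simp
qed

text \<open>With no eigenvalue to meet, inverse positivity persists indefinitely; so for
  \<open>k = 1\<close> only the upper neighbour limits the parameter range.\<close>

lemma IP_first: "0 \<le> \<nu> \<Longrightarrow> IP 0 \<nu>"
  by (rule IP_interval[OF le0 IP_0 _ not_eig_first])

lemma IP_iff:
  assumes k: "1 \<le> k" "k + 2 \<le> n" and l1: "least_pos_eig k l1" and l2'': "least_pos_eig (k + 1) l2''"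
    and l2: "if k = 1 then l2 = l2'' else \<exists>l2'. least_pos_eig (k - 1) l2' \<and> l2 = min l2' l2''"
  shows "IP k \<mu> \<longleftrightarrow> - l2 \<le> \<mu> \<and> \<mu> < l1"
proof -
  have k': "k < n" "Suc k < n" using k by auto
  have up: "IP (Suc k) \<nu>" if "0 \<le> \<nu>" "\<nu> < l2" for \<nu>
  proof (rule IP_below_least[OF _ _ that(1)])
    show "\<nu> < l2''" using l2 that(2) by (auto split: if_splits)
  qed (use k l2'' in auto)
  have down: "IP (k - 1) \<nu>" if "0 \<le> \<nu>" "\<nu> < l2" for \<nu>
  proof (cases "k = 1")
    case True
    then show ?thesis using IP_first[OF that(1)] by simp
  next
    case False
    then obtain l2' where l2': "least_pos_eig (k - 1) l2'" "l2 = min l2' l2''" using l2 by auto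
    show ?thesis by (rule IP_below_least[OF _ l2'(1) that(1)]) (use l2' that k in auto)
  qed
  show ?thesis
  proof
    assume IP: "IP k \<mu>"
    have "\<mu> < l1"
      using not_IP_above_least[OF less_imp_le[OF k'(1)] l1] IP by (meson not_le)
    moreover have "- l2 \<le> \<mu>"
    proof (rule ccontr)
      assume "\<not> - l2 \<le> \<mu>"
      then have lt: "l2 < - \<mu>" by simp
      \<comment> \<open>\<open>l2\<close> is the least positive eigenvalue of one of the two
        neighbours, and the failure result for that neighbour applies.\<close>
      have "\<not> IP k (- (- \<mu>))"
      proof (cases "k \<noteq> 1 \<and> l2 \<noteq> l2''")
        case True
        then obtain l2' where l2': "least_pos_eig (k - 1) l2'" "l2 = l2'" using l2 by (auto simp: min_def split: if_splits)
        show ?thesis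
          by (rule not_IP_beyond'[of k l2']) (use l2' lt True k in \<open>auto simp: least_pos_eig_def\<close>)
      next
        case False
        then have "l2 = l2''" using l2 by (auto split: if_splits)
        then show ?thesis
          using l2'' lt k'(2) by (intro not_IP_beyond[of k l2'']) (auto simp: least_pos_eig_def)
      qed
      with IP show False by simp
    qed
    ultimately show "- l2 \<le> \<mu> \<and> \<mu> < l1" by simp
  next
    assume \<mu>: "- l2 \<le> \<mu> \<and> \<mu> < l1"
    show "IP k \<mu>"
    proof (cases "0 \<le> \<mu>")
      case True
      then show ?thesis using IP_below_least[OF less_imp_le[OF k'(1)] l1] \<mu> by simp
    next
      case False
      have "IP k (- (- \<mu>))"
        by (rule IP_negative[OF k(1) k'(1) _ _ up down]) (use False \<mu> in auto)
      then show ?thesis by simp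
    qed
  qed
qed

end

section \<open>Translation to the given derivatives and operators\<close>

lemma nderiv_Suc: "nderiv a b (Suc i) u = (\<lambda>t. vector_derivative (nderiv a b i u) (at t within {a..b}))"
  by (simp add: nderiv_def)

lemma nderiv_0: "nderiv a b 0 u = u"
  by (simp add: nderiv_def)

lemma Cm_on_tower:
  assumes "Cm_on a b n u"
  shows "tower {a..b} n (\<lambda>i. nderiv a b i u)"
  unfolding tower_def
proof (intro conjI allI impI ballI)
  fix i t assume "i < n" "t \<in> {a..b}"
  then have "nderiv a b i u differentiable at t within {a..b}"
    using assms by (simp add: Cm_on_def differentiable_on_def)
  then show "(nderiv a b i u has_real_derivative nderiv a b (Suc i) u t) (at t within {a..b})"
    unfolding nderiv_Suc has_real_derivative_iff_has_vector_derivative by (simp add: vector_derivative_works)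
qed (use assms in \<open>simp add: Cm_on_def\<close>)

lemma nderiv_tower:
  assumes g: "tower {a..b} n g" and ab: "a < b"
  shows "i \<le> n \<Longrightarrow> t \<in> {a..b} \<Longrightarrow> nderiv a b i (g 0) t = g i t"
proof (induction i arbitrary: t)
  case 0
  then show ?case by (simp add: nderiv_0)
next
  case (Suc i)
  have "(g i has_real_derivative g (Suc i) t) (at t within {a..b})"
    using tower_deriv[OF g] Suc.prems by simp
  then have "(nderiv a b i (g 0) has_real_derivative g (Suc i) t) (at t within {a..b})"
    by (rule has_field_derivative_transform_within[of _ _ _ _ 1]) (use Suc in auto)
  then have "(nderiv a b i (g 0) has_vector_derivative g (Suc i) t) (at t within cbox a b)"
    by (simp add: has_real_derivative_iff_has_vector_derivative cbox_interval)
  moreover have "t \<in> cbox a b" using Suc.prems by (simp add: cbox_interval)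
  ultimately show ?case
    unfolding nderiv_Suc using vector_derivative_within_cbox[OF ab] by (simp add: cbox_interval)
qed

lemma tower_Cm_on:
  assumes g: "tower {a..b} n g" and ab: "a < b"
  shows "Cm_on a b n (g 0)"
  unfolding Cm_on_def
proof (intro conjI allI impI)
  fix i assume i: "i < n"
  show "nderiv a b i (g 0) differentiable_on {a..b}"
    unfolding differentiable_on_def
  proof
    fix t assume t: "t \<in> {a..b}"
    have "(nderiv a b i (g 0) has_real_derivative g (Suc i) t) (at t within {a..b})"
      by (rule has_field_derivative_transform_within[OF tower_deriv[OF g i t], of 1])
        (use nderiv_tower[OF g ab] i t in auto)
    then show "nderiv a b i (g 0) differentiable at t within {a..b}"
      unfolding has_field_derivative_def differentiable_def by blast
  qed
next
  show "continuous_on {a..b} (nderiv a b n (g 0))"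
    by (rule continuous_on_eq[OF tower_continuous[OF g order_refl]]) (simp add: nderiv_tower[OF g ab])
qed

definition op_coeffs :: "nat \<Rightarrow> (nat \<Rightarrow> real \<Rightarrow> real) \<Rightarrow> real \<Rightarrow> nat \<Rightarrow> real \<Rightarrow> real" where
  "op_coeffs n c M i t = c (n - i) t + (if i = 0 then M else 0)"

lemma T_op_eq:
  assumes "0 < n" and "\<And>i. i \<le> n \<Longrightarrow> nderiv a b i u t = g i t"
  shows "T_op a b n c M' u t = lin_op n (op_coeffs n c M) g t + (M' - M) * g 0 t"
proof -
  have "(\<Sum>j=1..<n. c j t * nderiv a b (n - j) u t) = (\<Sum>i=1..<n. c (n - i) t * g i t)"
    by (rule sum.reindex_bij_witness[of _ "\<lambda>i. n - i" "\<lambda>j. n - j"]) (use assms(2) in auto)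
  moreover have "(\<Sum>i<n. op_coeffs n c M i t * g i t) = (c n t + M) * g 0 t + (\<Sum>i=1..<n. c (n - i) t * g i t)"
  proof -
    have "{..<n} = insert 0 {1..<n}" using assms(1) by auto
    then show ?thesis by (simp add: op_coeffs_def)
  qed
  moreover have "u t = g 0 t" using assms(2)[of 0] by (simp add: nderiv_0)
  ultimately show ?thesis
    using assms(2)[of n] by (simp add: T_op_def lin_op_def algebra_simps)
qed

lemma zero_mult_ge:
  assumes "q \<le> n" "\<And>i. i < q \<Longrightarrow> nderiv a b i u t = 0"
  shows "q \<le> zero_mult a b n u t"
proof -
  have "zero_mult a b n u t = n \<or> nderiv a b (zero_mult a b n u t) u t \<noteq> 0"
    unfolding zero_mult_def by (rule LeastI[of _ n]) simp
  with assms show ?thesis by (metis not_le)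
qed

text \<open>The multiplicities at \<open>s\<close> and \<open>t\<close> alone already reach
  \<open>n\<close>. For \<open>q = 0\<close> or \<open>q = n\<close> only one of the two points has
  to be a zero, whence the separate cases.\<close>

lemma disconjugate_two_point:
  assumes disc: "disconjugate a b n c M" and n: "0 < n"
    and u: "Cm_on a b n u" "\<forall>t\<in>{a..b}. T_op a b n c M u t = 0"
    and st: "a \<le> s" "s < t" "t \<le> b" and q: "q \<le> n" "\<forall>i<q. nderiv a b i u s = 0" "\<forall>i<n-q. nderiv a b i u t = 0"
  shows "\<forall>r\<in>{a..b}. u r = 0"
proof (rule ccontr)
  assume "\<not> ?thesis"
  then have "nontrivial_on a b u" by (auto simp: nontrivial_on_def)
  with disc u have fin: "finite {t\<in>{a..b}. u t = 0}"
    and lt: "(\<Sum>t | t \<in> {a..b} \<and> u t = 0. zero_mult a b n u t) < n"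
    by (auto simp: disconjugate_def)
  let ?Z = "{t. t \<in> {a..b} \<and> u t = 0}"
  let ?z = "zero_mult a b n u"
  have zs: "q \<le> ?z s" using zero_mult_ge[of q n a b u s] q by blast
  have zt: "n - q \<le> ?z t" using zero_mult_ge[of "n - q" n a b u t] q by simp
  have s: "s \<in> ?Z" if "0 < q"
  proof -
    have "nderiv a b 0 u s = 0" using q(2) that by blast
    then show ?thesis using st by (simp add: nderiv_0)
  qed
  have t: "t \<in> ?Z" if "q < n"
  proof -
    have "nderiv a b 0 u t = 0" using q(3) that by (meson zero_less_diff)
    then show ?thesis using st by (simp add: nderiv_0)
  qed
  have "n \<le> (\<Sum>t\<in>?Z. ?z t)"
  proof -
    consider "q = 0" | "q = n" | "0 < q" "q < n" using q(1) by linarith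
    then show ?thesis
    proof cases
      case 1
      then have "n \<le> ?z t" "t \<in> ?Z" using zt t n by auto
      then show ?thesis using member_le_sum[of t ?Z ?z] fin by simp
    next
      case 2
      then have "n \<le> ?z s" "s \<in> ?Z" using zs s n by auto
      then show ?thesis using member_le_sum[of s ?Z ?z] fin by simp
    next
      case 3
      have "n \<le> (\<Sum>t\<in>{s, t}. ?z t)" using zs zt st q(1) by simp
      also have "\<dots> \<le> (\<Sum>t\<in>?Z. ?z t)" by (rule sum_mono2) (use fin s t 3 in auto)
      finally show ?thesis .
    qed
  qed
  with lt show False by simp
qed

lemma disconjugate_imp_disconj_op:
  assumes "0 < n" "a < b" "\<And>j. 1 \<le> j \<Longrightarrow> j \<le> n \<Longrightarrow> Cm_on a b (n - j) (c j)" and disc: "disconjugate a b n c M"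
  shows "disconj_op a b n (op_coeffs n c M)"
proof
  fix i assume i: "i < n"
  then have "Cm_on a b (n - (n - i)) (c (n - i))" by (intro assms(3)) auto
  from tower_continuous[OF Cm_on_tower[OF this], of 0]
  have "continuous_on {a..b} (c (n - i))" by (simp add: nderiv_0)
  then show "continuous_on {a..b} (op_coeffs n c M i)"
    unfolding op_coeffs_def by (intro continuous_intros)
next
  fix g s t q
  assume g: "tower {a..b} n g" "\<forall>r\<in>{a..b}. lin_op n (op_coeffs n c M) g r = 0"
    and st: "a \<le> s" "s < t" "t \<le> b" and q: "q \<le> n" "\<forall>i<q. g i s = 0" "\<forall>i<n - q. g i t = 0"
  note nd = nderiv_tower[OF g(1) assms(2)]
  show "\<forall>r\<in>{a..b}. g 0 r = 0"
  proof (rule disconjugate_two_point[OF disc assms(1) tower_Cm_on[OF g(1) assms(2)] _ st q(1)])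
    show "\<forall>t\<in>{a..b}. T_op a b n c M (g 0) t = 0"
    proof
      fix r assume r: "r \<in> {a..b}"
      have "T_op a b n c M (g 0) r = lin_op n (op_coeffs n c M) g r + (M - M) * g 0 r"
        by (rule T_op_eq[OF assms(1)]) (rule nd[OF _ r])
      then show "T_op a b n c M (g 0) r = 0" using g(2) r by simp
    qed
  qed (use nd q st in auto)
qed (use assms in auto)

locale disconj_problem =
  fixes a b :: real and n :: nat and c :: "nat \<Rightarrow> real \<Rightarrow> real" and Mbar :: real
  assumes n0: "0 < n" and aless: "a < b"
    and coeffs: "\<And>j. 1 \<le> j \<Longrightarrow> j \<le> n \<Longrightarrow> Cm_on a b (n - j) (c j)"
    and disconjugate: "disconjugate a b n c Mbar"
begin

sublocale disconj_op a b n "op_coeffs n c Mbar"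
  by (rule disconjugate_imp_disconj_op[OF n0 aless coeffs disconjugate])

lemma X_space_imp_X: "u \<in> X_space a b n m \<Longrightarrow> X m (\<lambda>i. nderiv a b i u)"
  by (simp add: X_space_def X_def Cm_on_tower)

lemma X_imp_X_space:
  assumes g: "X m g" and m: "m \<le> n"
  shows "g 0 \<in> X_space a b n m"
  using g m aless nderiv_tower[OF X_ts[OF g] aless] tower_Cm_on[OF X_ts[OF g] aless]
  by (auto simp: X_space_def X_def)

lemma T_op_u: "T_op a b n c M u t = L (\<lambda>i. nderiv a b i u) t + (M - Mbar) * u t"
  using T_op_eq[OF n0, of a b u t "\<lambda>i. nderiv a b i u" c M Mbar] by (simp add: nderiv_0)

lemma T_op_X:
  assumes "X m g" "t \<in> {a..b}"
  shows "T_op a b n c M (g 0) t = L g t + (M - Mbar) * g 0 t"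
  by (rule T_op_eq[OF n0]) (rule nderiv_tower[OF X_ts[OF assms(1)] aless _ assms(2)])

lemma sign_cancel: "(-1 :: real) ^ (n - m) * x = (-1) ^ (n - m) * y \<longleftrightarrow> x = y"
  by simp

text \<open>\<open>op m\<close> carries the sign \<open>(-1) ^ (n - m)\<close>, so positive and
  negative eigenvalues trade places when \<open>n - m\<close> is odd.\<close>

lemma eigenvalue_in_iff:
  assumes m: "m \<le> n"
  shows "eigenvalue_in a b n c Mbar m r \<longleftrightarrow> eig m ((-1) ^ (n - m) * r)"
proof
  assume "eigenvalue_in a b n c Mbar m r"
  then obtain u where u: "u \<in> X_space a b n m" "nontrivial_on a b u" "\<forall>t\<in>{a..b}. T_op a b n c Mbar u t = r * u t"
    unfolding eigenvalue_in_def by blast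
  then have "op m (\<lambda>i. nderiv a b i u) t = (-1) ^ (n - m) * r * nderiv a b 0 u t" if "t \<in> {a..b}" for t
    using that T_op_u[of Mbar u t] by (simp add: op_def nderiv_0 mult.assoc)
  then show "eig m ((-1) ^ (n - m) * r)"
    unfolding eig_def using X_space_imp_X[OF u(1)] u(2)
    by (intro exI[of _ "\<lambda>i. nderiv a b i u"]) (simp add: nontrivial_on_def nderiv_0)
next
  assume "eig m ((-1) ^ (n - m) * r)"
  then obtain g s where g: "X m g" "s \<in> {a..b}" "g 0 s \<noteq> 0" "\<forall>t\<in>{a..b}. op m g t = (-1) ^ (n - m) * r * g 0 t"
    unfolding eig_def by blast
  have "T_op a b n c Mbar (g 0) t = r * g 0 t" if t: "t \<in> {a..b}" for t
  proof -
    have "(-1) ^ (n - m) * L g t = (-1) ^ (n - m) * (r * g 0 t)"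
      using g(4) t by (simp add: op_def mult.assoc)
    then show ?thesis using T_op_X[OF g(1) t, of Mbar] unfolding sign_cancel by simp
  qed
  then show "eigenvalue_in a b n c Mbar m r"
    unfolding eigenvalue_in_def nontrivial_on_def using X_imp_X_space[OF g(1) m] g(2,3) by blast
qed

lemma least_pos_iff:
  assumes "m \<le> n" "even (n - m)"
  shows "least_pos_eigenvalue a b n c Mbar m r \<longleftrightarrow> least_pos_eig m r"
  using assms unfolding least_pos_eigenvalue_def least_pos_eig_def eigenvalue_in_iff[OF assms(1)] by auto

lemma biggest_neg_iff:
  assumes "m \<le> n" "odd (n - m)"
  shows "biggest_neg_eigenvalue a b n c Mbar m r \<longleftrightarrow> least_pos_eig m (- r)"
proof -
  have "(\<forall>\<mu>. eig m (- \<mu>) \<and> \<mu> < 0 \<longrightarrow> \<mu> \<le> r) \<longleftrightarrow> (\<forall>\<mu>. 0 < \<mu> \<longrightarrow> eig m \<mu> \<longrightarrow> - r \<le> \<mu>)"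
    by (metis minus_minus neg_0_less_iff_less neg_less_0_iff_less neg_le_iff_le)
  then show ?thesis
    using assms unfolding biggest_neg_eigenvalue_def least_pos_eig_def eigenvalue_in_iff[OF assms(1)] by auto
qed

lemma inverse_positive_iff:
  assumes k: "k \<le> n" "even (n - k)"
  shows "inverse_positive a b n c M k \<longleftrightarrow> IP k (Mbar - M)"
proof
  assume inv: "inverse_positive a b n c M k"
  show "IP k (Mbar - M)"
    unfolding IP_def
  proof (intro allI impI)
    fix g assume g: "X k g" "\<forall>t\<in>{a..b}. (Mbar - M) * g 0 t \<le> op k g t"
    have "0 \<le> T_op a b n c M (g 0) t" if "t \<in> {a..b}" for t
    proof -
      have "(Mbar - M) * g 0 t \<le> op k g t" using g(2) that by blast
      then show ?thesis using T_op_X[OF g(1) that, of M] k(2) by (simp add: op_def algebra_simps)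
    qed
    then show "\<forall>t\<in>{a..b}. 0 \<le> g 0 t"
      using inv X_imp_X_space[OF g(1) k(1)] unfolding inverse_positive_def by blast
  qed
next
  assume IP: "IP k (Mbar - M)"
  show "inverse_positive a b n c M k"
    unfolding inverse_positive_def
  proof (intro ballI impI)
    fix u t assume u: "u \<in> X_space a b n k" "\<forall>t\<in>{a..b}. 0 \<le> T_op a b n c M u t" and t: "t \<in> {a..b}"
    have "0 \<le> nderiv a b 0 u t"
    proof (rule IP_D[OF IP X_space_imp_X[OF u(1)] _ t])
      fix s assume "s \<in> {a..b}"
      then have "0 \<le> T_op a b n c M u s" using u(2) by blast
      then show "(Mbar - M) * nderiv a b 0 u s \<le> op k (\<lambda>i. nderiv a b i u) s"
        using k(2) by (simp add: T_op_u op_def nderiv_0 algebra_simps)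
    qed
    then show "0 \<le> u t" by (simp add: nderiv_0)
  qed
qed

text \<open>For odd \<open>n - k\<close> the operator with parameter \<open>M\<close> is minus the
  shift of \<open>op k\<close> by \<open>M - Mbar\<close>, so passing from \<open>u\<close> to
  \<open>- u\<close> turns inverse negativity into inverse positivity.\<close>

lemma inverse_negative_iff:
  assumes k: "k \<le> n" "odd (n - k)"
  shows "inverse_negative a b n c M k \<longleftrightarrow> IP k (M - Mbar)"
proof
  assume inv: "inverse_negative a b n c M k"
  show "IP k (M - Mbar)"
    unfolding IP_def
  proof (intro allI impI)
    fix h assume h: "X k h" "\<forall>t\<in>{a..b}. (M - Mbar) * h 0 t \<le> op k h t"
    define g where "g = (\<lambda>i t. - h i t)"
    have g: "X k g" unfolding g_def by (rule X_minus[OF h(1)])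
    have "0 \<le> T_op a b n c M (g 0) t" if "t \<in> {a..b}" for t
    proof -
      have "(M - Mbar) * h 0 t \<le> op k h t" using h(2) that by blast
      moreover have "L g t = op k h t"
        using op_minus[of k h t] k(2) by (simp add: op_def g_def)
      ultimately show ?thesis using T_op_X[OF g that, of M] by (simp add: g_def algebra_simps)
    qed
    then have "\<forall>t\<in>{a..b}. g 0 t \<le> 0"
      using inv X_imp_X_space[OF g k(1)] unfolding inverse_negative_def by blast
    then show "\<forall>t\<in>{a..b}. 0 \<le> h 0 t" by (simp add: g_def)
  qed
next
  assume IP: "IP k (M - Mbar)"
  show "inverse_negative a b n c M k"
    unfolding inverse_negative_def
  proof (intro ballI impI)
    fix u t assume u: "u \<in> X_space a b n k" "\<forall>t\<in>{a..b}. 0 \<le> T_op a b n c M u t" and t: "t \<in> {a..b}"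
    have "0 \<le> - nderiv a b 0 u t"
    proof (rule IP_D[OF IP X_minus[OF X_space_imp_X[OF u(1)]] _ t])
      fix s assume "s \<in> {a..b}"
      then have "0 \<le> T_op a b n c M u s" using u(2) by blast
      then show "(M - Mbar) * - nderiv a b 0 u s \<le> op k (\<lambda>i t. - nderiv a b i u t) s"
        using k(2) unfolding op_minus by (simp add: T_op_u op_def nderiv_0 algebra_simps)
    qed
    then show "u t \<le> 0" by (simp add: nderiv_0)
  qed
qed

end

text \<open>Each extremal eigenvalue is determined uniquely by its predicate, so the existential
  form asserts its existence and identifies the interval at once. The last conjunct justifies the
  convention for \<open>k = 1\<close>.\<close>

theorem theorem3p1:
  fixes n k :: nat and a b Mbar :: real and c :: "nat \<Rightarrow> real \<Rightarrow> real"
  assumes "1 \<le> k" and "k + 2 \<le> n"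
    and "a < b"
    and "\<And>j. 1 \<le> j \<Longrightarrow> j \<le> n \<Longrightarrow> Cm_on a b (n - j) (c j)"
    and "disconjugate a b n c Mbar"
  shows
    "(even (n - k) \<longrightarrow>
        (\<exists>l1 l2 l2''.
           least_pos_eigenvalue a b n c Mbar k l1 \<and>
           biggest_neg_eigenvalue a b n c Mbar (k + 1) l2'' \<and>
           (if k = 1 then l2 = l2''
            else \<exists>l2'. biggest_neg_eigenvalue a b n c Mbar (k - 1) l2' \<and> l2 = max l2' l2'') \<and>
           (\<forall>M. inverse_positive a b n c M k \<longleftrightarrow> M \<in> {Mbar - l1 <.. Mbar - l2})))
     \<and>
     (odd (n - k) \<longrightarrow>
        (\<exists>l1 l2 l2''.
           biggest_neg_eigenvalue a b n c Mbar k l1 \<and>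
           least_pos_eigenvalue a b n c Mbar (k + 1) l2'' \<and>
           (if k = 1 then l2 = l2''
            else \<exists>l2'. least_pos_eigenvalue a b n c Mbar (k - 1) l2' \<and> l2 = min l2' l2'') \<and>
           (\<forall>M. inverse_negative a b n c M k \<longleftrightarrow> M \<in> {Mbar - l2 ..< Mbar - l1})))
     \<and>
     (k = 1 \<longrightarrow> (\<forall>r. \<not> eigenvalue_in a b n c Mbar (k - 1) r))"
proof -
  have n0: "0 < n" using assms(2) by simp
  interpret disconj_problem a b n c Mbar
    by unfold_locales (use n0 assms(3-5) in auto)
  have k: "k \<le> n" "k < n" "k + 1 \<le> n" "k + 1 < n" "k - 1 \<le> n" using assms(1,2) by auto
  obtain l where l: "least_pos_eig k l" using least_pos_eig_exists[OF assms(1) k(2)] by blast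
  obtain L'' where L'': "least_pos_eig (k + 1) L''" using least_pos_eig_exists[of "k + 1"] k by auto
  have "\<exists>L'. least_pos_eig (k - 1) L'" if "k \<noteq> 1"
    by (rule least_pos_eig_exists) (use that assms(1,2) in auto)
  then obtain L' where L': "k \<noteq> 1 \<Longrightarrow> least_pos_eig (k - 1) L'" by blast
  define L2 where "L2 = (if k = 1 then L'' else min L' L'')"
  have iff: "IP k \<mu> \<longleftrightarrow> - L2 \<le> \<mu> \<and> \<mu> < l" for \<mu>
    by (rule IP_iff[OF assms(1,2) l L'']) (use L' in \<open>auto simp: L2_def\<close>)
  \<comment> \<open>The neighbouring spaces have the opposite parity: their least positive
    eigenvalue in the normalized sense is a biggest negative one of the given operator exactly when
    that of \<open>X k\<close> is a least positive one.\<close>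
  have par: "even (n - (k + 1)) \<longleftrightarrow> odd (n - k)" "even (n - (k - 1)) \<longleftrightarrow> odd (n - k)"
    using assms(1,2) by (auto simp: even_diff_nat)
  have first: "\<not> eigenvalue_in a b n c Mbar (k - 1) r" if "k = 1" for r
    using that eigenvalue_in_iff[of 0 r] not_eig_first by simp
  show ?thesis
  proof (intro conjI impI allI, goal_cases)
    case ev: 1
    have par': "odd (n - (k + 1))" "odd (n - (k - 1))" using par ev by blast+
    show ?case
    proof (rule exI[of _ l], rule exI[of _ "- L2"], rule exI[of _ "- L''"], intro conjI allI)
      show "least_pos_eigenvalue a b n c Mbar k l" using least_pos_iff[OF k(1) ev] l by simp
      show "biggest_neg_eigenvalue a b n c Mbar (k + 1) (- L'')"
        using biggest_neg_iff[OF k(3) par'(1), of "- L''"] L'' by (simp only: minus_minus)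
      show "if k = 1 then - L2 = - L''
        else \<exists>l2'. biggest_neg_eigenvalue a b n c Mbar (k - 1) l2' \<and> - L2 = max l2' (- L'')"
      proof (cases "k = 1")
        case False
        have "biggest_neg_eigenvalue a b n c Mbar (k - 1) (- L')"
          using biggest_neg_iff[OF k(5) par'(2), of "- L'"] L'[OF False] by (simp only: minus_minus)
        moreover have "- L2 = max (- L') (- L'')" using False by (simp add: L2_def minus_min_eq_max)
        ultimately show ?thesis using False by auto
      qed (simp add: L2_def)
      show "inverse_positive a b n c M k \<longleftrightarrow> M \<in> {Mbar - l <.. Mbar - - L2}" for M
        unfolding inverse_positive_iff[OF k(1) ev] iff by auto
    qed
  next
    case od: 2
    have par': "even (n - (k + 1))" "even (n - (k - 1))" using par od by blast+
    show ?case
    proof (rule exI[of _ "- l"], rule exI[of _ L2], rule exI[of _ L''], intro conjI allI)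
      show "biggest_neg_eigenvalue a b n c Mbar k (- l)" using biggest_neg_iff[OF k(1) od, of "- l"] l by (simp only: minus_minus)
      show "least_pos_eigenvalue a b n c Mbar (k + 1) L''"
        using least_pos_iff[OF k(3) par'(1)] L'' by blast
      show "if k = 1 then L2 = L''
        else \<exists>l2'. least_pos_eigenvalue a b n c Mbar (k - 1) l2' \<and> L2 = min l2' L''"
      proof (cases "k = 1")
        case False
        have "least_pos_eigenvalue a b n c Mbar (k - 1) L'"
          using least_pos_iff[OF k(5) par'(2)] L'[OF False] by blast
        then show ?thesis using False by (auto simp: L2_def)
      qed (simp add: L2_def)
      show "inverse_negative a b n c M k \<longleftrightarrow> M \<in> {Mbar - L2 ..< Mbar - - l}" for M
        unfolding inverse_negative_iff[OF k(1) od] iff by auto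
    qed
  next
    case (3 r)
    then show ?case by (rule first)
  qed
qed

end
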